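(* Let $\mathsf{k}$ be a field, let $E$ be a finite directed graph and let $L_{\mathsf{k}}(E)$ be its Leavitt path algebra, equipped with its standard filtration $\mathcal{L}=\{W_n\}_{n\ge 0}$. Then $L_{\mathsf{k}}(E)$ is a PI-algebra if and only if the sequence $\{\dim(W_n/W_{n-1})\}_{n\ge 0}$ is bounded.
   Context: A directed graph is a tuple $E=(E^0,E^1,s,r)$ with $E^0$ (vertices) and $E^1$ (edges) disjoint sets and $s,r:E^1\to E^0$ maps (source and range); it is finite if $E^0$ and $E^1$ are finite. A path is a sequence of edges $p=e_1e_2\cdots e_n$ with $r(e_i)=s(e_{i+1})$ for $1\le i\le n-1$; its length is $l(p)=n$, with $s(p)=s(e_1)$, $r(p)=r(e_n)$. Vertices $v$ are regarded as paths of length $0$ with $s(v)=r(v)=v$. $\mathrm{Path}(E)$ is the set of all paths. The Leavitt path algebra $L_{\mathsf{k}}(E)$ is the (associative) $\mathsf{k}$-algebra generated by $\{v:v\in E^0\}$, $\{e:e\in E^1\}$, $\{e^*:e\in E^1\}$ subject to the relations: (i) $v_iv_j=\delta_{i,j}v_i$ for $v_i,v_j\in E^0$; (ii) $s(e)e=e=e\,r(e)$ and $r(e)e^*=e^*=e^*s(e)$ for $e\in E^1$; (CK1) $e^*e'=\delta_{e,e'}r(e)$ for $e,e'\in E^1$; (CK2) $\sum_{e\in E^1,\,s(e)=v}ee^*=v$ for every $v\in E^0$ which is not a sink (i.e. which is the source of some edge). For a path $q=e_1\cdots e_n$, $q^*=e_n^*\cdots e_1^*$, and $v^*=v$ for a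 vertex $v$. The standard filtration of $L_{\mathsf{k}}(E)$ is $\mathcal{L}=\{W_n\}_{n\ge0}$ with $W_n=\operatorname{span}\{pq^* : p,q\in\mathrm{Path}(E),\ r(p)=r(q),\ l(p)+l(q)\le n\}$, and $W_{-1}=0$ by convention. For a commutative associative unital ring $R$, an $R$-algebra $A$ is a PI-algebra if there is a noncommutative polynomial $f(x_1,\dots,x_n)$ in the free associative unital $R$-algebra $R\langle x_1,x_2,\dots\rangle$, at least one of whose monomials of maximal degree has coefficient $1$, such that $f(a_1,\dots,a_n)=0$ for all $a_1,\dots,a_n\in A$. Here $R=\mathsf{k}$. *)

theory Defs
  imports
    "Graph_Theory.Arc_Walk"
    "Jordan_Normal_Form.VS_Connect"
    "HOL-Library.Poly_Mapping"
    "HOL-Algebra.AbelCoset"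
begin

section \<open>Free associative algebras\<close>

text \<open>
  Words are written additively, so that \<open>'x free_monoid \<Rightarrow>\<^sub>0 'k\<close> with the
  convolution product of \<open>Poly_Mapping\<close> is the free associative unital
  \<open>'k\<close>-algebra on \<open>'x\<close>.
\<close>

datatype 'x free_monoid = Letters (letters: "'x list")

instantiation free_monoid :: (type) monoid_add
begin

definition zero_free_monoid :: "'x free_monoid"
  where "zero_free_monoid = Letters []"

definition plus_free_monoid :: "'x free_monoid \<Rightarrow> 'x free_monoid \<Rightarrow> 'x free_monoid"
  where "plus_free_monoid u v = Letters (letters u @ letters v)"

instance
  by standard (simp_all add: zero_free_monoid_def plus_free_monoid_def)

end

type_synonym ('x, 'k) free_algebra = "'x free_monoid \<Rightarrow>\<^sub>0 'k"

definition gen :: "'x \<Rightarrow> ('x, 'k::comm_ring_1) free_algebra"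
  where "gen x = Poly_Mapping.single (Letters [x]) 1"

definition scale :: "'k \<Rightarrow> ('x, 'k) free_algebra \<Rightarrow> ('x, 'k::comm_ring_1) free_algebra"
  where "scale c f = Poly_Mapping.single 0 c * f"

text \<open>The non-unital free algebra on a set \<open>X\<close> of letters: no constant terms.\<close>

definition nonunital_free_algebra :: "'x set \<Rightarrow> ('x, 'k::comm_ring_1) free_algebra set"
  where "nonunital_free_algebra X =
    {f. \<forall>w \<in> Poly_Mapping.keys f. letters w \<noteq> [] \<and> set (letters w) \<subseteq> X}"

inductive_set generated_ideal ::
  "('x, 'k::comm_ring_1) free_algebra set \<Rightarrow> ('x, 'k) free_algebra set \<Rightarrow> ('x, 'k) free_algebra set"
  for F R
  where
    base: "f \<in> R \<Longrightarrow> f \<in> generated_ideal F R"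
  | zero: "0 \<in> generated_ideal F R"
  | add: "f \<in> generated_ideal F R \<Longrightarrow> g \<in> generated_ideal F R \<Longrightarrow> f + g \<in> generated_ideal F R"
  | scale: "f \<in> generated_ideal F R \<Longrightarrow> scale c f \<in> generated_ideal F R"
  | left: "h \<in> F \<Longrightarrow> f \<in> generated_ideal F R \<Longrightarrow> h * f \<in> generated_ideal F R"
  | right: "f \<in> generated_ideal F R \<Longrightarrow> h \<in> F \<Longrightarrow> f * h \<in> generated_ideal F R"


section \<open>PI-algebras\<close>

definition eval_word :: "('k, 'a) module \<Rightarrow> ('x \<Rightarrow> 'a) \<Rightarrow> 'x free_monoid \<Rightarrow> 'a"
  where "eval_word A a w = foldr (\<lambda>x y. a x \<otimes>\<^bsub>A\<^esub> y) (letters w) \<one>\<^bsub>A\<^esub>"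

definition eval_poly ::
  "('k::comm_ring_1, 'a) module \<Rightarrow> ('x, 'k) free_algebra \<Rightarrow> ('x \<Rightarrow> 'a) \<Rightarrow> 'a"
  where "eval_poly A f a =
    (\<Oplus>\<^bsub>A\<^esub>w \<in> Poly_Mapping.keys f. Poly_Mapping.lookup f w \<odot>\<^bsub>A\<^esub> eval_word A a w)"

text \<open>
  The variables of \<open>f\<close> are indexed by \<^typ>\<open>nat\<close>; only the finitely many values
  \<open>a i\<close> with \<open>i\<close> occurring in \<open>f\<close> matter. A constant term \<open>c\<close> of \<open>f\<close> evaluates
  to \<open>c\<close> times the unit of \<open>A\<close>.
\<close>

definition PI_algebra :: "('k::comm_ring_1, 'a) module \<Rightarrow> bool"
  where "PI_algebra A \<longleftrightarrow>
    (\<exists>f :: (nat, 'k) free_algebra.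
      (\<exists>w \<in> Poly_Mapping.keys f. Poly_Mapping.lookup f w = 1 \<and>
        (\<forall>w' \<in> Poly_Mapping.keys f. length (letters w') \<le> length (letters w))) \<and>
      (\<forall>a. (\<forall>i. a i \<in> carrier A) \<longrightarrow> eval_poly A f a = \<zero>\<^bsub>A\<^esub>))"


section \<open>Leavitt path algebras\<close>

datatype ('v, 'e) lpa_gen = Vertex 'v | Edge 'e | Ghost 'e

definition lpa_gens :: "('v, 'e) pre_digraph \<Rightarrow> ('v, 'e) lpa_gen set"
  where "lpa_gens E = Vertex ` verts E \<union> Edge ` arcs E \<union> Ghost ` arcs E"

abbreviation vx :: "'v \<Rightarrow> (('v, 'e) lpa_gen, 'k::field) free_algebra"
  where "vx v \<equiv> gen (Vertex v)"

abbreviation ed :: "'e \<Rightarrow> (('v, 'e) lpa_gen, 'k::field) free_algebra"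
  where "ed e \<equiv> gen (Edge e)"

abbreviation gh :: "'e \<Rightarrow> (('v, 'e) lpa_gen, 'k::field) free_algebra"
  where "gh e \<equiv> gen (Ghost e)"

text \<open>Each relation \<open>a = b\<close> is given as the element \<open>a - b\<close>.\<close>

definition lpa_relations :: "('v, 'e) pre_digraph \<Rightarrow> (('v, 'e) lpa_gen, 'k::field) free_algebra set"
  where "lpa_relations E =
      {vx u * vx v - (if u = v then vx u else 0) | u v. u \<in> verts E \<and> v \<in> verts E}
    \<union> {vx (tail E e) * ed e - ed e | e. e \<in> arcs E}
    \<union> {ed e * vx (head E e) - ed e | e. e \<in> arcs E}
    \<union> {vx (head E e) * gh e - gh e | e. e \<in> arcs E}
    \<union> {gh e * vx (tail E e) - gh e | e. e \<in> arcs E}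
    \<union> {gh e * ed e' - (if e = e' then vx (head E e) else 0) | e e'. e \<in> arcs E \<and> e' \<in> arcs E}
    \<union> {(\<Sum>e \<in> out_arcs E v. ed e * gh e) - vx v | v. v \<in> verts E \<and> out_arcs E v \<noteq> {}}"

definition lpa_ideal :: "('v, 'e) pre_digraph \<Rightarrow> (('v, 'e) lpa_gen, 'k::field) free_algebra set"
  where "lpa_ideal E = generated_ideal (nonunital_free_algebra (lpa_gens E)) (lpa_relations E)"

definition lpa_class ::
  "('v, 'e) pre_digraph \<Rightarrow> (('v, 'e) lpa_gen, 'k::field) free_algebra
    \<Rightarrow> (('v, 'e) lpa_gen, 'k) free_algebra set"
  where "lpa_class E f = (+) f ` lpa_ideal E"

text \<open>
  The quotient of the non-unital free algebra by the ideal of relations. (In the unital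
  free algebra the same relations would present the algebra with a further unit adjoined.)
  For a finite graph the sum of the vertices is a unit element.
\<close>

definition leavitt_path_algebra ::
  "'k::field itself \<Rightarrow> ('v, 'e) pre_digraph \<Rightarrow> ('k, (('v, 'e) lpa_gen, 'k) free_algebra set) module"
  where "leavitt_path_algebra k E =
    \<lparr>carrier = lpa_class E ` nonunital_free_algebra (lpa_gens E),
     mult = (\<lambda>A B. \<Union>a \<in> A. \<Union>b \<in> B. lpa_class E (a * b)),
     one = lpa_class E (\<Sum>v \<in> verts E. vx v),
     zero = lpa_class E 0,
     add = (\<lambda>A B. \<Union>a \<in> A. \<Union>b \<in> B. lpa_class E (a + b)),
     smult = (\<lambda>c A. \<Union>a \<in> A. lpa_class E (scale c a))\<rparr>"

text \<open>
  A path is a directed walk of \<open>Arc_Walk\<close>; the first argument is its source, needed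
  for the paths \<open>[]\<close> of length 0.
\<close>

definition path_elt :: "'v \<Rightarrow> 'e awalk \<Rightarrow> (('v, 'e) lpa_gen, 'k::field) free_algebra"
  where "path_elt u p = (if p = [] then vx u else prod_list (map ed p))"

definition ghost_path_elt :: "'v \<Rightarrow> 'e awalk \<Rightarrow> (('v, 'e) lpa_gen, 'k::field) free_algebra"
  where "ghost_path_elt u p = (if p = [] then vx u else prod_list (map gh (rev p)))"

text \<open>The index is an integer so that the \<open>(-1)\<close>st term is the span of \<open>{}\<close>, i.e. zero.\<close>

definition std_filtration ::
  "'k::field itself \<Rightarrow> ('v, 'e) pre_digraph \<Rightarrow> int \<Rightarrow> (('v, 'e) lpa_gen, 'k) free_algebra set set"
  where "std_filtration k E n =
    LinearCombinations.module.span class_ring (leavitt_path_algebra k E)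
      {lpa_class E (path_elt u p * ghost_path_elt u' q) | u p u' q w.
        pre_digraph.awalk E u p w \<and> pre_digraph.awalk E u' q w \<and>
        int (length p + length q) \<le> n}"


section \<open>Quotient spaces\<close>

text \<open>\<open>mult\<close> and \<open>one\<close> play no role in the vector space structure.\<close>

definition quotient_space :: "('k, 'a) module \<Rightarrow> 'a set \<Rightarrow> ('k, 'a set) module"
  where "quotient_space V W =
    \<lparr>carrier = a_rcosets\<^bsub>V\<^esub> W, mult = undefined, one = undefined,
     zero = W, add = set_add V,
     smult = (\<lambda>c A. \<Union>a \<in> A. W +>\<^bsub>V\<^esub> (c \<odot>\<^bsub>V\<^esub> a))\<rparr>"

definition filtration_quotient ::
  "'k::field itself \<Rightarrow> ('v, 'e) pre_digraph \<Rightarrow> int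
    \<Rightarrow> ('k, (('v, 'e) lpa_gen, 'k) free_algebra set set) module"
  where "filtration_quotient k E n =
    quotient_space (leavitt_path_algebra k E\<lparr>carrier := std_filtration k E n\<rparr>)
      (std_filtration k E (n - 1))"

end

theory Submission
  imports Defs
begin

text \<open>
  Both conditions say that no cycle of the graph has an exit, that is, that every vertex on a
  closed path emits exactly one edge. All computations take place in the free algebra modulo the
  ideal of relations, where the elements \<open>pq\<^sup>*\<close> with \<open>r(p) = r(q)\<close> span
  (\<open>A0_subset_span\<close>).

  Suppose that \<open>c\<close> is a closed path at \<open>v\<close> and that \<open>f\<close> is an edge out of \<open>v\<close> other than
  the first edge of \<open>c\<close>. The algebra acts on the functions on a set of points, over each
  vertex infinitely many, such that every point over a vertex that is not a sink has the form
  \<open>e \<cdot> z\<close> for exactly one edge \<open>e\<close> and one point \<open>z\<close> (\<open>rep_ideal\<close>). The paths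
  \<open>p\<^sub>i = c\<^sup>if\<close> send a point to pairwise different points, so the elements
  \<open>p\<^sub>ip\<^sub>j\<^sup>*\<close> act like infinitely many matrix units. Given a polynomial, let the
  variables be sums of such matrix units in which a word of coefficient 1 spells a path of
  indices from \<open>0\<close> to its length; the corresponding entry of the value of the polynomial is
  that coefficient, so the polynomial is not an identity (\<open>not_PI_if_cycle_exit\<close>). In the same
  representation, a difference of two matrix entries vanishes on all \<open>pq\<^sup>*\<close> of length less
  than \<open>n\<close>, and such differences separate the \<open>m + 1\<close> elements
  \<open>c\<^sup>iee\<^sup>*(c\<^sup>*)\<^sup>j\<close> with \<open>i + j = m\<close>, where \<open>e\<close> is the first edge of \<open>c\<close>
  and \<open>n = ml(c) + 2\<close>. So \<open>dim (W\<^sub>n/W\<^sub>n\<^sub>-\<^sub>1) \<ge> m + 1\<close>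
  (\<open>dim_filtration_quotient_ge\<close>).

  Suppose now that no cycle has an exit. A path starting on a cycle is then determined by its
  length, and modulo the relations \<open>pq\<^sup>*\<close>, for paths \<open>p\<close> and \<open>q\<close> starting at given
  vertices on cycles, depends on \<open>l(p) - l(q)\<close> only (\<open>monomials_between_eqv\<close>). Since every
  path of length at least the number of vertices has reached a cycle, the algebra is spanned by
  finitely many families such that \<open>tzt' = t'zt\<close> for \<open>t\<close>, \<open>t'\<close> in the same family and
  arbitrary \<open>z\<close> (\<open>same_shape_commute\<close>). A standard polynomial in more variables than there are
  families is multilinear and alternating, so it is an identity (\<open>PI_if_no_exit\<close>). As for the
  filtration, if \<open>p\<close> and \<open>q\<close> are both long, then they end in the same edge, which emerges
  from a vertex with no other outgoing edge, and the relation (CK2) shortens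
  \<open>pq\<^sup>*\<close> by two. In the remaining generators of \<open>W\<^sub>n\<close> modulo
  \<open>W\<^sub>n\<^sub>-\<^sub>1\<close> one of the paths is short and the other is determined by its length and
  an initial segment, so that their number is bounded independently of \<open>n\<close>
  (\<open>dim_filtration_quotient_le\<close>).
\<close>

section \<open>Free algebras as vector spaces\<close>

definition wd :: "'x list \<Rightarrow> ('x, 'k::comm_ring_1) free_algebra"
  where "wd u = Poly_Mapping.single (Letters u) 1"

lemma lookup_scale [simp]: "Poly_Mapping.lookup (scale c f) w = c * Poly_Mapping.lookup f w"
  by (simp add: scale_def mult_map_scale_conv_mult[symmetric] Poly_Mapping.map.rep_eq when_def)

lemma scale_single: "scale c (Poly_Mapping.single w d) = Poly_Mapping.single w (c * d)"
  by (rule poly_mapping_eqI) (simp add: lookup_single when_def)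

interpretation fa: vector_space "scale :: 'k::field \<Rightarrow> ('x, 'k) free_algebra \<Rightarrow> ('x, 'k) free_algebra"
  by unfold_locales (auto intro!: poly_mapping_eqI simp: lookup_add algebra_simps)

lemma scale_mult_left: "scale c f * g = scale c (f * g)"
  by (simp add: scale_def mult.assoc)

lemma wd_Nil: "wd [] = 1"
  by (simp add: wd_def zero_free_monoid_def[symmetric])

lemma wd_append: "wd (u @ v) = wd u * wd v"
  by (simp add: wd_def mult_single plus_free_monoid_def)

lemma wd_mult [simp]: "wd u * wd v = wd (u @ v)"
  by (simp add: wd_append)

lemma gen_eq_wd: "gen x = wd [x]"
  by (simp add: gen_def wd_def)

lemma prod_list_gen: "prod_list (map (\<lambda>e. gen (f e)) p) = wd (map f p)"
  by (induction p) (simp_all add: wd_Nil gen_eq_wd)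

lemma free_algebra_expand:
  "f = (\<Sum>w\<in>Poly_Mapping.keys f. scale (Poly_Mapping.lookup f w) (wd (letters w)))"
proof (rule poly_mapping_eqI)
  fix v
  have "(\<Sum>w\<in>Poly_Mapping.keys f. Poly_Mapping.lookup f w * (1 when w = v)) =
    (if v \<in> Poly_Mapping.keys f then Poly_Mapping.lookup f v else 0)"
    by (simp add: when_def if_distrib[of "\<lambda>x. _ * x"] sum.delta cong: if_cong)
  then show "Poly_Mapping.lookup f v =
    Poly_Mapping.lookup (\<Sum>w\<in>Poly_Mapping.keys f. scale (Poly_Mapping.lookup f w) (wd (letters w))) v"
    by (simp add: lookup_sum wd_def lookup_single in_keys_iff)
qed

lemma wd_induct [case_names add scale wd]:
  fixes f :: "('x, 'k::field) free_algebra"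
  assumes "\<And>f g. P f \<Longrightarrow> P g \<Longrightarrow> P (f + g)" "\<And>c f. P f \<Longrightarrow> P (scale c f)" "\<And>u. P (wd u)"
  shows "P f"
proof -
  have P0: "P 0"
    using assms(2)[of "wd []" 0] assms(3) by simp
  have "P (\<Sum>w\<in>A. scale (Poly_Mapping.lookup f w) (wd (letters w)))" if "finite A" for A
    using that by induction (auto intro: assms P0)
  then show ?thesis
    by (subst free_algebra_expand) simp
qed

lemma mult_scale_right:
  fixes f :: "('x, 'k::field) free_algebra"
  shows "f * scale c g = scale c (f * g)"
proof -
  have *: "f * Poly_Mapping.single 0 c = scale c f"
  proof (induction f rule: wd_induct)
    case (add f g)
    then show ?case by (simp only: distrib_right fa.scale_right_distrib)
  next
    case (scale d f)
    then show ?case by (simp only: scale_mult_left fa.scale_left_commute)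
  next
    case (wd u)
    then show ?case by (simp add: wd_def scale_single mult_single)
  qed
  show ?thesis
    unfolding scale_def[of c g] mult.assoc[symmetric] * by (rule scale_mult_left)
qed

lemma fa_sum_keys_superset:
  assumes "finite A" "Poly_Mapping.keys f \<subseteq> A"
  shows "(\<Sum>w\<in>Poly_Mapping.keys f. scale (Poly_Mapping.lookup f w) (g w)) =
    (\<Sum>w\<in>A. scale (Poly_Mapping.lookup f w) (g w))"
  using assms by (intro sum.mono_neutral_left) (auto simp: in_keys_iff scale_def)

text \<open>
  The variant with constants lets empty products occur as factors; an ideal of the non-unital
  algebra is closed under multiplication by its elements as well.
\<close>

definition free_algebra_on :: "'x set \<Rightarrow> ('x, 'k::comm_ring_1) free_algebra set"
  where "free_algebra_on X = {f. \<forall>w \<in> Poly_Mapping.keys f. set (letters w) \<subseteq> X}"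

lemma keys_scale_subset: "Poly_Mapping.keys (scale c f) \<subseteq> Poly_Mapping.keys f"
  by (auto simp: in_keys_iff)

lemma nonunital_subset: "nonunital_free_algebra X \<subseteq> free_algebra_on X"
  by (auto simp: nonunital_free_algebra_def free_algebra_on_def)

lemma subspace_nonunital: "fa.subspace (nonunital_free_algebra X)"
  unfolding fa.subspace_def nonunital_free_algebra_def
  by (auto dest!: set_mp[OF keys_add] set_mp[OF keys_scale_subset])

lemma subspace_free_algebra_on: "fa.subspace (free_algebra_on X)"
  unfolding fa.subspace_def free_algebra_on_def
  by (auto dest!: set_mp[OF keys_add] set_mp[OF keys_scale_subset])

lemma wd_in_free_algebra_on: "wd u \<in> free_algebra_on X" if "set u \<subseteq> X"
  using that by (simp add: wd_def free_algebra_on_def)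

lemma wd_in_nonunital: "wd u \<in> nonunital_free_algebra X" if "u \<noteq> []" "set u \<subseteq> X"
  using that by (simp add: wd_def nonunital_free_algebra_def)

lemma free_algebra_on_span:
  "(free_algebra_on X :: ('x, 'k::field) free_algebra set) = fa.span {wd u | u. set u \<subseteq> X}"
  (is "?L = ?R")
proof
  show "?R \<subseteq> ?L"
    by (rule fa.span_minimal) (auto simp: subspace_free_algebra_on wd_in_free_algebra_on)
  show "?L \<subseteq> ?R"
  proof
    fix f assume "f \<in> ?L"
    then show "f \<in> ?R"
      by (subst free_algebra_expand, intro fa.span_sum fa.span_scale fa.span_base)
        (auto simp: free_algebra_on_def)
  qed
qed

lemma nonunital_span:
  "(nonunital_free_algebra X :: ('x, 'k::field) free_algebra set) = fa.span {wd u | u. u \<noteq> [] \<and> set u \<subseteq> X}"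
  (is "?L = ?R")
proof
  show "?R \<subseteq> ?L"
    by (rule fa.span_minimal) (auto simp: subspace_nonunital wd_in_nonunital)
  show "?L \<subseteq> ?R"
  proof
    fix f assume "f \<in> ?L"
    then show "f \<in> ?R"
      by (subst free_algebra_expand, intro fa.span_sum fa.span_scale fa.span_base)
        (auto simp: nonunital_free_algebra_def)
  qed
qed

lemma subspace_left_factor: "fa.subspace {f. f * g \<in> S}" if "fa.subspace S"
  using that by (auto simp: fa.subspace_def algebra_simps scale_mult_left)

lemma subspace_right_factor: "fa.subspace {f. g * f \<in> S}" if "fa.subspace S"
  using that by (auto simp: fa.subspace_def algebra_simps mult_scale_right)

lemma one_in_free_algebra_on: "1 \<in> free_algebra_on X"
  using wd_in_free_algebra_on[of "[]" X] by (simp add: wd_Nil)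

lemma free_algebra_on_mult:
  assumes "f \<in> free_algebra_on X" "g \<in> free_algebra_on X"
  shows "f * g \<in> free_algebra_on X"
  using assms
  by (auto simp: free_algebra_on_def plus_free_monoid_def dest!: set_mp[OF keys_mult]) blast+

lemma nonunital_mult_left:
  assumes "f \<in> free_algebra_on X" "g \<in> nonunital_free_algebra X"
  shows "f * g \<in> nonunital_free_algebra X"
  using assms
  by (auto simp: free_algebra_on_def nonunital_free_algebra_def plus_free_monoid_def
      dest!: set_mp[OF keys_mult]) blast+

lemma nonunital_mult_right:
  assumes "f \<in> nonunital_free_algebra X" "g \<in> free_algebra_on X"
  shows "f * g \<in> nonunital_free_algebra X"
  using assms
  by (auto simp: free_algebra_on_def nonunital_free_algebra_def plus_free_monoid_def
      dest!: set_mp[OF keys_mult]) blast+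

section \<open>Ideals\<close>

lemma subspace_generated_ideal: "fa.subspace (generated_ideal F R)"
  by (auto simp: fa.subspace_def intro: generated_ideal.intros)

lemma generated_ideal_subset:
  fixes R :: "('x, 'k::field) free_algebra set"
  assumes "R \<subseteq> nonunital_free_algebra X"
  shows "generated_ideal (nonunital_free_algebra X) R \<subseteq> nonunital_free_algebra X"
proof
  fix f assume "f \<in> generated_ideal (nonunital_free_algebra X) R"
  then show "f \<in> nonunital_free_algebra X"
  proof induction
    case (left h f)
    then show ?case using nonunital_mult_left nonunital_subset by blast
  next
    case (right f h)
    then show ?case using nonunital_mult_left nonunital_subset by blast
  qed (use assms in \<open>auto intro: fa.subspace_0 fa.subspace_add fa.subspace_scale subspace_nonunital\<close>)
qed

lemma generated_ideal_mult_left: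
  fixes R :: "('x, 'k::field) free_algebra set"
  assumes "f \<in> generated_ideal (nonunital_free_algebra X) R" "h \<in> free_algebra_on X"
  shows "h * f \<in> generated_ideal (nonunital_free_algebra X) R"
proof -
  let ?I = "generated_ideal (nonunital_free_algebra X) R"
  have "free_algebra_on X \<subseteq> {h. h * f \<in> ?I}"
    unfolding free_algebra_on_span
  proof (rule fa.span_minimal)
    have "wd u * f \<in> ?I" if "set u \<subseteq> X" for u
      using assms(1) wd_in_nonunital[OF _ that]
      by (cases "u = []") (auto simp: wd_Nil intro: generated_ideal.left)
    then show "{wd u |u. set u \<subseteq> X} \<subseteq> {h. h * f \<in> ?I}"
      by auto
  qed (intro subspace_left_factor subspace_generated_ideal)
  with assms show ?thesis by blast
qed

lemma generated_ideal_mult_right: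
  fixes R :: "('x, 'k::field) free_algebra set"
  assumes "f \<in> generated_ideal (nonunital_free_algebra X) R" "h \<in> free_algebra_on X"
  shows "f * h \<in> generated_ideal (nonunital_free_algebra X) R"
proof -
  let ?I = "generated_ideal (nonunital_free_algebra X) R"
  have "free_algebra_on X \<subseteq> {h. f * h \<in> ?I}"
    unfolding free_algebra_on_span
  proof (rule fa.span_minimal)
    have "f * wd u \<in> ?I" if "set u \<subseteq> X" for u
      using assms(1) wd_in_nonunital[OF _ that]
      by (cases "u = []") (auto simp: wd_Nil intro: generated_ideal.right)
    then show "{wd u |u. set u \<subseteq> X} \<subseteq> {h. f * h \<in> ?I}"
      by auto
  qed (intro subspace_right_factor subspace_generated_ideal)
  with assms show ?thesis by blast
qed

section \<open>Linear images of subspaces\<close>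

text \<open>
  The Leavitt path algebra is a set of cosets, and a quotient of two of its subspaces a set of
  sets of cosets. Both are linear images of subspaces of the free algebra, and this locale lets
  one compute their sums, spans and dimensions there.
\<close>

locale linear_image =
  src: vector_space scl for scl :: "'k::field \<Rightarrow> 'b::ab_group_add \<Rightarrow> 'b" +
  fixes F :: "'b set" and \<pi> :: "'b \<Rightarrow> 'c" and M :: "('k, 'c) module"
  assumes subspace_F: "src.subspace F"
    and carrier_image: "carrier M = \<pi> ` F"
    and image_zero: "\<pi> 0 = \<zero>\<^bsub>M\<^esub>"
    and image_add: "f \<in> F \<Longrightarrow> g \<in> F \<Longrightarrow> \<pi> (f + g) = \<pi> f \<oplus>\<^bsub>M\<^esub> \<pi> g"
    and image_smult: "f \<in> F \<Longrightarrow> \<pi> (scl c f) = c \<odot>\<^bsub>M\<^esub> \<pi> f"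
begin

lemma add_closed: "f \<in> F \<Longrightarrow> g \<in> F \<Longrightarrow> f + g \<in> F"
  and smult_closed: "f \<in> F \<Longrightarrow> scl c f \<in> F"
  and zero_closed: "0 \<in> F"
  and neg_closed: "f \<in> F \<Longrightarrow> - f \<in> F"
  and diff_closed: "f \<in> F \<Longrightarrow> g \<in> F \<Longrightarrow> f - g \<in> F"
  using src.subspace_add[OF subspace_F] src.subspace_scale[OF subspace_F] src.subspace_0[OF subspace_F]
    src.subspace_neg[OF subspace_F] src.subspace_diff[OF subspace_F]
  by simp_all

lemma vectorspace_image: "vectorspace class_ring M"
proof (rule vs_criteria)
  show "field (class_ring :: 'k ring)"
    by (rule class_field)
  show "\<forall>v\<in>carrier M. \<exists>neg_v\<in>carrier M. v \<oplus>\<^bsub>M\<^esub> neg_v = \<zero>\<^bsub>M\<^esub>"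
    unfolding carrier_image
  proof
    fix v assume "v \<in> \<pi> ` F"
    then obtain f where "f \<in> F" "v = \<pi> f" by blast
    then show "\<exists>neg_v\<in>\<pi> ` F. v \<oplus>\<^bsub>M\<^esub> neg_v = \<zero>\<^bsub>M\<^esub>"
      by (intro bexI[of _ "\<pi> (- f)"]) (auto simp: image_add[symmetric] neg_closed image_zero[symmetric])
  qed
qed (auto simp: carrier_image image_add[symmetric] image_smult[symmetric] image_zero[symmetric]
    add_closed smult_closed zero_closed add_ac src.scale_left_distrib src.scale_right_distrib)

sublocale tgt: vectorspace class_ring M
  by (rule vectorspace_image)

lemma image_sum:
  assumes "finite A" "\<And>i. i \<in> A \<Longrightarrow> g i \<in> F"
  shows "\<pi> (\<Sum>i\<in>A. g i) = finsum M (\<lambda>i. \<pi> (g i)) A"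
  using assms
proof (induction A)
  case empty
  show ?case by (simp add: image_zero)
next
  case (insert x A)
  have "(\<Sum>i\<in>A. g i) \<in> F"
    using insert.prems by (intro src.subspace_sum[OF subspace_F]) auto
  with insert show ?case
    by (subst tgt.finsum_insert) (auto simp: image_add carrier_image)
qed

lemma image_lincomb:
  assumes "finite A" "\<And>i. i \<in> A \<Longrightarrow> g i \<in> F"
  shows "\<pi> (\<Sum>i\<in>A. scl (c i) (g i)) = finsum M (\<lambda>i. c i \<odot>\<^bsub>M\<^esub> \<pi> (g i)) A"
  using assms
  by (subst image_sum)
    (auto simp: smult_closed image_smult[symmetric] carrier_image intro!: tgt.finsum_cong')

lemma span_image:
  assumes "S \<subseteq> F"
  shows "tgt.span (\<pi> ` S) = \<pi> ` src.span S"
proof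
  show "tgt.span (\<pi> ` S) \<subseteq> \<pi> ` src.span S"
  proof
    fix x assume "x \<in> tgt.span (\<pi> ` S)"
    then obtain a A where A: "finite A" "A \<subseteq> \<pi> ` S" and x: "x = tgt.lincomb a A"
      unfolding tgt.span_def by blast
    define r where "r = inv_into S \<pi>"
    have r: "r v \<in> S" "\<pi> (r v) = v" if "v \<in> A" for v
      using that A(2) by (auto simp: r_def inv_into_into f_inv_into_f)
    have AM: "v \<in> carrier M" if "v \<in> A" for v
      using that A(2) assms by (auto simp: carrier_image)
    have "x = \<pi> (\<Sum>v\<in>A. scl (a v) (r v))"
      unfolding x tgt.lincomb_def using A(1) r assms
      by (subst image_lincomb) (auto intro!: tgt.finsum_cong' tgt.smult_closed intro: AM)
    moreover have "(\<Sum>v\<in>A. scl (a v) (r v)) \<in> src.span S"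
      using r by (intro src.span_sum src.span_scale src.span_base) auto
    ultimately show "x \<in> \<pi> ` src.span S" by blast
  qed
  have sub: "\<pi> ` S \<subseteq> carrier M"
    using assms by (auto simp: carrier_image)
  interpret sp: LinearCombinations.submodule class_ring "tgt.span (\<pi> ` S)" M
    by (rule tgt.span_is_submodule[OF sub])
  have "src.span S \<subseteq> {f \<in> F. \<pi> f \<in> tgt.span (\<pi> ` S)}"
  proof (rule src.span_minimal)
    show "S \<subseteq> {f \<in> F. \<pi> f \<in> tgt.span (\<pi> ` S)}"
      using assms tgt.in_own_span[OF sub] by auto
    show "src.subspace {f \<in> F. \<pi> f \<in> tgt.span (\<pi> ` S)}"
      using sp.zero_closed sp.m_closed sp.smult_closed
      by (auto simp: src.subspace_def zero_closed add_closed smult_closed image_add image_smult image_zero)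
  qed
  then show "\<pi> ` src.span S \<subseteq> tgt.span (\<pi> ` S)" by blast
qed

lemma image_eq_iff:
  assumes "f \<in> F" "g \<in> F"
  shows "\<pi> f = \<pi> g \<longleftrightarrow> \<pi> (f - g) = \<zero>\<^bsub>M\<^esub>"
proof -
  have "\<pi> f = \<pi> (f - g) \<oplus>\<^bsub>M\<^esub> \<pi> g"
    using image_add[OF diff_closed[OF assms] assms(2)] by simp
  moreover have "\<pi> (f - g) = \<pi> f \<oplus>\<^bsub>M\<^esub> \<pi> (- g)"
    using image_add[OF assms(1) neg_closed[OF assms(2)]] by simp
  moreover have "\<pi> g \<oplus>\<^bsub>M\<^esub> \<pi> (- g) = \<zero>\<^bsub>M\<^esub>"
    using image_add[OF assms(2) neg_closed[OF assms(2)]] by (simp add: image_zero)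
  moreover have "\<pi> g \<in> carrier M"
    using assms by (simp add: carrier_image)
  ultimately show ?thesis by (metis tgt.l_zero)
qed

lemma gen_set_image:
  assumes "S \<subseteq> F" "K \<subseteq> F" "\<And>f. f \<in> K \<Longrightarrow> \<pi> f = \<zero>\<^bsub>M\<^esub>" "F \<subseteq> src.span (S \<union> K)"
  shows "tgt.gen_set (\<pi> ` S)"
proof -
  have "\<pi> f \<in> \<pi> ` src.span S" if f_in: "f \<in> F" for f
  proof -
    obtain s k where f: "f = s + k" "s \<in> src.span S" "k \<in> src.span K"
      using subsetD[OF assms(4) f_in] unfolding src.span_Un by blast
    have sub: "src.span S \<subseteq> F" "src.span K \<subseteq> F"
      using assms(1,2) by (simp_all add: src.span_minimal subspace_F)
    have "src.span K \<subseteq> {f \<in> F. \<pi> f = \<zero>\<^bsub>M\<^esub>}"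
      by (rule src.span_minimal)
        (use assms(2,3) in \<open>auto simp: src.subspace_def zero_closed add_closed smult_closed image_add
          image_smult image_zero\<close>)
    then have "\<pi> f = \<pi> s"
      using f sub by (auto simp: image_eq_iff add_closed subset_iff)
    with f show ?thesis by blast
  qed
  moreover have "src.span S \<subseteq> F"
    using assms(1) subspace_F by (rule src.span_minimal)
  ultimately show ?thesis
    by (auto simp: span_image[OF assms(1)] carrier_image)
qed

lemma dim_image_le:
  assumes "finite S" "S \<subseteq> F" "K \<subseteq> F" "\<And>f. f \<in> K \<Longrightarrow> \<pi> f = \<zero>\<^bsub>M\<^esub>" "F \<subseteq> src.span (S \<union> K)"
  shows "tgt.dim \<le> card S"
proof -
  have "tgt.dim \<le> card (\<pi> ` S)"
    using gen_set_image[of S K] assms by (intro tgt.gen_ge_dim) (auto simp: carrier_image)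
  also have "\<dots> \<le> card S"
    using assms(1) by (rule card_image_le)
  finally show ?thesis .
qed

text \<open>
  The functionals \<open>\<phi> i\<close> vanish on the kernel of \<open>\<pi>\<close> and hence descend to \<open>M\<close>, where
  they are dual to the images of the \<open>b i\<close>. The finite set \<open>S\<close> guarantees that \<open>M\<close> has
  finite dimension; the dimension of any other space is an unspecified number.
\<close>

lemma le_dim_image:
  fixes \<phi> :: "'i \<Rightarrow> 'b \<Rightarrow> 'k"
  assumes fin: "finite S" "S \<subseteq> F" "K \<subseteq> F" "\<And>f. f \<in> K \<Longrightarrow> \<pi> f = \<zero>\<^bsub>M\<^esub>" "F \<subseteq> src.span (S \<union> K)"
    and J: "finite J" and b: "\<And>i. i \<in> J \<Longrightarrow> b i \<in> F"
    and lin: "\<And>i f g. \<phi> i (f + g) = \<phi> i f + \<phi> i g" "\<And>i c f. \<phi> i (scl c f) = c * \<phi> i f"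
    and ker: "\<And>i f. i \<in> J \<Longrightarrow> f \<in> F \<Longrightarrow> \<pi> f = \<zero>\<^bsub>M\<^esub> \<Longrightarrow> \<phi> i f = 0"
    and dual: "\<And>i j. i \<in> J \<Longrightarrow> j \<in> J \<Longrightarrow> \<phi> i (b j) = (if i = j then 1 else 0)"
  shows "card J \<le> tgt.dim"
proof -
  have fd: "tgt.fin_dim"
    unfolding tgt.fin_dim_def using gen_set_image[of S K] fin
    by (intro exI[of _ "\<pi> ` S"]) (auto simp: carrier_image)
  have phi0: "\<phi> i 0 = 0" for i
    using lin(2)[of i 0 0] by simp
  have phi_sum: "\<phi> i (\<Sum>j\<in>A. g j) = (\<Sum>j\<in>A. \<phi> i (g j))" for i A and g :: "'i \<Rightarrow> 'b"
    by (induction A rule: infinite_finite_induct) (auto simp: phi0 lin)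
  have phi_diff: "\<phi> i (f - g) = \<phi> i f - \<phi> i g" for i f g
    using lin(1)[of i "f - g" g] by simp
  have inj: "inj_on (\<lambda>i. \<pi> (b i)) J"
  proof (rule inj_onI)
    fix i j assume ij: "i \<in> J" "j \<in> J" "\<pi> (b i) = \<pi> (b j)"
    then have "\<phi> i (b i - b j) = 0"
      by (intro ker) (auto simp: b diff_closed image_eq_iff[symmetric])
    then show "i = j"
      using ij by (simp add: phi_diff dual split: if_splits)
  qed
  have li: "tgt.lin_indpt ((\<lambda>i. \<pi> (b i)) ` J)"
  proof
    assume "tgt.lin_dep ((\<lambda>i. \<pi> (b i)) ` J)"
    then obtain A a v where A: "finite A" "A \<subseteq> (\<lambda>i. \<pi> (b i)) ` J" "tgt.lincomb a A = \<zero>\<^bsub>M\<^esub>" "v \<in> A" "a v \<noteq> 0"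
      unfolding tgt.lin_dep_def by auto
    then obtain J' where J': "J' \<subseteq> J" "A = (\<lambda>i. \<pi> (b i)) ` J'"
      by (auto simp: subset_image_iff)
    have inj': "inj_on (\<lambda>i. \<pi> (b i)) J'"
      using inj J'(1) by (rule inj_on_subset)
    have finJ': "finite J'"
      using J J'(1) by (rule rev_finite_subset)
    obtain i where i: "i \<in> J'" "v = \<pi> (b i)"
      using A(4) J'(2) by auto
    define s where "s = (\<Sum>j\<in>J'. scl (a (\<pi> (b j))) (b j))"
    have bF: "b j \<in> F" if "j \<in> J'" for j
      using that J'(1) b by auto
    have "\<pi> s = tgt.lincomb a A"
      unfolding s_def tgt.lincomb_def J'(2) using finJ' bF inj'
      by (subst image_lincomb, simp, simp, subst tgt.finsum_reindex)
        (auto simp: carrier_image image_smult[symmetric] smult_closed)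
    then have "\<phi> i s = 0"
      using A(3) i J'(1) bF
      by (intro ker) (auto simp: s_def intro!: src.subspace_sum[OF subspace_F] smult_closed)
    moreover have "\<phi> i s = (\<Sum>j\<in>J'. a (\<pi> (b j)) * (if i = j then 1 else 0))"
      unfolding s_def phi_sum lin(2) using i(1) by (intro sum.cong refl) (simp add: dual subsetD[OF J'(1)])
    moreover have "\<dots> = a v"
      using i finJ' by (simp add: if_distrib[of "\<lambda>x. _ * x"] sum.delta' cong: if_cong)
    ultimately show False using A(5) by simp
  qed
  have "card J = card ((\<lambda>i. \<pi> (b i)) ` J)"
    using inj by (simp add: card_image)
  also have "\<dots> \<le> tgt.dim"
    using b by (intro tgt.li_le_dim(2)[OF fd _ li]) (auto simp: carrier_image)
  finally show ?thesis .
qed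

end

section \<open>Computing modulo the relations\<close>

lemma UN_const_eq: "A \<noteq> {} \<Longrightarrow> (\<And>a. a \<in> A \<Longrightarrow> B a = C) \<Longrightarrow> (\<Union>a\<in>A. B a) = C"
  by auto

lemma lpa_gens_simps [simp]:
  "Vertex v \<in> lpa_gens E \<longleftrightarrow> v \<in> verts E"
  "Edge e \<in> lpa_gens E \<longleftrightarrow> e \<in> arcs E"
  "Ghost e \<in> lpa_gens E \<longleftrightarrow> e \<in> arcs E"
  by (auto simp: lpa_gens_def)

text \<open>
  The product \<open>pq\<^sup>*\<close> of paths ending in \<open>w\<close>. Writing down the vertex \<open>w\<close> between them makes
  it a single word and includes the paths of length zero without case distinction.
\<close>

definition path_ghost :: "'e list \<Rightarrow> 'v \<Rightarrow> 'e list \<Rightarrow> (('v, 'e) lpa_gen, 'k::comm_ring_1) free_algebra"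
  where "path_ghost p w q = wd (map Edge p @ Vertex w # map Ghost (rev q))"

context fin_digraph
begin

abbreviation A0 :: "(('a, 'b) lpa_gen, 'k::field) free_algebra set"
  where "A0 \<equiv> nonunital_free_algebra (lpa_gens G)"

abbreviation A1 :: "(('a, 'b) lpa_gen, 'k::field) free_algebra set"
  where "A1 \<equiv> free_algebra_on (lpa_gens G)"

lemma lpa_relations_subset: "(lpa_relations G :: (('a, 'b) lpa_gen, 'k::field) free_algebra set) \<subseteq> A0"
proof -
  note sub = fa.subspace_diff[OF subspace_nonunital] fa.subspace_sum[OF subspace_nonunital]
    fa.subspace_0[OF subspace_nonunital] wd_in_nonunital
  show ?thesis
    unfolding lpa_relations_def gen_eq_wd
    by (auto intro!: sub simp: out_arcs_def)
qed

lemma lpa_ideal_subset: "(lpa_ideal G :: (('a, 'b) lpa_gen, 'k::field) free_algebra set) \<subseteq> A0"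
  unfolding lpa_ideal_def by (rule generated_ideal_subset[OF lpa_relations_subset])

lemma subspace_lpa_ideal: "fa.subspace (lpa_ideal G)"
  unfolding lpa_ideal_def by (rule subspace_generated_ideal)

lemma lpa_ideal_mult_left:
  "f \<in> lpa_ideal G \<Longrightarrow> h \<in> A1 \<Longrightarrow> h * f \<in> (lpa_ideal G :: (('a, 'b) lpa_gen, 'k::field) free_algebra set)"
  unfolding lpa_ideal_def by (rule generated_ideal_mult_left)

lemma lpa_ideal_mult_right:
  "f \<in> lpa_ideal G \<Longrightarrow> h \<in> A1 \<Longrightarrow> f * h \<in> (lpa_ideal G :: (('a, 'b) lpa_gen, 'k::field) free_algebra set)"
  unfolding lpa_ideal_def by (rule generated_ideal_mult_right)

lemmas lpa_ideal_closed =
  fa.subspace_0[OF subspace_lpa_ideal] fa.subspace_add[OF subspace_lpa_ideal]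
  fa.subspace_diff[OF subspace_lpa_ideal] fa.subspace_neg[OF subspace_lpa_ideal]
  fa.subspace_scale[OF subspace_lpa_ideal]

definition eqv ::
  "(('a, 'b) lpa_gen, 'k::field) free_algebra \<Rightarrow> (('a, 'b) lpa_gen, 'k) free_algebra \<Rightarrow> bool" (infix "\<simeq>" 50)
  where "f \<simeq> g \<longleftrightarrow> f - g \<in> lpa_ideal G"

lemma eqv_refl [simp]: "f \<simeq> f"
  by (simp add: eqv_def lpa_ideal_closed)

lemma eqv_zero_iff: "f \<simeq> 0 \<longleftrightarrow> f \<in> lpa_ideal G"
  by (simp add: eqv_def)

lemma eqv_sym: "f \<simeq> g \<Longrightarrow> g \<simeq> f"
  unfolding eqv_def using lpa_ideal_closed(4)[of "f - g"] by simp

lemma eqv_trans [trans]: "f \<simeq> g \<Longrightarrow> g \<simeq> h \<Longrightarrow> f \<simeq> h"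
  unfolding eqv_def using lpa_ideal_closed(2)[of "f - g" "g - h"] by simp

lemma eqv_add: "f \<simeq> f' \<Longrightarrow> g \<simeq> g' \<Longrightarrow> f + g \<simeq> f' + g'"
  unfolding eqv_def using lpa_ideal_closed(2)[of "f - f'" "g - g'"] by (simp add: algebra_simps)

lemma eqv_scale: "f \<simeq> f' \<Longrightarrow> scale c f \<simeq> scale c f'"
  unfolding eqv_def using lpa_ideal_closed(5)[of "f - f'" c] by (simp add: fa.scale_right_diff_distrib)

lemma eqv_sum: "(\<And>i. i \<in> A \<Longrightarrow> f i \<simeq> g i) \<Longrightarrow> (\<Sum>i\<in>A. f i) \<simeq> (\<Sum>i\<in>A. g i)"
  by (induction A rule: infinite_finite_induct) (auto intro: eqv_add)

lemma eqv_mult_left: "f \<simeq> g \<Longrightarrow> h \<in> A1 \<Longrightarrow> h * f \<simeq> h * g"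
  unfolding eqv_def using lpa_ideal_mult_left[of "f - g" h] by (simp add: algebra_simps)

lemma eqv_mult_right: "f \<simeq> g \<Longrightarrow> h \<in> A1 \<Longrightarrow> f * h \<simeq> g * h"
  unfolding eqv_def using lpa_ideal_mult_right[of "f - g" h] by (simp add: algebra_simps)

lemma eqv_in_span: "f \<simeq> g \<Longrightarrow> g \<in> fa.span (S \<union> lpa_ideal G) \<Longrightarrow> f \<in> fa.span (S \<union> lpa_ideal G)"
  using fa.span_add[of "f - g" "S \<union> lpa_ideal G" g] fa.span_base[of "f - g" "S \<union> lpa_ideal G"]
  by (simp add: eqv_def)

lemma eqv_wd_left: "wd u \<simeq> f \<Longrightarrow> set x \<subseteq> lpa_gens G \<Longrightarrow> wd (x @ u) \<simeq> wd x * f"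
  by (simp add: wd_append eqv_mult_left wd_in_free_algebra_on del: wd_mult)

lemma eqv_wd_right: "wd u \<simeq> f \<Longrightarrow> set x \<subseteq> lpa_gens G \<Longrightarrow> wd (u @ x) \<simeq> f * wd x"
  by (simp add: wd_append eqv_mult_right wd_in_free_algebra_on del: wd_mult)

lemma relationI: "f - g \<in> lpa_relations G \<Longrightarrow> f \<simeq> g"
  by (simp add: eqv_def lpa_ideal_def generated_ideal.base)

lemma vertex_vertex:
  "u \<in> verts G \<Longrightarrow> v \<in> verts G \<Longrightarrow>
    wd [Vertex u, Vertex v] \<simeq> (if u = v then wd [Vertex u] else 0)"
  by (rule relationI)
    (simp only: lpa_relations_def gen_eq_wd wd_mult append.simps Un_iff mem_Collect_eq, blast)

lemma vertex_edge: "e \<in> arcs G \<Longrightarrow> wd [Vertex (tail G e), Edge e] \<simeq> wd [Edge e]"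
  by (rule relationI)
    (simp only: lpa_relations_def gen_eq_wd wd_mult append.simps Un_iff mem_Collect_eq, blast)

lemma edge_vertex: "e \<in> arcs G \<Longrightarrow> wd [Edge e, Vertex (head G e)] \<simeq> wd [Edge e]"
  by (rule relationI)
    (simp only: lpa_relations_def gen_eq_wd wd_mult append.simps Un_iff mem_Collect_eq, blast)

lemma vertex_ghost: "e \<in> arcs G \<Longrightarrow> wd [Vertex (head G e), Ghost e] \<simeq> wd [Ghost e]"
  by (rule relationI)
    (simp only: lpa_relations_def gen_eq_wd wd_mult append.simps Un_iff mem_Collect_eq, blast)

lemma ghost_vertex: "e \<in> arcs G \<Longrightarrow> wd [Ghost e, Vertex (tail G e)] \<simeq> wd [Ghost e]"
  by (rule relationI)
    (simp only: lpa_relations_def gen_eq_wd wd_mult append.simps Un_iff mem_Collect_eq, blast)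

lemma ghost_edge:
  "e \<in> arcs G \<Longrightarrow> e' \<in> arcs G \<Longrightarrow>
    wd [Ghost e, Edge e'] \<simeq> (if e = e' then wd [Vertex (head G e)] else 0)"
  by (rule relationI)
    (simp only: lpa_relations_def gen_eq_wd wd_mult append.simps Un_iff mem_Collect_eq, blast)

lemma sum_edge_ghost:
  "v \<in> verts G \<Longrightarrow> out_arcs G v \<noteq> {} \<Longrightarrow>
    (\<Sum>e\<in>out_arcs G v. wd [Edge e, Ghost e]) \<simeq> wd [Vertex v]"
  by (rule relationI)
    (simp only: lpa_relations_def gen_eq_wd wd_mult append.simps Un_iff mem_Collect_eq, blast)

lemma vertex_edge_if:
  assumes "x \<in> verts G" "e \<in> arcs G"
  shows "wd [Vertex x, Edge e] \<simeq> (if x = tail G e then wd [Edge e] else 0)"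
proof (cases "x = tail G e")
  case False
  have "wd [Vertex x, Edge e] \<simeq> wd [Vertex x] * wd [Vertex (tail G e), Edge e]"
    using eqv_wd_left[OF eqv_sym[OF vertex_edge], of e "[Vertex x]"] assms by simp
  also have "\<dots> = wd [Vertex x, Vertex (tail G e)] * wd [Edge e]" by simp
  also have "\<dots> \<simeq> 0 * wd [Edge e]"
    using assms False vertex_vertex[of x "tail G e"] by (intro eqv_mult_right wd_in_free_algebra_on) auto
  finally show ?thesis using False by simp
qed (use assms vertex_edge in simp)

lemma ghost_vertex_if:
  assumes "x \<in> verts G" "e \<in> arcs G"
  shows "wd [Ghost e, Vertex x] \<simeq> (if x = tail G e then wd [Ghost e] else 0)"
proof (cases "x = tail G e")
  case False
  have "wd [Ghost e, Vertex x] \<simeq> wd [Ghost e, Vertex (tail G e)] * wd [Vertex x]"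
    using eqv_wd_right[OF eqv_sym[OF ghost_vertex], of e "[Vertex x]"] assms by simp
  also have "\<dots> = wd [Ghost e] * wd [Vertex (tail G e), Vertex x]" by simp
  also have "\<dots> \<simeq> wd [Ghost e] * 0"
    using assms False vertex_vertex[of "tail G e" x] by (intro eqv_mult_left wd_in_free_algebra_on) auto
  finally show ?thesis using False by simp
qed (use assms ghost_vertex in simp)

section \<open>Multiplication of monomials\<close>

lemma awalk_set_arcs: "awalk u p w \<Longrightarrow> set p \<subseteq> arcs G"
  by (simp add: awalk_def)

lemma set_path_ghost_subset:
  assumes "awalk u p w" "awalk u' q w"
  shows "set (map Edge p @ Vertex w # map Ghost (rev q)) \<subseteq> lpa_gens G"
  using awalk_set_arcs[OF assms(1)] awalk_set_arcs[OF assms(2)] awalk_last_in_verts[OF assms(1)] by auto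

lemma path_ghost_in_A0: "awalk u p w \<Longrightarrow> awalk u' q w \<Longrightarrow> path_ghost p w q \<in> A0"
  unfolding path_ghost_def by (intro wd_in_nonunital set_path_ghost_subset) auto

lemma path_ghost_in_A1: "awalk u p w \<Longrightarrow> awalk u' q w \<Longrightarrow> path_ghost p w q \<in> A1"
  unfolding path_ghost_def by (intro wd_in_free_algebra_on set_path_ghost_subset)

lemma edges_in_A1: "awalk u p w \<Longrightarrow> wd (map Edge p) \<in> A1"
  using awalk_set_arcs by (intro wd_in_free_algebra_on) fastforce

lemma ghosts_in_A1: "awalk u p w \<Longrightarrow> wd (map Ghost (rev p)) \<in> A1"
  using awalk_set_arcs by (intro wd_in_free_algebra_on) fastforce

lemma vertex_in_A1: "v \<in> verts G \<Longrightarrow> wd [Vertex v] \<in> A1"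
  by (intro wd_in_free_algebra_on) auto

lemma path_ghost_Cons: "path_ghost (e # p) w q = wd [Edge e] * path_ghost p w q"
  by (simp add: path_ghost_def)

lemma path_ghost_append_left: "path_ghost (p @ p') w q = wd (map Edge p) * path_ghost p' w q"
  by (simp add: path_ghost_def)

lemma path_ghost_append_right: "path_ghost p w (q @ q') = path_ghost p w q' * wd (map Ghost (rev q))"
  by (simp add: path_ghost_def)

lemma vertex_path_ghost:
  assumes x: "x \<in> verts G" and p: "awalk u p w" and q: "awalk u' q w"
  shows "wd [Vertex x] * path_ghost p w q \<simeq> (if x = u then path_ghost p w q else 0)"
proof (cases p)
  case Nil
  have "wd [Vertex x, Vertex u] * wd (map Ghost (rev q)) \<simeq>
    (if x = u then wd [Vertex u] else 0) * wd (map Ghost (rev q))"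
    using p x vertex_vertex[of x u] by (intro eqv_mult_right ghosts_in_A1[OF q]) (auto split: if_splits)
  then show ?thesis
    using Nil p by (auto simp: path_ghost_def awalk_Nil_iff)
next
  case (Cons e p')
  then have e: "e \<in> arcs G" "u = tail G e" "awalk (head G e) p' w"
    using p by (auto simp: awalk_Cons_iff)
  have "wd [Vertex x, Edge e] * path_ghost p' w q \<simeq> (if x = u then wd [Edge e] else 0) * path_ghost p' w q"
    using e x vertex_edge_if[of x e] by (intro eqv_mult_right path_ghost_in_A1[OF e(3) q]) auto
  then show ?thesis
    using Cons by (auto simp: path_ghost_def)
qed

lemma path_ghost_vertex:
  assumes x: "x \<in> verts G" and p: "awalk u p w" and q: "awalk u' q w"
  shows "path_ghost p w q * wd [Vertex x] \<simeq> (if x = u' then path_ghost p w q else 0)"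
proof (cases q)
  case Nil
  have "wd (map Edge p) * wd [Vertex w, Vertex x] \<simeq>
    wd (map Edge p) * (if x = u' then wd [Vertex w] else 0)"
    using q x vertex_vertex[of w x] Nil
    by (intro eqv_mult_left edges_in_A1[OF p]) (auto simp: awalk_Nil_iff)
  then show ?thesis
    using Nil q by (auto simp: path_ghost_def awalk_Nil_iff)
next
  case (Cons e q')
  then have e: "e \<in> arcs G" "u' = tail G e" "awalk (head G e) q' w"
    using q by (auto simp: awalk_Cons_iff)
  have "path_ghost p w q' * wd [Ghost e, Vertex x] \<simeq> path_ghost p w q' * (if x = u' then wd [Ghost e] else 0)"
    using e x ghost_vertex_if[of x e] by (intro eqv_mult_left path_ghost_in_A1[OF p e(3)]) auto
  then show ?thesis
    using Cons by (auto simp: path_ghost_def)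
qed

lemma edge_path_ghost_zero:
  assumes e: "e \<in> arcs G" and p: "awalk u p w" and q: "awalk u' q w" and "u \<noteq> head G e"
  shows "path_ghost (e # p) w q \<simeq> 0"
proof -
  have "wd [Edge e] * path_ghost p w q \<simeq> wd [Edge e, Vertex (head G e)] * path_ghost p w q"
    by (intro eqv_mult_right eqv_sym[OF edge_vertex] e path_ghost_in_A1[OF p q])
  also have "\<dots> = wd [Edge e] * (wd [Vertex (head G e)] * path_ghost p w q)"
    by (simp add: mult.assoc[symmetric])
  also have "\<dots> \<simeq> wd [Edge e] * 0"
    using vertex_path_ghost[OF _ p q, of "head G e"] assms by (intro eqv_mult_left wd_in_free_algebra_on) auto
  finally show ?thesis by (simp add: path_ghost_Cons)
qed

lemma ghost_path_ghost_Cons: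
  assumes e: "e \<in> arcs G" and p: "awalk u (e' # p) w" and q: "awalk u' q w"
  shows "wd [Ghost e] * path_ghost (e' # p) w q \<simeq> (if e = e' then path_ghost p w q else 0)"
proof -
  have e': "e' \<in> arcs G" and p': "awalk (head G e') p w"
    using p by (auto simp: awalk_Cons_iff)
  have "wd [Ghost e] * path_ghost (e' # p) w q = wd [Ghost e, Edge e'] * path_ghost p w q"
    by (simp add: path_ghost_Cons mult.assoc[symmetric])
  also have "\<dots> \<simeq> (if e = e' then wd [Vertex (head G e)] else 0) * path_ghost p w q"
    by (intro eqv_mult_right ghost_edge e e' path_ghost_in_A1[OF p' q])
  also have "\<dots> \<simeq> (if e = e' then path_ghost p w q else 0)"
    using vertex_path_ghost[OF _ p' q, of "head G e'"] e' by auto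
  finally show ?thesis .
qed

lemma ghost_path_ghost_Nil:
  assumes e: "e \<in> arcs G" and w: "w \<in> verts G" and q: "awalk u' q w"
  shows "wd [Ghost e] * path_ghost [] w q \<simeq> (if w = tail G e then path_ghost [] (head G e) (q @ [e]) else 0)"
proof -
  have "wd [Ghost e] * path_ghost [] w q = wd [Ghost e, Vertex w] * wd (map Ghost (rev q))"
    by (simp add: path_ghost_def)
  also have "\<dots> \<simeq> (if w = tail G e then wd [Ghost e] else 0) * wd (map Ghost (rev q))"
    by (intro eqv_mult_right ghost_vertex_if e w ghosts_in_A1[OF q])
  also have "\<dots> \<simeq> (if w = tail G e then wd [Vertex (head G e), Ghost e] else 0) * wd (map Ghost (rev q))"
    by (intro eqv_mult_right ghosts_in_A1[OF q]) (auto intro: eqv_sym[OF vertex_ghost] e)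
  also have "\<dots> = (if w = tail G e then path_ghost [] (head G e) (q @ [e]) else 0)"
    by (simp add: path_ghost_def)
  finally show ?thesis .
qed

text \<open>
  Adjacent letters \<open>e\<^sup>*\<close> and \<open>e\<close> cancel, beginning with the first edge of \<open>q\<close>.
\<close>

lemma ghosts_path_ghost:
  assumes "awalk u q w" "awalk u (q @ r) w'" "awalk u' s w'"
  shows "wd (map Ghost (rev q)) * path_ghost (q @ r) w' s \<simeq>
    (path_ghost r w' s :: (('a, 'b) lpa_gen, 'k::field) free_algebra)"
  using assms
proof (induction q arbitrary: u)
  case (Cons e q)
  have e: "e \<in> arcs G" "awalk (head G e) q w" "awalk (head G e) (q @ r) w'"
    using Cons.prems by (auto simp: awalk_Cons_iff)
  have "wd (map Ghost (rev (e # q))) * path_ghost ((e # q) @ r) w' s =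
    (wd (map Ghost (rev q)) * (wd [Ghost e] * path_ghost (e # q @ r) w' s) ::
      (('a, 'b) lpa_gen, 'k) free_algebra)"
    by (simp add: mult.assoc[symmetric])
  also have "\<dots> \<simeq> wd (map Ghost (rev q)) * path_ghost (q @ r) w' s"
    using ghost_path_ghost_Cons[of e u e "q @ r" w' u' s] Cons.prems e
    by (intro eqv_mult_left ghosts_in_A1[OF e(2)]) auto
  also have "\<dots> \<simeq> path_ghost r w' s"
    by (rule Cons.IH[OF e(2,3) Cons.prems(3)])
  finally show ?case .
qed (simp add: wd_Nil)

text \<open>
  A product \<open>pq\<^sup>*p's\<^sup>*\<close> can be nonzero only if one of the paths \<open>q\<close> and \<open>p'\<close> is an
  initial segment of the other. This lemma and the next one compute it in the two cases.
\<close>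

lemma path_ghost_mult_left:
  assumes "awalk u p w" "awalk u' q w" "awalk u' (q @ r) w'" "awalk u'' s w'"
  shows "path_ghost p w q * path_ghost (q @ r) w' s \<simeq> path_ghost (p @ r) w' s"
proof -
  have r: "awalk w r w'"
    using assms(2,3) by (auto simp: awalk_append_iff)
  have "path_ghost p w q * path_ghost (q @ r) w' s =
    wd (map Edge p @ [Vertex w]) * (wd (map Ghost (rev q)) * path_ghost (q @ r) w' s)"
    by (simp add: path_ghost_def)
  also have "\<dots> \<simeq> wd (map Edge p @ [Vertex w]) * path_ghost r w' s"
    using set_path_ghost_subset[of u p w w "[]"] assms
    by (intro eqv_mult_left ghosts_path_ghost wd_in_free_algebra_on) (auto simp: awalk_Nil_iff)
  also have "\<dots> = wd (map Edge p) * (wd [Vertex w] * path_ghost r w' s)"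
    by (simp add: mult.assoc[symmetric])
  also have "\<dots> \<simeq> wd (map Edge p) * path_ghost r w' s"
    using vertex_path_ghost[OF _ r assms(4), of w] awalk_last_in_verts[OF assms(1)]
    by (intro eqv_mult_left edges_in_A1[OF assms(1)]) auto
  finally show ?thesis by (simp add: path_ghost_append_left)
qed

lemma path_ghost_mult_right:
  assumes "awalk u p w" "awalk u' (q @ r) w" "awalk u' q w'" "awalk u'' s w'"
  shows "path_ghost p w (q @ r) * path_ghost q w' s \<simeq> path_ghost p w (s @ r)"
proof -
  have r: "awalk w' r w"
    using assms(2,3) by (auto simp: awalk_append_iff)
  have "path_ghost p w (q @ r) * path_ghost q w' s =
    path_ghost p w r * (wd (map Ghost (rev q)) * path_ghost (q @ []) w' s)"
    by (simp add: path_ghost_append_right mult.assoc)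
  also have "\<dots> \<simeq> path_ghost p w r * path_ghost [] w' s"
    using assms by (intro eqv_mult_left ghosts_path_ghost path_ghost_in_A1[OF assms(1) r]) auto
  also have "\<dots> = path_ghost p w r * wd [Vertex w'] * wd (map Ghost (rev s))"
    by (simp add: path_ghost_def)
  also have "\<dots> \<simeq> path_ghost p w r * wd (map Ghost (rev s))"
    using path_ghost_vertex[OF _ assms(1) r, of w'] awalk_last_in_verts[OF assms(3)]
    by (intro eqv_mult_right ghosts_in_A1[OF assms(4)]) auto
  finally show ?thesis by (simp add: path_ghost_append_right)
qed

text \<open>
  The relation (CK2), applied to the vertex in the middle.
\<close>

lemma path_ghost_expand:
  assumes p: "awalk u p w" and q: "awalk u' q w" and w: "out_arcs G w \<noteq> {}"
  shows "path_ghost p w q \<simeq> (\<Sum>e\<in>out_arcs G w. path_ghost (p @ [e]) (head G e) (q @ [e]))"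
proof -
  have "path_ghost p w q = wd (map Edge p) * wd [Vertex w] * wd (map Ghost (rev q))"
    by (simp add: path_ghost_def)
  also have "\<dots> \<simeq> wd (map Edge p) * (\<Sum>e\<in>out_arcs G w. wd [Edge e, Ghost e]) * wd (map Ghost (rev q))"
    using awalk_last_in_verts[OF p] w
    by (intro eqv_mult_right eqv_mult_left edges_in_A1[OF p] ghosts_in_A1[OF q] eqv_sym[OF sum_edge_ghost])
  also have "\<dots> \<simeq> wd (map Edge p) * (\<Sum>e\<in>out_arcs G w. wd [Edge e, Vertex (head G e), Ghost e]) * wd (map Ghost (rev q))"
  proof (intro eqv_mult_right eqv_mult_left edges_in_A1[OF p] ghosts_in_A1[OF q] eqv_sum)
    fix e assume "e \<in> out_arcs G w"
    then show "wd [Edge e, Ghost e] \<simeq> wd [Edge e, Vertex (head G e), Ghost e]"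
      using eqv_wd_left[OF eqv_sym[OF vertex_ghost], of e "[Edge e]"] by simp
  qed
  also have "\<dots> = (\<Sum>e\<in>out_arcs G w. path_ghost (p @ [e]) (head G e) (q @ [e]))"
    by (simp add: sum_distrib_left sum_distrib_right path_ghost_def)
  finally show ?thesis .
qed

definition monomials :: "(('a, 'b) lpa_gen, 'k::field) free_algebra set"
  where "monomials = {path_ghost p w q | p w q. (\<exists>u. awalk u p w) \<and> (\<exists>u. awalk u q w)}"

text \<open>
  A generator times \<open>pq\<^sup>*\<close> is zero or again of this form: a vertex keeps or kills it, an edge
  lengthens \<open>p\<close>, and a ghost edge shortens \<open>p\<close> or, if \<open>p\<close> has length zero, lengthens \<open>q\<close>.
\<close>

lemma gen_monomial_in_span:
  assumes x: "x \<in> lpa_gens G" and m: "m \<in> monomials"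
  shows "wd [x] * m \<in> fa.span (monomials \<union> lpa_ideal G)"
proof -
  obtain p w q u u' where p: "awalk u p w" and q: "awalk u' q w" and m: "m = path_ghost p w q"
    using m by (auto simp: monomials_def)
  have base: "path_ghost p w q \<in> fa.span (monomials \<union> lpa_ideal G)" if "awalk u p w" "awalk u' q w" for p w q u u'
    using that by (intro fa.span_base) (auto simp: monomials_def)
  note zero = fa.span_zero[of "monomials \<union> lpa_ideal G"]
  consider v where "x = Vertex v" "v \<in> verts G" | e where "x = Edge e" "e \<in> arcs G"
    | e where "x = Ghost e" "e \<in> arcs G"
    using x by (auto simp: lpa_gens_def)
  then show ?thesis
  proof cases
    case 1
    show ?thesis unfolding 1 m
      by (rule eqv_in_span[OF vertex_path_ghost[OF 1(2) p q]]) (simp add: base[OF p q] zero)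
  next
    case 2
    show ?thesis
    proof (cases "u = head G e")
      case True
      then have "awalk (tail G e) (e # p) w"
        using p 2 by (simp add: awalk_Cons_iff)
      then show ?thesis
        using base[OF _ q] by (simp add: m 2 path_ghost_Cons[symmetric])
    next
      case False
      then show ?thesis
        using eqv_in_span[OF edge_path_ghost_zero[OF 2(2) p q False] zero] by (simp add: m 2 path_ghost_Cons)
    qed
  next
    case 3
    show ?thesis
    proof (cases p)
      case Nil
      with p have w: "w \<in> verts G" by (auto simp: awalk_Nil_iff)
      show ?thesis
      proof (cases "w = tail G e")
        case True
        have a: "awalk u' (q @ [e]) (head G e)"
          using q 3 True by (intro awalk_appendI[OF q]) (auto simp: awalk_simps)
        have b: "awalk (head G e) [] (head G e)"
          using 3 by (simp add: awalk_Nil_iff)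
        show ?thesis
          using eqv_in_span[OF ghost_path_ghost_Nil[OF 3(2) w q]] base[OF b a] True by (simp add: m 3 Nil)
      next
        case False
        then show ?thesis
          using eqv_in_span[OF ghost_path_ghost_Nil[OF 3(2) w q]] zero by (simp add: m 3 Nil)
      qed
    next
      case (Cons e' p')
      then have p': "awalk (head G e') p' w"
        using p by (auto simp: awalk_Cons_iff)
      show ?thesis
        using eqv_in_span[OF ghost_path_ghost_Cons[OF 3(2) p[unfolded Cons] q]] base[OF p' q] zero
        by (cases "e = e'") (simp_all add: m 3 Cons)
    qed
  qed
qed

lemma gen_in_span:
  assumes "x \<in> lpa_gens G"
  shows "wd [x] \<in> fa.span (monomials \<union> lpa_ideal G)"
proof -
  have base: "path_ghost p w q \<in> fa.span (monomials \<union> lpa_ideal G)" if "awalk u p w" "awalk u' q w" for p w q u u'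
    using that by (intro fa.span_base) (auto simp: monomials_def)
  consider v where "x = Vertex v" "v \<in> verts G" | e where "x = Edge e" "e \<in> arcs G"
    | e where "x = Ghost e" "e \<in> arcs G"
    using assms by (auto simp: lpa_gens_def)
  then show ?thesis
  proof cases
    case 1
    then show ?thesis using base[of v "[]" v v "[]"] by (simp add: path_ghost_def awalk_Nil_iff)
  next
    case 2
    have "path_ghost [e] (head G e) [] \<in> fa.span (monomials \<union> lpa_ideal G)"
      using 2 by (intro base[OF arc_implies_awalk]) (auto simp: awalk_Nil_iff)
    then show ?thesis
      using eqv_in_span[OF eqv_sym[OF edge_vertex]] 2 by (simp add: path_ghost_def)
  next
    case 3
    have "path_ghost [] (head G e) [e] \<in> fa.span (monomials \<union> lpa_ideal G)"
      using 3 by (intro base[OF _ arc_implies_awalk, of "head G e"]) (auto simp: awalk_Nil_iff)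
    then show ?thesis
      using eqv_in_span[OF eqv_sym[OF vertex_ghost]] 3 by (simp add: path_ghost_def)
  qed
qed

lemma A0_subset_span: "A0 \<subseteq> fa.span (monomials \<union> lpa_ideal G)"
  unfolding nonunital_span
proof (rule fa.span_minimal)
  let ?S = "fa.span (monomials \<union> lpa_ideal G)"
  have "wd u \<in> ?S" if "u \<noteq> []" "set u \<subseteq> lpa_gens G" for u
    using that
  proof (induction u rule: list_nonempty_induct)
    case (single x)
    then show ?case by (simp add: gen_in_span)
  next
    case (cons x u)
    have "?S \<subseteq> {f. wd [x] * f \<in> ?S}"
    proof (rule fa.span_minimal)
      have "wd [x] * f \<in> lpa_ideal G" if "f \<in> lpa_ideal G" for f
        using that cons.prems by (intro lpa_ideal_mult_left wd_in_free_algebra_on) auto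
      then show "monomials \<union> lpa_ideal G \<subseteq> {f. wd [x] * f \<in> ?S}"
        using cons.prems gen_monomial_in_span by (auto intro: fa.span_base)
    qed (intro subspace_right_factor fa.subspace_span)
    with cons show ?case by auto
  qed
  then show "{wd u |u. u \<noteq> [] \<and> set u \<subseteq> lpa_gens G} \<subseteq> ?S" by auto
qed simp

section \<open>The Leavitt path algebra and its filtration as linear images\<close>

lemma in_lpa_class_iff: "h \<in> lpa_class G f \<longleftrightarrow> h \<simeq> f"
  unfolding lpa_class_def eqv_def by (auto simp: image_iff intro!: bexI[of _ "h - f"])

lemma lpa_class_eq_iff: "lpa_class G f = lpa_class G g \<longleftrightarrow> f \<simeq> g"
  unfolding set_eq_iff in_lpa_class_iff by (blast intro: eqv_refl eqv_trans eqv_sym)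

lemma lpa_class_nonempty: "lpa_class G f \<noteq> {}"
  using in_lpa_class_iff[of f f] by auto

lemma eqv_in_A0: "f \<simeq> g \<Longrightarrow> g \<in> A0 \<Longrightarrow> f \<in> A0"
  using lpa_ideal_subset fa.subspace_add[OF subspace_nonunital, of "f - g" _ g] by (auto simp: eqv_def)

lemma A0_in_A1: "f \<in> A0 \<Longrightarrow> f \<in> A1"
  using nonunital_subset by blast

lemma eqv_mult:
  assumes "f \<simeq> f'" "g \<simeq> g'" "f' \<in> A1" "g \<in> A1"
  shows "f * g \<simeq> f' * g'"
  using eqv_trans[OF eqv_mult_right[OF assms(1,4)] eqv_mult_left[OF assms(2,3)]] .

lemma lpa_add: "lpa_class G f \<oplus>\<^bsub>leavitt_path_algebra k G\<^esub> lpa_class G g = lpa_class G (f + g)"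
  unfolding leavitt_path_algebra_def module.simps ring.simps monoid.simps
  by (intro UN_const_eq lpa_class_nonempty) (simp add: lpa_class_eq_iff in_lpa_class_iff eqv_add)

lemma lpa_smult: "c \<odot>\<^bsub>leavitt_path_algebra k G\<^esub> lpa_class G f = lpa_class G (scale c f)"
  unfolding leavitt_path_algebra_def module.simps ring.simps monoid.simps
  by (intro UN_const_eq lpa_class_nonempty) (simp add: lpa_class_eq_iff in_lpa_class_iff eqv_scale)

lemma lpa_mult:
  assumes "f \<in> A0" "g \<in> A0"
  shows "lpa_class G f \<otimes>\<^bsub>leavitt_path_algebra k G\<^esub> lpa_class G g = lpa_class G (f * g)"
proof -
  have "a * b \<simeq> f * g" if "a \<simeq> f" "b \<simeq> g" for a b
    using that assms eqv_in_A0 A0_in_A1 by (intro eqv_mult) auto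
  then show ?thesis
    unfolding leavitt_path_algebra_def monoid.simps
    by (intro UN_const_eq lpa_class_nonempty) (simp add: lpa_class_eq_iff in_lpa_class_iff)
qed

lemma lpa_zero: "\<zero>\<^bsub>leavitt_path_algebra k G\<^esub> = lpa_class G 0"
  by (simp add: leavitt_path_algebra_def)

lemma lpa_one: "\<one>\<^bsub>leavitt_path_algebra k G\<^esub> = lpa_class G (\<Sum>v\<in>verts G. wd [Vertex v])"
  by (simp add: leavitt_path_algebra_def gen_eq_wd)

lemma lpa_carrier: "carrier (leavitt_path_algebra k G) = lpa_class G ` A0"
  by (simp add: leavitt_path_algebra_def)

lemma linear_image_lpa:
  "linear_image scale A0 (lpa_class G) (leavitt_path_algebra TYPE('k::field) G)"
  by unfold_locales (simp_all add: subspace_nonunital lpa_add lpa_smult lpa_zero lpa_carrier)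

lemma path_elt_eq_wd: "p \<noteq> [] \<Longrightarrow> path_elt u p = wd (map Edge p)"
  by (simp add: path_elt_def prod_list_gen)

lemma ghost_path_elt_eq_wd: "p \<noteq> [] \<Longrightarrow> ghost_path_elt u p = wd (map Ghost (rev p))"
  by (simp add: ghost_path_elt_def prod_list_gen)

text \<open>
  Inserting the vertex \<open>w\<close> between the two factors does not change the product modulo the
  relations.
\<close>

lemma path_elt_eqv:
  assumes p: "awalk u p w" and q: "awalk u' q w"
  shows "path_elt u p * ghost_path_elt u' q \<simeq> path_ghost p w q"
proof -
  have 1: "path_elt u p \<simeq> wd (map Edge p @ [Vertex w])"
  proof (cases p rule: rev_cases)
    case Nil
    then show ?thesis using p by (simp add: path_elt_def gen_eq_wd awalk_Nil_iff)
  next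
    case (snoc p' e)
    then have e: "e \<in> arcs G" "head G e = w"
      using p by (auto simp: awalk_Cons_iff awalk_Nil_iff)
    have "set (map Edge p') \<subseteq> lpa_gens G"
      using awalk_set_arcs[OF p] snoc by auto
    from eqv_wd_left[OF eqv_sym[OF edge_vertex[OF e(1)]] this] show ?thesis
      using snoc e by (simp add: path_elt_eq_wd)
  qed
  have 2: "ghost_path_elt u' q \<simeq> wd (Vertex w # map Ghost (rev q))"
  proof (cases q rule: rev_cases)
    case Nil
    then show ?thesis using q by (simp add: ghost_path_elt_def gen_eq_wd awalk_Nil_iff)
  next
    case (snoc q' e)
    then have e: "e \<in> arcs G" "head G e = w"
      using q by (auto simp: awalk_Cons_iff awalk_Nil_iff)
    have "set (map Ghost (rev q')) \<subseteq> lpa_gens G"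
      using awalk_set_arcs[OF q] snoc by auto
    from eqv_wd_right[OF eqv_sym[OF vertex_ghost[OF e(1)]] this] show ?thesis
      using snoc e by (simp add: ghost_path_elt_eq_wd)
  qed
  have w: "w \<in> verts G" and u': "u' \<in> verts G"
    using p q by (auto simp: awalk_last_in_verts awalk_hd_in_verts)
  have sets: "set (map Edge p @ [Vertex w]) \<subseteq> lpa_gens G" "set (map Ghost (rev q)) \<subseteq> lpa_gens G"
    using awalk_set_arcs[OF p] awalk_set_arcs[OF q] w by auto
  have "ghost_path_elt u' q \<in> A1"
    using sets(2) u'
    by (cases "q = []") (simp_all add: ghost_path_elt_eq_wd wd_in_free_algebra_on ghost_path_elt_def[of _ "[]"] gen_eq_wd)
  then have "path_elt u p * ghost_path_elt u' q \<simeq>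
      wd (map Edge p @ [Vertex w]) * wd (Vertex w # map Ghost (rev q))"
    by (intro eqv_mult 1 2 wd_in_free_algebra_on sets)
  also have "\<dots> = wd (map Edge p) * wd [Vertex w, Vertex w] * wd (map Ghost (rev q))" by simp
  also have "\<dots> \<simeq> wd (map Edge p) * wd [Vertex w] * wd (map Ghost (rev q))"
    using vertex_vertex[OF w w] by (intro eqv_mult_right eqv_mult_left edges_in_A1[OF p] ghosts_in_A1[OF q]) simp
  finally show ?thesis by (simp add: path_ghost_def)
qed

definition monomials_upto :: "int \<Rightarrow> (('a, 'b) lpa_gen, 'k::field) free_algebra set"
  where "monomials_upto n = {path_ghost p w q | p w q.
    (\<exists>u. awalk u p w) \<and> (\<exists>u. awalk u q w) \<and> int (length p + length q) \<le> n}"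

definition filtration :: "int \<Rightarrow> (('a, 'b) lpa_gen, 'k::field) free_algebra set"
  where "filtration n = fa.span (monomials_upto n \<union> lpa_ideal G)"

lemma monomials_upto_subset: "monomials_upto n \<subseteq> A0"
  by (auto simp: monomials_upto_def intro: path_ghost_in_A0)

lemma subspace_filtration: "fa.subspace (filtration n)"
  by (simp add: filtration_def)

lemma filtration_mono: "m \<le> n \<Longrightarrow> filtration m \<subseteq> filtration n"
  unfolding filtration_def monomials_upto_def
  by (intro fa.span_mono Un_mono subset_refl) (blast intro: order_trans)

lemma lpa_ideal_subset_filtration: "lpa_ideal G \<subseteq> filtration n"
  unfolding filtration_def by (auto intro: fa.span_base)

lemma std_filtration_eq:
  "std_filtration TYPE('k::field) G n = lpa_class G ` filtration n"
proof -
  interpret L: linear_image scale A0 "lpa_class G" "leavitt_path_algebra TYPE('k) G"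
    by (rule linear_image_lpa)
  have "{lpa_class G (path_elt u p * ghost_path_elt u' q) | u p u' q w.
        awalk u p w \<and> awalk u' q w \<and> int (length p + length q) \<le> n} =
      (lpa_class G ` monomials_upto n :: (('a, 'b) lpa_gen, 'k) free_algebra set set)" (is "?A = ?B")
  proof (intro equalityI subsetI)
    fix x assume "x \<in> ?A"
    then obtain u p u' q w where
      "x = lpa_class G (path_elt u p * ghost_path_elt u' q)" and
      *: "awalk u p w" "awalk u' q w" "int (length p + length q) \<le> n" by blast
    then have "x = lpa_class G (path_ghost p w q)"
      by (simp add: lpa_class_eq_iff path_elt_eqv)
    with * show "x \<in> ?B" unfolding monomials_upto_def by blast
  next
    fix x assume "x \<in> ?B"
    then obtain u p u' q w where "x = lpa_class G (path_ghost p w q)" and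
      *: "awalk u p w" "awalk u' q w" "int (length p + length q) \<le> n"
      by (auto simp: monomials_upto_def)
    then have "x = lpa_class G (path_elt u p * ghost_path_elt u' q)"
      by (simp add: lpa_class_eq_iff path_elt_eqv eqv_sym)
    with * show "x \<in> ?A" by blast
  qed
  then have "std_filtration TYPE('k) G n = lpa_class G ` fa.span (monomials_upto n)"
    unfolding std_filtration_def by (simp only: L.span_image[OF monomials_upto_subset])
  also have "\<dots> = lpa_class G ` filtration n"
  proof (intro equalityI subsetI)
    fix x :: "(('a, 'b) lpa_gen, 'k) free_algebra set"
    assume "x \<in> lpa_class G ` filtration n"
    then obtain f where f: "f \<in> filtration n" "x = lpa_class G f" by blast
    then obtain g h where "f = g + h" "g \<in> fa.span (monomials_upto n)" "h \<in> lpa_ideal G"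
      unfolding filtration_def fa.span_Un fa.span_eq_iff[THEN iffD2, OF subspace_lpa_ideal] by blast
    then have "x = lpa_class G g"
      by (simp add: f lpa_class_eq_iff eqv_def)
    then show "x \<in> lpa_class G ` fa.span (monomials_upto n)"
      using \<open>g \<in> _\<close> by blast
  qed (auto simp: filtration_def intro: subsetD[OF fa.span_mono])
  finally show ?thesis .
qed

text \<open>
  The map from the free algebra onto \<open>W\<^sub>n/W\<^sub>n\<^sub>-\<^sub>1\<close>, defined on the preimage of
  \<open>W\<^sub>n\<close>.
\<close>

definition filtration_coset ::
  "int \<Rightarrow> (('a, 'b) lpa_gen, 'k::field) free_algebra \<Rightarrow> (('a, 'b) lpa_gen, 'k) free_algebra set set"
  where "filtration_coset n f = lpa_class G ` (\<lambda>h. h + f) ` filtration (n - 1)"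

lemma filtration_coset_cong:
  assumes "f - g \<in> filtration (n - 1)"
  shows "filtration_coset n f = filtration_coset n g"
proof -
  have "(\<lambda>h. h + f) ` filtration (n - 1) \<subseteq> (\<lambda>h. h + g) ` filtration (n - 1)"
    if "f - g \<in> filtration (n - 1)" for f g
    using fa.subspace_add[OF subspace_filtration _ that]
    by (fastforce simp: image_iff algebra_simps intro!: bexI[of _ "_ + (f - g)"])
  from this[OF assms] this[of g f] show ?thesis
    using fa.subspace_neg[OF subspace_filtration assms] by (auto simp: filtration_coset_def)
qed

lemma filtration_coset_eq:
  "std_filtration TYPE('k::field) G (n - 1)
     +>\<^bsub>leavitt_path_algebra TYPE('k) G\<lparr>carrier := C\<rparr>\<^esub> lpa_class G f = filtration_coset n f"
  unfolding a_r_coset_def' std_filtration_eq filtration_coset_def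
  by (auto simp: image_iff lpa_add)

lemma filtration_coset_zero_iff:
  "filtration_coset n f = std_filtration TYPE('k::field) G (n - 1) \<longleftrightarrow> f \<in> filtration (n - 1)"
proof
  assume "filtration_coset n f = std_filtration TYPE('k) G (n - 1)"
  moreover have "lpa_class G f \<in> filtration_coset n f"
    unfolding filtration_coset_def using fa.subspace_0[OF subspace_filtration, of "n - 1"] by force
  ultimately obtain g where "g \<in> filtration (n - 1)" "f \<simeq> g"
    unfolding std_filtration_eq by (auto simp: lpa_class_eq_iff)
  then show "f \<in> filtration (n - 1)"
    using lpa_ideal_subset_filtration fa.subspace_add[OF subspace_filtration, of "f - g" "n - 1" g]
    by (auto simp: eqv_def)
next
  assume "f \<in> filtration (n - 1)"
  then have "filtration_coset n f = filtration_coset n 0"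
    by (intro filtration_coset_cong) simp
  then show "filtration_coset n f = std_filtration TYPE('k) G (n - 1)"
    by (simp add: std_filtration_eq filtration_coset_def)
qed

lemma linear_image_filtration_quotient:
  "linear_image scale (filtration n) (filtration_coset n) (filtration_quotient TYPE('k::field) G n)"
proof unfold_locales
  note Q = filtration_quotient_def quotient_space_def
  let ?L = "leavitt_path_algebra TYPE('k) G\<lparr>carrier := std_filtration TYPE('k) G n\<rparr>"
  show "fa.subspace (filtration n)"
    by (rule subspace_filtration)
  show "carrier (filtration_quotient TYPE('k) G n) = filtration_coset n ` filtration n"
    by (simp add: Q A_RCOSETS_def' std_filtration_eq[of n] filtration_coset_eq image_Union
        UNION_singleton_eq_range image_image)
  show "filtration_coset n 0 = \<zero>\<^bsub>filtration_quotient TYPE('k) G n\<^esub>"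
    using filtration_coset_zero_iff[of n "0 :: (('a, 'b) lpa_gen, 'k) free_algebra"] fa.subspace_0[OF subspace_filtration] by (simp add: Q)
  fix f g :: "(('a, 'b) lpa_gen, 'k) free_algebra"
  assume f: "f \<in> filtration n"
  show "filtration_coset n (scale c f) = c \<odot>\<^bsub>filtration_quotient TYPE('k) G n\<^esub> filtration_coset n f" for c
  proof -
    have "(\<Union>a\<in>filtration_coset n f.
        std_filtration TYPE('k) G (n - 1) +>\<^bsub>?L\<^esub> (c \<odot>\<^bsub>?L\<^esub> a)) = filtration_coset n (scale c f)"
    proof (rule UN_const_eq)
      show "filtration_coset n f \<noteq> {}"
        unfolding filtration_coset_def using fa.subspace_0[OF subspace_filtration] by blast
      fix a assume "a \<in> filtration_coset n f"
      then obtain h where h: "h \<in> filtration (n - 1)" "a = lpa_class G (h + f)"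
        by (auto simp: filtration_coset_def)
      have "c \<odot>\<^bsub>?L\<^esub> a = lpa_class G (scale c (h + f))"
        by (simp add: h lpa_smult)
      moreover have "filtration_coset n (scale c (h + f)) = filtration_coset n (scale c f)"
        using fa.subspace_scale[OF subspace_filtration h(1), of c]
        by (intro filtration_coset_cong) (simp add: fa.scale_right_distrib)
      ultimately show "std_filtration TYPE('k) G (n - 1) +>\<^bsub>?L\<^esub> (c \<odot>\<^bsub>?L\<^esub> a) = filtration_coset n (scale c f)"
        by (simp only: filtration_coset_eq)
    qed
    then show ?thesis by (simp add: Q)
  qed
  assume g: "g \<in> filtration n"
  have "filtration_coset n f <+>\<^bsub>?L\<^esub> filtration_coset n g =
    lpa_class G ` {x + y | x y. x \<in> (\<lambda>h. h + f) ` filtration (n - 1) \<and> y \<in> (\<lambda>h. h + g) ` filtration (n - 1)}"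
    unfolding set_add_def' filtration_coset_def by (force simp: lpa_add)
  also have "{x + y | x y. x \<in> (\<lambda>h. h + f) ` filtration (n - 1) \<and> y \<in> (\<lambda>h. h + g) ` filtration (n - 1)} =
    (\<lambda>h. h + (f + g)) ` filtration (n - 1)"
  proof (intro equalityI subsetI)
    fix x assume "x \<in> {x + y | x y. x \<in> (\<lambda>h. h + f) ` filtration (n - 1) \<and> y \<in> (\<lambda>h. h + g) ` filtration (n - 1)}"
    then obtain h h' where h: "h \<in> filtration (n - 1)" "h' \<in> filtration (n - 1)" "x = (h + f) + (h' + g)"
      by blast
    then have "x = (h + h') + (f + g)" by simp
    then show "x \<in> (\<lambda>h. h + (f + g)) ` filtration (n - 1)"
      using fa.subspace_add[OF subspace_filtration h(1,2)] by blast
  next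
    fix x assume "x \<in> (\<lambda>h. h + (f + g)) ` filtration (n - 1)"
    then obtain h where h: "h \<in> filtration (n - 1)" "x = (h + f) + (0 + g)"
      by (auto simp: add.assoc)
    then show "x \<in> {x + y | x y. x \<in> (\<lambda>h. h + f) ` filtration (n - 1) \<and> y \<in> (\<lambda>h. h + g) ` filtration (n - 1)}"
      using fa.subspace_0[OF subspace_filtration] by blast
  qed
  finally show "filtration_coset n (f + g) =
    filtration_coset n f \<oplus>\<^bsub>filtration_quotient TYPE('k) G n\<^esub> filtration_coset n g"
    by (simp add: Q filtration_coset_def)
qed

definition unit_elt :: "(('a, 'b) lpa_gen, 'k::field) free_algebra"
  where "unit_elt = (\<Sum>v\<in>verts G. wd [Vertex v])"

lemma unit_elt_in_A0: "unit_elt \<in> A0"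
  unfolding unit_elt_def by (intro fa.subspace_sum[OF subspace_nonunital] wd_in_nonunital) auto

lemma prod_list_in_A1: "(\<And>x. x \<in> set xs \<Longrightarrow> x \<in> A1) \<Longrightarrow> prod_list xs \<in> A1"
  by (induction xs) (auto intro: free_algebra_on_mult one_in_free_algebra_on)

text \<open>
  The value of \<open>f\<close> computed with representatives \<open>\<alpha> i\<close> of the arguments. The factor
  \<open>unit_elt\<close> represents the unit with which \<open>eval_word\<close> ends every product.
\<close>

definition subst_poly :: "('i, 'k) free_algebra \<Rightarrow> ('i \<Rightarrow> (('a, 'b) lpa_gen, 'k::field) free_algebra)
    \<Rightarrow> (('a, 'b) lpa_gen, 'k) free_algebra"
  where "subst_poly f \<alpha> =
    (\<Sum>w\<in>Poly_Mapping.keys f. scale (Poly_Mapping.lookup f w) (prod_list (map \<alpha> (letters w)) * unit_elt))"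

lemma eval_word_lpa:
  fixes \<alpha> :: "'i \<Rightarrow> (('a, 'b) lpa_gen, 'k::field) free_algebra"
  assumes "\<And>i. \<alpha> i \<in> A0"
  shows "eval_word (leavitt_path_algebra TYPE('k) G) (\<lambda>i. lpa_class G (\<alpha> i)) w =
    lpa_class G (prod_list (map \<alpha> (letters w)) * unit_elt)"
proof -
  have "foldr (\<lambda>x y. lpa_class G (\<alpha> x) \<otimes>\<^bsub>leavitt_path_algebra TYPE('k) G\<^esub> y) xs
      \<one>\<^bsub>leavitt_path_algebra TYPE('k) G\<^esub> = lpa_class G (prod_list (map \<alpha> xs) * unit_elt)" for xs
  proof (induction xs)
    case (Cons x xs)
    have "prod_list (map \<alpha> xs) * unit_elt \<in> A0"
      using assms A0_in_A1 by (intro nonunital_mult_left prod_list_in_A1 unit_elt_in_A0) auto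
    with Cons show ?case
      by (simp add: lpa_mult assms mult.assoc)
  qed (simp add: lpa_one unit_elt_def)
  then show ?thesis by (simp add: eval_word_def)
qed

lemma eval_poly_lpa:
  fixes \<alpha> :: "'i \<Rightarrow> (('a, 'b) lpa_gen, 'k::field) free_algebra"
  assumes "\<And>i. \<alpha> i \<in> A0"
  shows "eval_poly (leavitt_path_algebra TYPE('k) G) f (\<lambda>i. lpa_class G (\<alpha> i)) =
    lpa_class G (subst_poly f \<alpha>)"
proof -
  interpret L: linear_image scale A0 "lpa_class G" "leavitt_path_algebra TYPE('k) G"
    by (rule linear_image_lpa)
  have "prod_list (map \<alpha> xs) * unit_elt \<in> A0" for xs
    using assms A0_in_A1 by (intro nonunital_mult_left prod_list_in_A1 unit_elt_in_A0) auto
  then show ?thesis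
    unfolding eval_poly_def subst_poly_def eval_word_lpa[OF assms]
    by (subst L.image_lincomb) simp_all
qed

lemma PI_algebra_lpa_iff:
  "PI_algebra (leavitt_path_algebra TYPE('k::field) G) \<longleftrightarrow>
    (\<exists>f :: (nat, 'k) free_algebra.
      (\<exists>w \<in> Poly_Mapping.keys f. Poly_Mapping.lookup f w = 1 \<and>
        (\<forall>w' \<in> Poly_Mapping.keys f. length (letters w') \<le> length (letters w))) \<and>
      (\<forall>\<alpha>. (\<forall>i. \<alpha> i \<in> A0) \<longrightarrow> subst_poly f \<alpha> \<in> lpa_ideal G))"
proof -
  let ?L = "leavitt_path_algebra TYPE('k) G"
  have "(\<forall>a. (\<forall>i. a i \<in> carrier ?L) \<longrightarrow> eval_poly ?L f a = \<zero>\<^bsub>?L\<^esub>) \<longleftrightarrow>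
      (\<forall>\<alpha>. (\<forall>i. \<alpha> i \<in> A0) \<longrightarrow> subst_poly f \<alpha> \<in> lpa_ideal G)" (is "?A \<longleftrightarrow> ?B")
    for f :: "(nat, 'k) free_algebra"
  proof
    assume ?A
    show ?B
    proof (intro allI impI)
      fix \<alpha> :: "nat \<Rightarrow> (('a, 'b) lpa_gen, 'k) free_algebra" assume \<alpha>: "\<forall>i. \<alpha> i \<in> A0"
      then have "eval_poly ?L f (\<lambda>i. lpa_class G (\<alpha> i)) = \<zero>\<^bsub>?L\<^esub>"
        using \<open>?A\<close> by (simp add: lpa_carrier)
      with \<alpha> show "subst_poly f \<alpha> \<in> lpa_ideal G"
        by (simp add: eval_poly_lpa lpa_zero lpa_class_eq_iff eqv_zero_iff)
    qed
  next
    assume ?B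
    show ?A
    proof (intro allI impI)
      fix a :: "nat \<Rightarrow> (('a, 'b) lpa_gen, 'k) free_algebra set" assume "\<forall>i. a i \<in> carrier ?L"
      then have "\<forall>i. \<exists>f. f \<in> A0 \<and> a i = lpa_class G f"
        unfolding lpa_carrier by blast
      then obtain \<alpha> where \<alpha>: "\<And>i. \<alpha> i \<in> A0" "\<And>i. a i = lpa_class G (\<alpha> i)"
        by metis
      then have "a = (\<lambda>i. lpa_class G (\<alpha> i))" by blast
      with \<open>?B\<close> \<alpha>(1) show "eval_poly ?L f a = \<zero>\<^bsub>?L\<^esub>"
        by (simp add: eval_poly_lpa lpa_zero lpa_class_eq_iff eqv_zero_iff)
    qed
  qed
  then show ?thesis
    unfolding PI_algebra_def by (simp only:)
qed

section \<open>A representation\<close>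

text \<open>
  A point \<open>(v, x, d)\<close> lies over the vertex \<open>v\<close>. If \<open>v\<close> emits \<open>m\<close> edges, the edge with
  number \<open>i < m\<close> sends the points \<open>(w, x, d)\<close> over its range to \<open>(v, mx + i, d + 1)\<close>. By
  division with remainder, every point over \<open>v\<close> arises from exactly one edge and one point,
  unless \<open>v\<close> is a sink. The last coordinate records lengths of paths, which makes the degree
  \<open>l(p) - l(q)\<close> of \<open>pq\<^sup>*\<close> visible in the representation.
\<close>

abbreviation src :: "'a \<times> nat \<times> int \<Rightarrow> 'a"
  where "src \<equiv> fst"

abbreviation deg :: "'a \<times> nat \<times> int \<Rightarrow> int"
  where "deg y \<equiv> snd (snd y)"

definition first_arc :: "'a \<times> nat \<times> int \<Rightarrow> 'b option"
  where "first_arc y =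
    (if out_arcs G (src y) = {} then None
     else Some (from_nat_into (out_arcs G (src y)) (fst (snd y) mod out_degree G (src y))))"

definition rest :: "'a \<times> nat \<times> int \<Rightarrow> 'a \<times> nat \<times> int"
  where "rest y = (head G (the (first_arc y)), fst (snd y) div out_degree G (src y), deg y - 1)"

definition prepend :: "'b \<Rightarrow> 'a \<times> nat \<times> int \<Rightarrow> 'a \<times> nat \<times> int"
  where "prepend e z = (tail G e,
    out_degree G (tail G e) * fst (snd z) + to_nat_on (out_arcs G (tail G e)) e, deg z + 1)"

lemma finite_out_arcs: "finite (out_arcs G v)"
  by (rule finite_subset[OF _ finite_arcs]) (simp add: out_arcs_def)

lemma to_nat_on_out_arcs: "e \<in> out_arcs G v \<Longrightarrow> to_nat_on (out_arcs G v) e < out_degree G v"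
  using to_nat_on_finite[OF finite_out_arcs, of v] by (auto simp: out_degree_def bij_betw_def)

lemma src_prepend [simp]: "src (prepend e z) = tail G e"
  and deg_prepend [simp]: "deg (prepend e z) = deg z + 1"
  by (simp_all add: prepend_def)

lemma first_arc_prepend [simp]:
  assumes "e \<in> arcs G"
  shows "first_arc (prepend e z) = Some e"
proof -
  have e: "e \<in> out_arcs G (tail G e)" using assms by simp
  then show ?thesis
    using to_nat_on_out_arcs[OF e] countable_finite[OF finite_out_arcs]
    by (auto simp: first_arc_def prepend_def)
qed

lemma rest_prepend [simp]:
  assumes "e \<in> arcs G" "src z = head G e"
  shows "rest (prepend e z) = z"
proof -
  have "e \<in> out_arcs G (tail G e)" using assms by simp
  from to_nat_on_out_arcs[OF this] show ?thesis
    using first_arc_prepend[OF assms(1), of z] assms(2)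
    by (cases z) (simp add: rest_def prepend_def)
qed

lemma first_arc_SomeD:
  assumes "first_arc y = Some e"
  shows "e \<in> arcs G" "tail G e = src y" "src (rest y) = head G e" "prepend e (rest y) = y"
proof -
  let ?A = "out_arcs G (src y)"
  have ne: "?A \<noteq> {}" and e: "e = from_nat_into ?A (fst (snd y) mod out_degree G (src y))"
    using assms by (auto simp: first_arc_def split: if_splits)
  have eA: "e \<in> ?A"
    unfolding e by (rule from_nat_into[OF ne])
  then show 1: "e \<in> arcs G" "tail G e = src y" by auto
  show "src (rest y) = head G e" using assms by (simp add: rest_def)
  have pos: "0 < out_degree G (src y)"
    using ne finite_out_arcs by (simp add: out_degree_def card_gt_0_iff)
  have "to_nat_on ?A e = fst (snd y) mod out_degree G (src y)"
    unfolding e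
  proof (rule to_nat_on_from_nat_into)
    show "fst (snd y) mod out_degree G (src y) \<in> to_nat_on ?A ` ?A"
      using to_nat_on_finite[OF finite_out_arcs, of "src y"] pos
      by (simp add: bij_betw_def out_degree_def)
  qed
  then show "prepend e (rest y) = y"
    using 1 by (cases y) (simp add: prepend_def rest_def)
qed

lemma first_arc_None_iff: "first_arc y = None \<longleftrightarrow> out_arcs G (src y) = {}"
  by (simp add: first_arc_def)

text \<open>
  A ghost edge acts on functions by composition with prepending the edge, and the edge acts by
  the reverse: \<open>(eh)(e \<cdot> z) = h(z)\<close>, and \<open>(eh)(y) = 0\<close> at points \<open>y\<close> that do not begin
  with \<open>e\<close>.
\<close>

fun act :: "('a, 'b) lpa_gen \<Rightarrow> ('a \<times> nat \<times> int \<Rightarrow> 'k::field) \<Rightarrow> 'a \<times> nat \<times> int \<Rightarrow> 'k"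
  where
    "act (Vertex v) h = (\<lambda>y. if src y = v then h y else 0)"
  | "act (Edge e) h = (\<lambda>y. if first_arc y = Some e then h (rest y) else 0)"
  | "act (Ghost e) h = (\<lambda>y. if src y = head G e then h (prepend e y) else 0)"

definition word_act :: "('a, 'b) lpa_gen list \<Rightarrow> ('a \<times> nat \<times> int \<Rightarrow> 'k::field) \<Rightarrow> 'a \<times> nat \<times> int \<Rightarrow> 'k"
  where "word_act u = foldr act u"

definition rep :: "(('a, 'b) lpa_gen, 'k::field) free_algebra \<Rightarrow> ('a \<times> nat \<times> int \<Rightarrow> 'k) \<Rightarrow> 'a \<times> nat \<times> int \<Rightarrow> 'k"
  where "rep f h y =
    (\<Sum>w\<in>Poly_Mapping.keys f. Poly_Mapping.lookup f w * word_act (letters w) h y)"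

lemma word_act_simps [simp]:
  "word_act [] h = h"
  "word_act (x # u) h = act x (word_act u h)"
  by (simp_all add: word_act_def)

lemma word_act_append: "word_act (u @ v) h = word_act u (word_act v h)"
  by (simp add: word_act_def)

lemma act_add: "act x (\<lambda>y. h y + h' y) = (\<lambda>y. act x h y + act x h' y)"
  and act_scale: "act x (\<lambda>y. c * h y) = (\<lambda>y. c * act x h y)"
  by (cases x; auto)+

lemma word_act_add: "word_act u (\<lambda>y. h y + h' y) = (\<lambda>y. word_act u h y + word_act u h' y)"
  and word_act_scale: "word_act u (\<lambda>y. c * h y) = (\<lambda>y. c * word_act u h y)"
  by (induction u) (simp_all add: act_add act_scale)

lemma rep_superset:
  assumes "finite A" "Poly_Mapping.keys f \<subseteq> A"
  shows "rep f h y = (\<Sum>w\<in>A. Poly_Mapping.lookup f w * word_act (letters w) h y)"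
  unfolding rep_def using assms by (intro sum.mono_neutral_left) (auto simp: in_keys_iff)

lemma rep_wd [simp]: "rep (wd u) h = word_act u h"
  by (rule ext) (simp add: rep_def wd_def)

lemma rep_zero [simp]: "rep 0 h = (\<lambda>y. 0)"
  by (rule ext) (simp add: rep_def)

lemma rep_add: "rep (f + g) h y = rep f h y + rep g h y"
proof -
  let ?A = "Poly_Mapping.keys f \<union> Poly_Mapping.keys g"
  have "Poly_Mapping.keys (f + g) \<subseteq> ?A" by (rule keys_add)
  then show ?thesis
    by (simp add: rep_superset[of ?A] lookup_add distrib_right sum.distrib)
qed

lemma rep_scale: "rep (scale c f) h y = c * rep f h y"
  by (subst rep_superset[OF _ keys_scale_subset]) (simp_all add: rep_def sum_distrib_left mult.assoc)

lemma rep_diff: "rep (f - g) h y = rep f h y - rep g h y"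
  using rep_add[of "f - g" g h y] by simp

lemma rep_sum: "rep (\<Sum>i\<in>A. f i) h y = (\<Sum>i\<in>A. rep (f i) h y)"
  by (induction A rule: infinite_finite_induct) (simp_all add: rep_add)

lemma rep_mult: "rep (f * g) h = rep f (rep g h)"
proof (induction f rule: wd_induct)
  case (wd u)
  show ?case
  proof (induction g rule: wd_induct)
    case (add f g)
    have "rep (f + g) h = (\<lambda>y. rep f h y + rep g h y)" by (rule ext) (rule rep_add)
    with add show ?case by (auto simp: distrib_left rep_add word_act_add)
  next
    case (scale c g)
    have "rep (scale c g) h = (\<lambda>y. c * rep g h y)" by (rule ext) (rule rep_scale)
    with scale show ?case by (auto simp: mult_scale_right rep_scale word_act_scale)
  next
    case (wd v)
    then show ?case by (simp add: word_act_append)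
  qed
qed (auto simp: distrib_right rep_add scale_mult_left rep_scale)

lemma rep_zero_right: "rep f (\<lambda>y. 0) = (\<lambda>y. 0)"
proof (induction f rule: wd_induct)
  case (wd u)
  show ?case using word_act_scale[of u 0 "\<lambda>y. 0"] by simp
qed (auto simp: rep_add rep_scale)

text \<open>
  This is the relation (CK2): a point over \<open>v\<close> begins with exactly one edge out of \<open>v\<close>, so
  exactly one summand contributes.
\<close>

lemma rep_sum_edge_ghost:
  assumes "out_arcs G v \<noteq> {}"
  shows "rep (\<Sum>e\<in>out_arcs G v. wd [Edge e, Ghost e]) h y = rep (wd [Vertex v]) h y"
proof -
  have "rep (\<Sum>e\<in>out_arcs G v. wd [Edge e, Ghost e]) h y =
      (\<Sum>e\<in>out_arcs G v. if first_arc y = Some e then h y else 0)"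
    unfolding rep_sum by (intro sum.cong refl) (auto dest: first_arc_SomeD)
  also have "\<dots> = (if src y = v then h y else 0)"
  proof (cases "first_arc y")
    case None
    then have "src y \<noteq> v" using assms by (auto simp: first_arc_None_iff)
    then show ?thesis using None by simp
  next
    case (Some e)
    then have "(\<Sum>e'\<in>out_arcs G v. if first_arc y = Some e' then h y else 0) =
        (\<Sum>e'\<in>out_arcs G v. if e = e' then h y else 0)" by simp
    then show ?thesis
      using first_arc_SomeD[OF Some] finite_out_arcs[of v] by auto
  qed
  finally show ?thesis by simp
qed

lemma rep_relation:
  assumes "r \<in> lpa_relations G"
  shows "rep r h = (\<lambda>y. 0)"
proof
  fix y
  have "rep (\<Sum>e\<in>out_arcs G (tail G x). wd [Edge e, Ghost e]) h y = (if src y = tail G x then h y else 0)"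
    if "x \<in> arcs G" for x
    using that by (subst rep_sum_edge_ghost) auto
  then show "rep r h y = 0"
    using assms unfolding lpa_relations_def gen_eq_wd wd_mult append.simps
    by (auto simp: rep_diff first_arc_SomeD)
qed

lemma rep_ideal:
  assumes "f \<in> lpa_ideal G"
  shows "rep f h = (\<lambda>y. 0)"
proof -
  have "\<forall>h. rep f h = (\<lambda>y. 0)"
    using assms unfolding lpa_ideal_def
    by induction (auto simp: rep_relation rep_add rep_scale rep_mult rep_zero_right)
  then show ?thesis ..
qed

definition prepend_path :: "'b list \<Rightarrow> 'a \<times> nat \<times> int \<Rightarrow> 'a \<times> nat \<times> int"
  where "prepend_path p = foldr prepend p"

lemma prepend_path_simps [simp]:
  "prepend_path [] z = z"
  "prepend_path (e # p) z = prepend e (prepend_path p z)"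
  by (simp_all add: prepend_path_def)

lemma prepend_path_append: "prepend_path (p @ q) z = prepend_path p (prepend_path q z)"
  by (simp add: prepend_path_def)

lemma deg_prepend_path: "deg (prepend_path p z) = deg z + int (length p)"
  by (induction p) auto

lemma src_prepend_path: "awalk u p w \<Longrightarrow> src z = w \<Longrightarrow> src (prepend_path p z) = u"
  by (cases p) (auto simp: awalk_simps)

text \<open>
  Unique readability: a point determines its first edge and what follows, so the shorter path is
  an initial segment of the longer one.
\<close>

lemma prepend_path_eq:
  assumes "awalk u p w" "awalk u' q w'" "src z = w" "src z' = w'"
    "prepend_path p z = prepend_path q z'" "length p \<le> length q"
  shows "\<exists>s. q = p @ s \<and> z = prepend_path s z' \<and> awalk w s w'"
  using assms
proof (induction p arbitrary: u u' q)
  case Nil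
  then have "u' = w" using src_prepend_path[OF Nil(2)] by simp
  with Nil show ?case by auto
next
  case (Cons e p)
  then obtain e' q' where q: "q = e' # q'" by (cases q) auto
  have p: "e \<in> arcs G" "awalk (head G e) p w" and q': "e' \<in> arcs G" "awalk (head G e') q' w'"
    using Cons.prems q by (auto simp: awalk_Cons_iff)
  have eq: "prepend e (prepend_path p z) = prepend e' (prepend_path q' z')"
    using Cons.prems q by simp
  from arg_cong[OF eq, of first_arc] have "e = e'"
    using p q' by simp
  moreover from arg_cong[OF eq, of rest] have "prepend_path p z = prepend_path q' z'"
    using p q' Cons.prems src_prepend_path by simp
  ultimately show ?case
    using Cons.IH[OF p(2) q'(2)] Cons.prems q by auto
qed

lemma ghosts_act:
  "awalk u q w \<Longrightarrow> src z = w \<Longrightarrow> word_act (map Ghost (rev q)) h z = h (prepend_path q z)"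
proof (induction q arbitrary: u h)
  case (Cons e q)
  then show ?case
    using src_prepend_path[of "head G e" q w z] by (auto simp: awalk_Cons_iff word_act_append)
qed simp

lemma edges_act:
  "awalk u p w \<Longrightarrow> src z = w \<Longrightarrow> word_act (map Edge p) h (prepend_path p z) = h z"
proof (induction p arbitrary: u)
  case (Cons e p)
  then show ?case
    using src_prepend_path[of "head G e" p w z] by (auto simp: awalk_Cons_iff)
qed simp

lemma edges_act_nonzero:
  "word_act (map Edge p) h y \<noteq> 0 \<Longrightarrow> \<exists>z. y = prepend_path p z \<and> h z \<noteq> 0"
proof (induction p arbitrary: y)
  case (Cons e p)
  then have "first_arc y = Some e" "word_act (map Edge p) h (rest y) \<noteq> 0"
    by (auto split: if_splits)
  with Cons.IH[of "rest y"] show ?case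
    by (metis first_arc_SomeD(4) prepend_path_simps(2))
qed auto

lemma rep_path_ghost:
  assumes "awalk u p w" "awalk u' q w" "src z = w"
  shows "rep (path_ghost p w q) h (prepend_path p z) = h (prepend_path q z)"
  unfolding path_ghost_def rep_wd word_act_append
  by (simp add: edges_act[OF assms(1,3)] ghosts_act[OF assms(2,3)] assms(3))

text \<open>
  With the preceding lemma: \<open>(pq\<^sup>*h)(p \<cdot> z) = h(q \<cdot> z)\<close>, and \<open>pq\<^sup>*h\<close> vanishes at
  all other points.
\<close>

lemma rep_path_ghost_nonzero:
  assumes "rep (path_ghost p w q) h y \<noteq> 0"
  shows "\<exists>z. y = prepend_path p z \<and> src z = w"
  using edges_act_nonzero[of p _ y] assms
  unfolding path_ghost_def rep_wd word_act_append by (fastforce split: if_splits)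

lemma rep_unit_elt: "src y \<in> verts G \<Longrightarrow> rep unit_elt h y = h y"
  by (simp add: unit_elt_def rep_sum)

section \<open>A cycle with an exit\<close>

text \<open>
  The exit \<open>f\<close> is required at the base point of \<open>c\<close>; any exit of a closed path can be moved
  there by rotating the path.
\<close>

definition cycle_exit :: "'a \<Rightarrow> 'b list \<Rightarrow> 'b \<Rightarrow> bool"
  where "cycle_exit v c f \<longleftrightarrow> awalk v c v \<and> c \<noteq> [] \<and> f \<in> out_arcs G v \<and> f \<noteq> hd c"

abbreviation cycle_pow :: "'b list \<Rightarrow> nat \<Rightarrow> 'b list"
  where "cycle_pow c i \<equiv> concat (replicate i c)"

lemma awalk_cycle_pow: "awalk v c v \<Longrightarrow> awalk v (cycle_pow c i) v"
proof (induction i)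
  case 0
  then show ?case by (auto simp: awalk_Nil_iff)
next
  case (Suc i)
  then have "awalk v (c @ cycle_pow c i) v" by (intro awalk_appendI) auto
  then show ?case by simp
qed

lemma cycle_pow_add: "cycle_pow c (i + j) = cycle_pow c i @ cycle_pow c j"
  by (simp add: replicate_add)

lemma length_cycle_pow: "length (cycle_pow c i) = i * length c"
  by (induction i) auto

text \<open>
  If \<open>i < j\<close>, then the edge \<open>f\<close> of \<open>c\<^sup>if\<close> stands where \<open>c\<^sup>jf\<close> continues with the
  first edge of \<open>c\<close>. Hence \<open>c\<^sup>if\<close> and \<open>c\<^sup>jf\<close> have no point in common.
\<close>

lemma exit_paths_orthogonal:
  assumes c: "cycle_exit v c f" and z: "src z = head G f" "src z' = head G f"
    and eq: "prepend_path (cycle_pow c i @ [f]) z = prepend_path (cycle_pow c j @ [f]) z'"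
  shows "i = j \<and> z = z'"
proof -
  have walk: "awalk v (cycle_pow c i @ [f]) (head G f)" for i
    using c awalk_cycle_pow[of v c i] by (intro awalk_appendI) (auto simp: cycle_exit_def awalk_simps)
  have *: "i = j \<and> z = z'" if ij: "i \<le> j" and zs: "src z = head G f" "src z' = head G f"
    and eq: "prepend_path (cycle_pow c i @ [f]) z = prepend_path (cycle_pow c j @ [f]) z'" for i j z z'
  proof -
    obtain s where s: "cycle_pow c j @ [f] = (cycle_pow c i @ [f]) @ s" "z = prepend_path s z'"
      using prepend_path_eq[OF walk walk zs eq] ij by (auto simp: length_cycle_pow)
    show ?thesis
    proof (cases "i = j")
      case True
      then show ?thesis using s by simp
    next
      case False
      then obtain k where k: "j = i + Suc k"
        using ij less_iff_Suc_add[of i j] by auto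
      have "cycle_pow c j = cycle_pow c i @ c @ cycle_pow c k"
        unfolding k cycle_pow_add by simp
      with s(1) have "hd (c @ cycle_pow c k @ [f]) = f" by simp
      then show ?thesis using c by (auto simp: cycle_exit_def hd_append)
    qed
  qed
  show ?thesis
    using *[of i j z z'] *[of j i z' z] z eq by (cases "i \<le> j") auto
qed

text \<open>
  With \<open>p\<^sub>i = c\<^sup>if\<close> the elements \<open>p\<^sub>ip\<^sub>j\<^sup>*\<close> act as matrix units on the points
  \<open>Y i = p\<^sub>i \<cdot> z\<close>. If the word \<open>x\<close> of length \<open>d\<close> has coefficient 1, put
  \<open>\<alpha> i = \<Sum> p\<^sub>jp\<^sub>j\<^sub>+\<^sub>1\<^sup>*\<close> over the positions \<open>j < d\<close> at which \<open>x\<close> has the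
  letter \<open>i\<close>. A word \<open>w'\<close> evaluated at \<open>\<alpha>\<close> moves from index \<open>0\<close> to index \<open>d\<close> only if
  \<open>w' = x\<close>, so the entry \<open>(0, d)\<close> of the value of the polynomial is the coefficient of \<open>x\<close>.
  No multilinearization is involved, so small finite fields need no special care.
\<close>

lemma not_PI_if_cycle_exit:
  assumes c: "cycle_exit v c f"
  shows "\<not> PI_algebra (leavitt_path_algebra TYPE('k::field) G)"
proof
  assume "PI_algebra (leavitt_path_algebra TYPE('k) G)"
  then obtain F :: "(nat, 'k) free_algebra" and w where
    w: "Poly_Mapping.lookup F w = 1" and
    F: "\<And>\<alpha>. (\<And>i. \<alpha> i \<in> A0) \<Longrightarrow> subst_poly F \<alpha> \<in> lpa_ideal G"
    unfolding PI_algebra_lpa_iff by blast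
  define p where "p i = cycle_pow c i @ [f]" for i
  define r where "r = head G f"
  define x where "x = letters w"
  define d where "d = length x"
  define z where "z = (r, 0::nat, 0::int)"
  define Y where "Y i = prepend_path (p i) z" for i
  define \<alpha> :: "nat \<Rightarrow> (('a, 'b) lpa_gen, 'k) free_algebra"
    where "\<alpha> i = (\<Sum>j\<in>{j. j < d \<and> x ! j = i}. path_ghost (p j) r (p (Suc j)))" for i
  have f: "f \<in> arcs G" "tail G f = v"
    using c by (auto simp: cycle_exit_def)
  have walk: "awalk v (p i) r" for i
    using c f awalk_cycle_pow[of v c i] unfolding p_def r_def
    by (intro awalk_appendI) (auto simp: cycle_exit_def awalk_simps)
  have z: "src z = r" by (simp add: z_def)
  have Y_eq: "i = j \<and> y = z" if "src y = r" "Y i = prepend_path (p j) y" for i j y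
    using exit_paths_orthogonal[OF c, of z y i j] that z unfolding Y_def p_def r_def by auto
  have src_Y: "src (Y i) = v" for i
    unfolding Y_def using src_prepend_path[OF walk z] .
  have entry: "rep (path_ghost (p i) r (p j)) h (Y l) = (if i = l then h (Y j) else 0)" for i j l h
  proof (cases "i = l")
    case True
    then show ?thesis using rep_path_ghost[OF walk walk z] by (simp add: Y_def)
  next
    case False
    have "rep (path_ghost (p i) r (p j)) h (Y l) = 0"
    proof (rule ccontr)
      assume "rep (path_ghost (p i) r (p j)) h (Y l) \<noteq> 0"
      from rep_path_ghost_nonzero[OF this] Y_eq False show False by metis
    qed
    with False show ?thesis by simp
  qed
  have \<alpha>_A0: "\<alpha> i \<in> A0" for i
    unfolding \<alpha>_def by (intro fa.subspace_sum[OF subspace_nonunital] path_ghost_in_A0[OF walk walk])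
  have rep_\<alpha>: "rep (\<alpha> i) h (Y j) = (if j < d \<and> x ! j = i then h (Y (Suc j)) else 0)" for i j h
    unfolding \<alpha>_def rep_sum entry by (auto simp: sum.delta)
  have rep_prod: "rep (prod_list (map \<alpha> xs)) h (Y j) =
      (if take (length xs) (drop j x) = xs then h (Y (j + length xs)) else 0)" for xs h j
  proof (induction xs arbitrary: j)
    case Nil
    then show ?case using rep_wd[of "[]" h] by (simp add: wd_Nil)
  next
    case (Cons a xs)
    have "take (length (a # xs)) (drop j x) = a # xs \<longleftrightarrow>
        j < d \<and> x ! j = a \<and> take (length xs) (drop (Suc j) x) = xs"
    proof (cases "j < d")
      case True
      then have "drop j x = x ! j # drop (Suc j) x"
        by (simp add: d_def Cons_nth_drop_Suc)
      with True show ?thesis by auto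
    qed (simp add: d_def)
    then show ?case by (simp add: rep_mult rep_\<alpha> Cons)
  qed
  \<comment> \<open>The indicator function of \<open>Y d\<close> picks out column \<open>d\<close>; evaluation at \<open>Y 0\<close> picks out row \<open>0\<close>.\<close>
  define h :: "'a \<times> nat \<times> int \<Rightarrow> 'k" where "h y = (if y = Y d then 1 else 0)" for y
  have v: "v \<in> verts G" using awalk_hd_in_verts[OF walk] .
  have summand: "rep (prod_list (map \<alpha> (letters w')) * unit_elt) h (Y 0) = (if w' = w then 1 else 0)" for w'
  proof -
    have "rep unit_elt h (Y i) = (if i = d then 1 else 0)" for i
      using rep_unit_elt[of "Y i" h] src_Y v Y_eq[OF z, of i d] by (auto simp: h_def Y_def)
    then have "rep (prod_list (map \<alpha> (letters w')) * unit_elt) h (Y 0) =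
        (if take (length (letters w')) x = letters w' \<and> length (letters w') = d then 1 else 0)"
      by (auto simp: rep_mult rep_prod)
    also have "take (length (letters w')) x = letters w' \<and> length (letters w') = d \<longleftrightarrow> w' = w"
    proof
      assume "take (length (letters w')) x = letters w' \<and> length (letters w') = d"
      then have "letters w' = letters w" by (metis d_def order_refl take_all x_def)
      then show "w' = w" by (rule free_monoid.expand)
    qed (simp add: x_def d_def)
    finally show ?thesis .
  qed
  have "rep (subst_poly F \<alpha>) h (Y 0) = (\<Sum>w'\<in>Poly_Mapping.keys F. Poly_Mapping.lookup F w' * (if w' = w then 1 else 0))"
    unfolding subst_poly_def rep_sum rep_scale summand ..
  also have "\<dots> = 1"
    using w by (simp add: if_distrib[of "\<lambda>x. _ * x"] sum.delta in_keys_iff cong: if_cong)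
  finally show False
    using rep_ideal[OF F[OF \<alpha>_A0]] by simp
qed

text \<open>
  The matrix entries of \<open>pq\<^sup>*\<close> with respect to the points.
\<close>

lemma rep_indicator:
  assumes "awalk u p w" "awalk u' q w"
  shows "rep (path_ghost p w q) (\<lambda>x. if x = x0 then 1 else 0) y0 =
    (if \<exists>y. src y = w \<and> y0 = prepend_path p y \<and> x0 = prepend_path q y then 1 else (0 :: 'k::field))"
    (is "?l = (if ?P then 1 else 0)")
proof (cases "\<exists>y. src y = w \<and> y0 = prepend_path p y")
  case True
  then obtain y where y: "src y = w" "y0 = prepend_path p y" by blast
  have "y' = y" if "src y' = w" "y0 = prepend_path p y'" for y'
    using prepend_path_eq[OF assms(1) assms(1) that(1) y(1)] that(2) y(2) by auto
  then have P: "?P \<longleftrightarrow> x0 = prepend_path q y"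
    using y by metis
  show ?thesis
    unfolding P unfolding y(2) rep_path_ghost[OF assms y(1)] by auto
next
  case False
  then have "\<not> ?P" by blast
  moreover have "?l = 0"
    using rep_path_ghost_nonzero[of p w q "\<lambda>x. if x = x0 then 1 else 0 :: 'k" y0] False by metis
  ultimately show ?thesis by (simp only: if_False)
qed

text \<open>
  An element \<open>ab\<^sup>*\<close> of length less than that of \<open>pe(qe)\<^sup>*\<close> does not notice the last edge. By
  degree, both \<open>a\<close> and \<open>b\<close> are then shorter than \<open>pe\<close> and \<open>qe\<close>, respectively; so they are
  initial segments of \<open>p\<close> and \<open>q\<close>, with the same remainder \<open>t\<close>, and \<open>t\<close> may be followed by
  \<open>f\<close> in place of \<open>e\<close>.
\<close>

lemma monomial_entry_swap:
  assumes p: "awalk u p v" and q: "awalk u' q v"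
    and e: "e \<in> out_arcs G v" and f: "f \<in> out_arcs G v"
    and z: "src z = head G e" "src z' = head G f"
    and a: "awalk u1 a w" and b: "awalk u2 b w"
    and len: "length a + length b < length p + length q + 2" and deg: "deg z = 0"
    and y: "src y = w" "prepend_path (p @ [e]) z = prepend_path a y" "prepend_path (q @ [e]) z = prepend_path b y"
  shows "\<exists>y. src y = w \<and> prepend_path (p @ [f]) z' = prepend_path a y \<and> prepend_path (q @ [f]) z' = prepend_path b y"
proof -
  have pe: "awalk u (p @ [e]) (head G e)" and qe: "awalk u' (q @ [e]) (head G e)"
    using awalk_appendI[OF p, of "[e]"] awalk_appendI[OF q, of "[e]"] e by (auto simp: awalk_simps)
  have d: "int (length p) + 1 = deg y + int (length a)" "int (length q) + 1 = deg y + int (length b)"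
    using arg_cong[OF y(2), of deg] arg_cong[OF y(3), of deg] deg by (simp_all add: deg_prepend_path)
  with len have la: "length a \<le> length p" and lb: "length b \<le> length q" by linarith+
  obtain s where s: "p @ [e] = a @ s" "y = prepend_path s z" "awalk w s (head G e)"
    using prepend_path_eq[OF a pe y(1) z(1) y(2)[symmetric]] la by auto
  obtain s' where s': "q @ [e] = b @ s'" "y = prepend_path s' z" "awalk w s' (head G e)"
    using prepend_path_eq[OF b qe y(1) z(1) y(3)[symmetric]] lb by auto
  have "length s = length s'"
    using arg_cong[OF s(1), of length] arg_cong[OF s'(1), of length] d by simp
  then have "s' = s"
    using prepend_path_eq[OF s(3) s'(3) z(1) z(1)] s(2) s'(2) by auto
  moreover have "s \<noteq> []"
    using arg_cong[OF s(1), of length] la by auto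
  then obtain t where t: "s = t @ [e]"
    using s(1) by (cases s rule: rev_cases) auto
  ultimately have pq: "p = a @ t" "q = b @ t"
    using s(1) s'(1) by auto
  have "awalk w t v"
    using s(3) e unfolding t by (auto simp: awalk_simps)
  then have "src (prepend_path (t @ [f]) z') = w"
    using f z by (intro src_prepend_path[of w _ "head G f"]) (auto intro!: awalk_appendI simp: awalk_simps)
  then show ?thesis
    by (intro exI[of _ "prepend_path (t @ [f]) z'"]) (simp add: pq prepend_path_append)
qed

lemma finite_monomials_upto: "finite (monomials_upto n)"
proof -
  let ?L = "{p. set p \<subseteq> arcs G \<and> length p \<le> nat n}"
  have "monomials_upto n \<subseteq> (\<lambda>(p, w, q). path_ghost p w q) ` (?L \<times> verts G \<times> ?L)"
  proof
    fix x assume "x \<in> monomials_upto n"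
    then obtain p w q u u' where "x = path_ghost p w q" "awalk u p w" "awalk u' q w"
      "int (length p + length q) \<le> n"
      unfolding monomials_upto_def by blast
    then show "x \<in> (\<lambda>(p, w, q). path_ghost p w q) ` (?L \<times> verts G \<times> ?L)"
      using awalk_last_in_verts awalk_set_arcs
      by (intro image_eqI[of _ _ "(p, w, q)"]) (auto dest: awalk_last_in_verts awalk_set_arcs)
  qed
  moreover have "finite (?L \<times> verts G \<times> ?L)"
    by (intro finite_cartesian_product finite_lists_length_le finite_arcs finite_verts)
  ultimately show ?thesis
    using finite_surj by blast
qed

lemma filtration_quotient_zero:
  "\<zero>\<^bsub>filtration_quotient TYPE('k::field) G n\<^esub> = std_filtration TYPE('k) G (n - 1)"
  by (simp add: filtration_quotient_def quotient_space_def)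

text \<open>
  The functional \<open>\<phi> i\<close> is the entry of an operator between the points \<open>c\<^sup>m\<^sup>-\<^sup>ie \<cdot> z\<close>
  and \<open>c\<^sup>ie \<cdot> z\<close>, minus the entry obtained when the last edge \<open>e\<close> is replaced by \<open>f\<close> and \<open>z\<close> by a point over
  the range of \<open>f\<close>. On
  \<open>W\<^sub>n\<^sub>-\<^sub>1\<close> the two entries agree by the preceding lemma. On \<open>c\<^sup>jee\<^sup>*(c\<^sup>*)\<^sup>m\<^sup>-\<^sup>j\<close>
  the degree forces \<open>j = i\<close> if one of them is nonzero, and then only the first one is, because
  \<open>e\<close> differs from \<open>f\<close>.
\<close>

lemma dim_filtration_quotient_ge:
  assumes c: "cycle_exit v c f"
  shows "Suc m \<le> vectorspace.dim class_ring (filtration_quotient TYPE('k::field) G (int (m * length c + 2)))"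
proof -
  define n where "n = int (m * length c + 2)"
  interpret Q: linear_image scale "filtration n" "filtration_coset n" "filtration_quotient TYPE('k) G n"
    by (rule linear_image_filtration_quotient)
  define e where "e = hd c"
  have cw: "awalk v c v" "c \<noteq> []" and f: "f \<in> out_arcs G v" "f \<noteq> e"
    using c by (auto simp: cycle_exit_def e_def)
  have e: "e \<in> out_arcs G v"
    using cw by (cases c) (auto simp: e_def awalk_Cons_iff)
  define z where "z a = (head G a, 0::nat, 0::int)" for a
  have z: "src (z a) = head G a" "deg (z a) = 0" for a
    by (simp_all add: z_def)
  define p where "p i = cycle_pow c i" for i
  have p: "awalk v (p i) v" "length (p i) = i * length c" for i
    unfolding p_def using awalk_cycle_pow[OF cw(1)] by (simp_all add: length_cycle_pow)
  have pa: "awalk v (p i @ [a]) (head G a)" if "a \<in> out_arcs G v" for i a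
    using that by (intro awalk_appendI[OF p(1)]) (auto simp: awalk_simps)
  define b :: "nat \<Rightarrow> (('a, 'b) lpa_gen, 'k) free_algebra"
    where "b i = path_ghost (p i @ [e]) (head G e) (p (m - i) @ [e])" for i
  define ent :: "'b \<Rightarrow> nat \<Rightarrow> (('a, 'b) lpa_gen, 'k) free_algebra \<Rightarrow> 'k"
    where "ent a i g = rep g (\<lambda>x. if x = prepend_path (p (m - i) @ [a]) (z a) then 1 else 0)
      (prepend_path (p i @ [a]) (z a))" for a i g
  define \<phi> where "\<phi> i g = ent e i g - ent f i g" for i g
  have len: "length (p i) + length (p (m - i)) = m * length c" if "i \<le> m" for i
    using that by (simp add: p(2) add_mult_distrib[symmetric])
  have "card {..m} \<le> Q.tgt.dim"
  proof (rule Q.le_dim_image[of "monomials_upto n" "filtration (n - 1)" _ b \<phi>])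
    show "finite (monomials_upto n)" by (rule finite_monomials_upto)
    show "monomials_upto n \<subseteq> filtration n"
      by (auto simp: filtration_def intro: fa.span_base)
    show "filtration (n - 1) \<subseteq> filtration n" by (rule filtration_mono) simp
    show "filtration_coset n g = \<zero>\<^bsub>filtration_quotient TYPE('k) G n\<^esub>" if "g \<in> filtration (n - 1)" for g
      using that by (simp add: filtration_quotient_zero filtration_coset_zero_iff)
    have "monomials_upto n \<union> lpa_ideal G \<subseteq> monomials_upto n \<union> filtration (n - 1)"
      using lpa_ideal_subset_filtration by blast
    then show "filtration n \<subseteq> fa.span (monomials_upto n \<union> filtration (n - 1))"
      unfolding filtration_def[of n] by (rule fa.span_mono)
    show "b i \<in> filtration n" if "i \<in> {..m}" for i
    proof -
      have "int (length (p i @ [e]) + length (p (m - i) @ [e])) \<le> n"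
        using len[of i] that by (simp add: n_def)
      then have "b i \<in> monomials_upto n"
        unfolding monomials_upto_def b_def using pa[OF e] by blast
      then show ?thesis by (simp add: filtration_def fa.span_base)
    qed
    show "\<phi> i (g + h) = \<phi> i g + \<phi> i h" for i g h
      by (simp add: \<phi>_def ent_def rep_add)
    show "\<phi> i (scale c g) = c * \<phi> i g" for i c g
      by (simp add: \<phi>_def ent_def rep_scale algebra_simps)
    show "\<phi> i g = 0" if "i \<in> {..m}" "filtration_coset n g = \<zero>\<^bsub>filtration_quotient TYPE('k) G n\<^esub>" for i g
    proof -
      have "filtration (n - 1) \<subseteq> {g. \<phi> i g = 0}"
        unfolding filtration_def
      proof (rule fa.span_minimal)
        show "fa.subspace {g. \<phi> i g = 0}"
          by (auto simp: fa.subspace_def \<phi>_def ent_def rep_add rep_scale)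
        have "\<phi> i (path_ghost a w b') = 0"
          if a: "awalk u a w" and b: "awalk u' b' w" and "int (length a + length b') \<le> n - 1" for a b' w u u'
        proof -
          have l: "length a + length b' < length (p i) + length (p (m - i)) + 2"
            using that(3) len[of i] \<open>i \<in> {..m}\<close> unfolding n_def atMost_iff by linarith
          have "(\<exists>y. src y = w \<and> prepend_path (p i @ [e]) (z e) = prepend_path a y \<and>
              prepend_path (p (m - i) @ [e]) (z e) = prepend_path b' y) \<longleftrightarrow>
            (\<exists>y. src y = w \<and> prepend_path (p i @ [f]) (z f) = prepend_path a y \<and>
              prepend_path (p (m - i) @ [f]) (z f) = prepend_path b' y)"
            using monomial_entry_swap[OF p(1) p(1) e f(1) z(1) z(1) a b l z(2)]
              monomial_entry_swap[OF p(1) p(1) f(1) e z(1) z(1) a b l z(2)] by blast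
          then show ?thesis
            unfolding \<phi>_def ent_def rep_indicator[OF a b] by (simp only: diff_self)
        qed
        then show "monomials_upto (n - 1) \<union> lpa_ideal G \<subseteq> {g. \<phi> i g = 0}"
          by (auto simp: monomials_upto_def \<phi>_def ent_def rep_ideal)
      qed
      then show ?thesis
        using that by (auto simp: filtration_quotient_zero filtration_coset_zero_iff)
    qed
    \<comment> \<open>The points have degree zero before the paths are prepended, so comparing degrees compares lengths.\<close>
    show "\<phi> i (b j) = (if i = j then 1 else 0)" if ij: "i \<in> {..m}" "j \<in> {..m}" for i j
    proof -
      have eq: "i = j \<and> a = e"
        if a: "a \<in> out_arcs G v" and y: "src y = head G e"
          "prepend_path (p i @ [a]) (z a) = prepend_path (p j @ [e]) y"
          "prepend_path (p (m - i) @ [a]) (z a) = prepend_path (p (m - j) @ [e]) y" for a y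
      proof -
        have "int (i * length c) = deg y + int (j * length c)"
          "int ((m - i) * length c) = deg y + int ((m - j) * length c)"
          using arg_cong[OF y(2), of deg] arg_cong[OF y(3), of deg] z(2)
          by (simp_all add: deg_prepend_path p(2))
        then have "int (i * length c) + int ((m - j) * length c) = int (j * length c) + int ((m - i) * length c)"
          by linarith
        then have "(i + (m - j)) * length c = (j + (m - i)) * length c"
          unfolding add_mult_distrib of_nat_add[symmetric] of_nat_eq_iff .
        then have "i = j" using cw(2) ij by auto
        moreover have "a = e"
          using prepend_path_eq[OF pa[OF a] pa[OF e] z(1) y(1,2)] \<open>i = j\<close> by auto
        ultimately show ?thesis by simp
      qed
      have "ent e i (b i) = 1"
        unfolding ent_def b_def rep_indicator[OF pa[OF e] pa[OF e]] using z(1)[of e]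
        by (intro if_P) blast
      moreover have "ent a i (b j) = 0" if "a \<in> out_arcs G v" "i \<noteq> j \<or> a \<noteq> e" for a
        unfolding ent_def b_def rep_indicator[OF pa[OF e] pa[OF e]] using eq[OF that(1)] that(2)
        by (intro if_not_P) blast
      ultimately show ?thesis
        using e f by (auto simp: \<phi>_def)
    qed
  qed simp_all
  then show ?thesis by (simp add: n_def)
qed

section \<open>Rigid vertices\<close>

lemma awalk_split:
  assumes "awalk u (p @ q) w"
  obtains v where "awalk u p v" "awalk v q w"
  using assms by auto

lemma awalk_snoc_iff: "awalk u (p @ [e]) w \<longleftrightarrow> awalk u p (tail G e) \<and> e \<in> arcs G \<and> head G e = w"
proof
  assume "awalk u (p @ [e]) w"
  then show "awalk u p (tail G e) \<and> e \<in> arcs G \<and> head G e = w"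
    by (elim awalk_split) (auto simp: awalk_simps)
next
  assume "awalk u p (tail G e) \<and> e \<in> arcs G \<and> head G e = w"
  then show "awalk u (p @ [e]) w"
    using awalk_appendI[of u p "tail G e" "[e]" w] by (auto simp: awalk_simps)
qed

text \<open>
  Sinks are rigid, and so are the vertices on cycles if no cycle has an exit.
\<close>

definition rigid :: "'a \<Rightarrow> bool"
  where "rigid w \<longleftrightarrow>
    (\<forall>p q x y. awalk w p x \<longrightarrow> awalk w q y \<longrightarrow> length p = length q \<longrightarrow> p = q)"

lemma rigidD: "rigid w \<Longrightarrow> awalk w p x \<Longrightarrow> awalk w q y \<Longrightarrow> length p = length q \<Longrightarrow> p = q"
  unfolding rigid_def by blast

lemma rigid_awalk:
  assumes "rigid w" "awalk w p x"
  shows "rigid x"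
  unfolding rigid_def
proof (intro allI impI)
  fix q q' y y' assume "awalk x q y" "awalk x q' y'" "length q = length q'"
  then have "p @ q = p @ q'"
    using awalk_appendI[OF assms(2)] by (intro rigidD[OF assms(1)]) auto
  then show "q = q'" by simp
qed

lemma rigid_prefix:
  assumes "rigid w" "awalk w p x" "awalk w q y" "length p \<le> length q"
  obtains s where "q = p @ s" "awalk x s y"
proof -
  have "awalk w (take (length p) q @ drop (length p) q) y"
    using assms(3) by simp
  then obtain v where v: "awalk w (take (length p) q) v" "awalk v (drop (length p) q) y"
    by (rule awalk_split)
  have "take (length p) q = p"
    using rigidD[OF assms(1) v(1) assms(2)] assms(4) by simp
  then have "q = p @ drop (length p) q" "awalk w p v"
    using v(1) append_take_drop_id[of "length p" q] by simp_all
  moreover have "v = x"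
    using awalk_ends[OF \<open>awalk w p v\<close> assms(2)] by auto
  ultimately show ?thesis using v(2) that by blast
qed

lemma rigid_out_arcs:
  assumes "rigid w" "e \<in> out_arcs G w"
  shows "out_arcs G w = {e}"
proof -
  have "f = e" if "f \<in> out_arcs G w" for f
    using rigidD[OF assms(1), of "[f]" "head G f" "[e]" "head G e"] that assms(2)
    by (auto simp: awalk_simps)
  with assms(2) show ?thesis by blast
qed

text \<open>
  Along a path out of a rigid vertex the sum in (CK2) has a single term.
\<close>

lemma path_ghost_rigid_extend:
  assumes "awalk u p w" "awalk u' q w" "rigid w" "awalk w t x"
  shows "path_ghost (p @ t) x (q @ t) \<simeq> (path_ghost p w q :: (('a, 'b) lpa_gen, 'k::field) free_algebra)"
  using assms
proof (induction t arbitrary: p q w)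
  case Nil
  then show ?case by (auto simp: awalk_Nil_iff)
next
  case (Cons e t)
  have e: "e \<in> out_arcs G w" "awalk (head G e) t x"
    using Cons.prems(4) by (auto simp: awalk_Cons_iff)
  have ends: "awalk u (p @ [e]) (head G e)" "awalk u' (q @ [e]) (head G e)"
    using Cons.prems e unfolding awalk_snoc_iff by auto
  have "path_ghost ((p @ [e]) @ t) x ((q @ [e]) @ t) \<simeq>
      (path_ghost (p @ [e]) (head G e) (q @ [e]) :: (('a, 'b) lpa_gen, 'k) free_algebra)"
    using ends rigid_awalk[OF Cons.prems(3), of "[e]" "head G e"] e
    by (intro Cons.IH) (auto simp: awalk_simps)
  also have "\<dots> \<simeq> path_ghost p w q"
    using path_ghost_expand[OF Cons.prems(1,2)] e rigid_out_arcs[OF Cons.prems(3) e(1)]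
    by (auto intro: eqv_sym)
  finally show ?case by simp
qed

text \<open>
  The elements \<open>pq\<^sup>*\<close> of degree \<open>d\<close> that lead from \<open>w\<close> to \<open>w'\<close>, in the sense that
  multiplication on the left by \<open>w\<close> and on the right by \<open>w'\<close> fixes them.
\<close>

definition monomials_between :: "'a \<Rightarrow> 'a \<Rightarrow> int \<Rightarrow> (('a, 'b) lpa_gen, 'k::field) free_algebra set"
  where "monomials_between w w' d =
    {path_ghost p x q | p x q. awalk w p x \<and> awalk w' q x \<and> int (length p) - int (length q) = d}"

text \<open>
  For rigid vertices, there is at most one such element modulo the relations: the longer of two
  such pairs extends the shorter one by the same path on both sides.
\<close>

lemma monomials_between_eqv:
  assumes w: "rigid w" "rigid w'" and a: "a \<in> monomials_between w w' d" and b: "b \<in> monomials_between w w' d"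
  shows "a \<simeq> b"
proof -
  have *: "path_ghost p' x' q' \<simeq> path_ghost p x q"
    if p: "awalk w p x" "awalk w' q x" and p': "awalk w p' x'" "awalk w' q' x'"
      and len: "int (length p) - int (length q) = d" "int (length p') - int (length q') = d"
        "length p \<le> length p'" for p x q p' x' q'
  proof -
    obtain s where s: "p' = p @ s" "awalk x s x'"
      by (rule rigid_prefix[OF w(1) p(1) p'(1) len(3)])
    have "length q \<le> length q'" using len by linarith
    then obtain s' where s': "q' = q @ s'" "awalk x s' x'"
      by (rule rigid_prefix[OF w(2) p(2) p'(2)])
    have "length s = length s'"
      using len s(1) s'(1) by simp
    then have "s' = s"
      using rigidD[OF rigid_awalk[OF w(1) p(1)] s(2) s'(2)] by simp
    then show ?thesis
      using path_ghost_rigid_extend[OF p rigid_awalk[OF w(1) p(1)] s(2)] s s' by simp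
  qed
  obtain p x q p' x' q' where a: "a = path_ghost p x q" "awalk w p x" "awalk w' q x"
      "int (length p) - int (length q) = d"
    and b: "b = path_ghost p' x' q'" "awalk w p' x'" "awalk w' q' x'"
      "int (length p') - int (length q') = d"
    using a b unfolding monomials_between_def by blast
  show ?thesis
    using *[OF a(2,3) b(2,3) a(4) b(4)] *[OF b(2,3) a(2,3) b(4) a(4)] a(1) b(1)
    by (cases "length p \<le> length p'") (auto intro: eqv_sym)
qed

lemma monomials_between_mult:
  fixes a b :: "(('a, 'b) lpa_gen, 'k::field) free_algebra"
  assumes w': "rigid w'" and a: "a \<in> monomials_between w w' d" and b: "b \<in> monomials_between w' w'' d'"
  shows "\<exists>c \<in> monomials_between w w'' (d + d'). a * b \<simeq> c"
proof -
  obtain p x q where a: "a = path_ghost p x q" "awalk w p x" "awalk w' q x"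
      "int (length p) - int (length q) = d"
    using a unfolding monomials_between_def by blast
  obtain p' x' q' where b: "b = path_ghost p' x' q'" "awalk w' p' x'" "awalk w'' q' x'"
      "int (length p') - int (length q') = d'"
    using b unfolding monomials_between_def by blast
  show ?thesis
  proof (cases "length q \<le> length p'")
    case True
    obtain s where s: "p' = q @ s" "awalk x s x'"
      by (rule rigid_prefix[OF w' a(3) b(2) True])
    have "a * b \<simeq> path_ghost (p @ s) x' q'"
      using path_ghost_mult_left[OF a(2,3) _ b(3), of s] b(2) s(1) a(1) b(1) by simp
    moreover have "path_ghost (p @ s) x' q' \<in> (monomials_between w w'' (d + d') :: (('a, 'b) lpa_gen, 'k) free_algebra set)"
      unfolding monomials_between_def mem_Collect_eq
      using awalk_appendI[OF a(2) s(2)] b(3) a(4) b(4) s(1)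
      by (intro exI[of _ "p @ s"] exI[of _ x'] exI[of _ q']) (simp add: awalk_append_iff[symmetric] del: awalk_append_iff)
    ultimately show ?thesis by blast
  next
    case False
    then have "length p' \<le> length q" by simp
    then obtain s where s: "q = p' @ s" "awalk x' s x"
      by (rule rigid_prefix[OF w' b(2) a(3)])
    have "a * b \<simeq> path_ghost p x (q' @ s)"
      using path_ghost_mult_right[OF a(2) _ b(2,3), of s] a(3) s(1) a(1) b(1) by simp
    moreover have "path_ghost p x (q' @ s) \<in> (monomials_between w w'' (d + d') :: (('a, 'b) lpa_gen, 'k) free_algebra set)"
      unfolding monomials_between_def mem_Collect_eq
      using awalk_appendI[OF b(3) s(2)] a(2) a(4) b(4) s(1)
      by (intro exI[of _ p] exI[of _ x] exI[of _ "q' @ s"]) (simp add: awalk_append_iff[symmetric] del: awalk_append_iff)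
    ultimately show ?thesis by blast
  qed
qed

lemma monomials_between_A1: "a \<in> monomials_between w w' d \<Longrightarrow> a \<in> A1"
  unfolding monomials_between_def by (auto intro: path_ghost_in_A1)

lemma monomials_between_vertex:
  assumes "a \<in> monomials_between w w' d"
  shows "x \<in> verts G \<Longrightarrow> a * wd [Vertex x] \<simeq> (if x = w' then a else 0)"
    and "x \<in> verts G \<Longrightarrow> wd [Vertex x] * a \<simeq> (if x = w then a else 0)"
    and "w \<in> verts G" "w' \<in> verts G"
  using assms unfolding monomials_between_def
  by (auto dest: awalk_hd_in_verts intro!: path_ghost_vertex vertex_path_ghost[THEN eqv_trans] simp del: if_cancel split del: if_split)

text \<open>
  By linearity it suffices to consider \<open>z = pq\<^sup>*\<close>. Then both sides vanish unless \<open>z\<close> leads from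
  \<open>w'\<close> to \<open>w\<close>. In that case both sides lead from \<open>w\<close> to \<open>w'\<close> and have the same degree,
  the sum of the three degrees, so they are equal.
\<close>

lemma monomials_between_swap:
  fixes a a' z :: "(('a, 'b) lpa_gen, 'k::field) free_algebra"
  assumes w: "rigid w" "rigid w'" and a: "a \<in> monomials_between w w' d" and a': "a' \<in> monomials_between w w' d'"
    and z: "z \<in> A1"
  shows "a * z * a' \<simeq> a' * z * a"
proof -
  note aA = monomials_between_A1[OF a] monomials_between_A1[OF a']
  note wv = monomials_between_vertex(3,4)[OF a]
  note VA = vertex_in_A1[OF wv(1)] vertex_in_A1[OF wv(2)]
  \<comment> \<open>The vertices around z turn it into an element without constant term, to which the spanning set applies.\<close>
  define z' where "z' = wd [Vertex w'] * z * wd [Vertex w]"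
  have z': "z' \<in> A0"
    unfolding z'_def using wv VA z
    by (intro nonunital_mult_right[OF nonunital_mult_right] wd_in_nonunital) auto
  have swap_monomial: "a * m * a' \<simeq> a' * m * a" if m: "m \<in> monomials" for m
  proof -
    obtain p x q u u' where m: "m = path_ghost p x q" "awalk u p x" "awalk u' q x"
      using m unfolding monomials_def by blast
    have mA: "m \<in> A1" using m by (auto intro: path_ghost_in_A1)
    have mb: "m \<in> monomials_between u u' (int (length p) - int (length q))"
      using m unfolding monomials_between_def by blast
    show ?thesis
    proof (cases "u = w' \<and> u' = w")
      case True
      define k where "k = int (length p) - int (length q)"
      have "\<exists>c \<in> monomials_between w w' (d1 + (k + d2)). b * m * b' \<simeq> c"
        if b: "b \<in> monomials_between w w' d1" "b' \<in> monomials_between w w' d2" for b b' d1 d2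
      proof -
        have "m \<in> monomials_between w' w k"
          using mb True by (simp add: k_def)
        then obtain c where c: "c \<in> monomials_between w' w' (k + d2)" "m * b' \<simeq> c"
          using monomials_between_mult[OF w(1) _ b(2)] by blast
        obtain c' where c': "c' \<in> monomials_between w w' (d1 + (k + d2))" "b * c \<simeq> c'"
          using monomials_between_mult[OF w(2) b(1) c(1)] by blast
        have "b * (m * b') \<simeq> b * c"
          by (intro eqv_mult_left c(2) monomials_between_A1[OF b(1)])
        with c' show ?thesis by (metis eqv_trans mult.assoc)
      qed
      from this[OF a a'] this[OF a' a] obtain c c' where
        "c \<in> monomials_between w w' (d + (k + d'))" "a * m * a' \<simeq> c"
        "c' \<in> monomials_between w w' (d' + (k + d))" "a' * m * a \<simeq> c'" by blast
      moreover have "d' + (k + d) = d + (k + d')" by simp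
      ultimately show ?thesis
        using monomials_between_eqv[OF w, of c _ c'] eqv_sym eqv_trans by metis
    next
      case False
      have zero: "b * m * b' \<simeq> 0"
        if b: "b \<in> monomials_between w w' d1" "b' \<in> monomials_between w w' d2" for b b' d1 d2
      proof (cases "u = w'")
        case True
        then have "u' \<noteq> w" using False by simp
        have "b * m * b' \<simeq> b * m * (wd [Vertex w] * b')"
          using monomials_between_vertex(2)[OF b(2) wv(1)] monomials_between_A1[OF b(1)] mA
          by (intro eqv_mult_left free_algebra_on_mult) (auto intro: eqv_sym)
        also have "\<dots> = b * (m * wd [Vertex w]) * b'" by (simp only: mult.assoc)
        also have "\<dots> \<simeq> b * 0 * b'"
          using monomials_between_vertex(1)[OF mb wv(1)] \<open>u' \<noteq> w\<close> monomials_between_A1[OF b(1)]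
            monomials_between_A1[OF b(2)]
          by (intro eqv_mult_left eqv_mult_right) auto
        finally show ?thesis by simp
      next
        case neq: False
        have "b * m * b' \<simeq> b * wd [Vertex w'] * m * b'"
          using monomials_between_vertex(1)[OF b(1) wv(2)] monomials_between_A1[OF b(2)] mA
          by (intro eqv_mult_right) (auto intro: eqv_sym)
        also have "\<dots> = b * (wd [Vertex w'] * m) * b'" by (simp only: mult.assoc)
        also have "\<dots> \<simeq> b * 0 * b'"
          using monomials_between_vertex(2)[OF mb wv(2)] neq monomials_between_A1[OF b(1)]
            monomials_between_A1[OF b(2)]
          by (intro eqv_mult_left eqv_mult_right) auto
        finally show ?thesis by simp
      qed
      show ?thesis
        using zero[OF a a'] zero[OF a' a] eqv_sym eqv_trans by metis
    qed
  qed
  have "fa.subspace {m. a * m * a' - a' * m * a \<in> lpa_ideal G}"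
    unfolding fa.subspace_def
  proof (intro conjI ballI allI)
    fix x y assume "x \<in> {m. a * m * a' - a' * m * a \<in> lpa_ideal G}" "y \<in> {m. a * m * a' - a' * m * a \<in> lpa_ideal G}"
    then have "(a * x * a' - a' * x * a) + (a * y * a' - a' * y * a) \<in> lpa_ideal G"
      by (intro lpa_ideal_closed(2)) auto
    then show "x + y \<in> {m. a * m * a' - a' * m * a \<in> lpa_ideal G}"
      by (simp add: algebra_simps)
  next
    fix c x assume "x \<in> {m. a * m * a' - a' * m * a \<in> lpa_ideal G}"
    then have "scale c (a * x * a' - a' * x * a) \<in> lpa_ideal G"
      by (intro lpa_ideal_closed(5)) auto
    then show "scale c x \<in> {m. a * m * a' - a' * m * a \<in> lpa_ideal G}"
      by (simp add: mult_scale_right scale_mult_left fa.scale_right_diff_distrib)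
  qed (simp add: lpa_ideal_closed)
  moreover have "a * m * a' - a' * m * a \<in> lpa_ideal G" if "m \<in> lpa_ideal G" for m
    by (intro lpa_ideal_closed(3) lpa_ideal_mult_right[OF lpa_ideal_mult_left[OF that]] aA)
  then have "monomials \<union> lpa_ideal G \<subseteq> {m. a * m * a' - a' * m * a \<in> lpa_ideal G}"
    using swap_monomial by (auto simp: eqv_def)
  ultimately have "fa.span (monomials \<union> lpa_ideal G) \<subseteq> {m. a * m * a' - a' * m * a \<in> lpa_ideal G}"
    by (intro fa.span_minimal)
  then have swap: "a * z' * a' \<simeq> a' * z' * a"
    using A0_subset_span z' unfolding eqv_def by blast
  have sandwich: "b * z * b' \<simeq> b * z' * b'"
    if b: "b \<in> monomials_between w w' d1" "b' \<in> monomials_between w w' d2" for b b' d1 d2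
  proof -
    have "b \<simeq> b * wd [Vertex w']" "b' \<simeq> wd [Vertex w] * b'"
      using monomials_between_vertex(1)[OF b(1) wv(2)] monomials_between_vertex(2)[OF b(2) wv(1)]
      by (auto intro: eqv_sym)
    then have "(b * z) * b' \<simeq> (b * wd [Vertex w'] * z) * (wd [Vertex w] * b')"
      using monomials_between_A1[OF b(1)] monomials_between_A1[OF b(2)] z VA
      by (intro eqv_mult eqv_mult_right free_algebra_on_mult)
    also have "\<dots> = b * z' * b'" by (simp add: z'_def mult.assoc)
    finally show ?thesis .
  qed
  show ?thesis
    using eqv_trans[OF eqv_trans[OF sandwich[OF a a'] swap] eqv_sym[OF sandwich[OF a' a]]] .
qed

section \<open>Graphs in which no cycle has an exit\<close>

definition no_exit :: bool
  where "no_exit \<longleftrightarrow> \<not> (\<exists>v c f. cycle_exit v c f)"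

definition cyclic :: "'a \<Rightarrow> bool"
  where "cyclic v \<longleftrightarrow> (\<exists>c. c \<noteq> [] \<and> awalk v c v)"

lemma cyclic_awalk:
  assumes "no_exit" "cyclic v" "awalk v p w"
  shows "cyclic w"
  using assms(2,3)
proof (induction p arbitrary: v)
  case Nil
  then show ?case by (auto simp: awalk_Nil_iff)
next
  case (Cons e p)
  then obtain c where c: "c \<noteq> []" "awalk v c v" by (auto simp: cyclic_def)
  have e: "e \<in> out_arcs G v" "awalk (head G e) p w"
    using Cons.prems by (auto simp: awalk_Cons_iff)
  then have "hd c = e"
    using assms(1) c unfolding no_exit_def cycle_exit_def by blast
  then obtain c' where "c = e # c'" using c by (cases c) auto
  then have "awalk (head G e) (c' @ [e]) (head G e)"
    using c(2) e(1) unfolding awalk_snoc_iff by (auto simp: awalk_Cons_iff)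
  then have "cyclic (head G e)" unfolding cyclic_def by blast
  with Cons.IH e(2) show ?case by blast
qed

lemma cyclic_rigid:
  assumes "no_exit" "cyclic v"
  shows "rigid v"
proof -
  have "p = q" if "cyclic v" "awalk v p x" "awalk v q y" "length p = length q" for v p q x y
    using that
  proof (induction p arbitrary: v q)
    case Nil
    then show ?case by simp
  next
    case (Cons e p)
    then obtain f q' where q: "q = f # q'" by (cases q) auto
    obtain c where c: "c \<noteq> []" "awalk v c v" using Cons.prems by (auto simp: cyclic_def)
    have ef: "e \<in> out_arcs G v" "awalk (head G e) p x" "f \<in> out_arcs G v" "awalk (head G f) q' y"
      using Cons.prems q by (auto simp: awalk_Cons_iff)
    then have "e = hd c" "f = hd c"
      using assms(1) c unfolding no_exit_def cycle_exit_def by blast+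
    moreover have "cyclic (head G e)"
      using cyclic_awalk[OF assms(1) Cons.prems(1), of "[e]" "head G e"] ef by (auto simp: awalk_simps)
    ultimately show ?case
      using Cons.IH[of "head G e" q'] Cons.prems ef q by auto
  qed
  with assms(2) show ?thesis unfolding rigid_def by blast
qed

lemma sink_rigid:
  assumes "out_arcs G v = {}"
  shows "rigid v"
proof -
  have "p = []" if "awalk v p x" for p x
    using that assms by (cases p) (auto simp: awalk_Cons_iff)
  then show ?thesis unfolding rigid_def by blast
qed

text \<open>
  Such a path visits some vertex twice; from then on it stays on a cycle.
\<close>

lemma long_walk_cyclic:
  assumes "no_exit" "awalk u p w" "card (verts G) \<le> length p"
  shows "cyclic w"
proof -
  have "set (awalk_verts u p) \<subseteq> verts G"
    using assms(2) by blast
  then have "card (set (awalk_verts u p)) \<le> card (verts G)"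
    by (intro card_mono finite_verts)
  then have "\<not> distinct (awalk_verts u p)"
    using assms(3) by (auto dest!: distinct_card simp: length_awalk_verts)
  then obtain q r s x where "0 < length r" "awalk x r x" "awalk x s w"
    using awalk_not_distinct_decomp[OF assms(2)] by blast
  then show ?thesis
    using cyclic_awalk[OF assms(1), of x s w] unfolding cyclic_def by auto
qed

text \<open>
  At the common head there are closed paths ending in \<open>e\<close> and in \<open>f\<close>. Suitable powers of them
  have the same length, so they are equal by rigidity, and so are their last edges.
\<close>

lemma cyclic_in_arc_unique:
  assumes "no_exit" "e \<in> arcs G" "f \<in> arcs G" "head G e = head G f" "cyclic (tail G e)" "cyclic (tail G f)"
  shows "e = f"
proof -
  have closed: "\<exists>t. awalk (head G e) (t @ [e]) (head G e)" if "e \<in> arcs G" "cyclic (tail G e)" for e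
  proof -
    obtain c where c: "c \<noteq> []" "awalk (tail G e) c (tail G e)"
      using \<open>cyclic (tail G e)\<close> by (auto simp: cyclic_def)
    have "hd c = e"
      using assms(1) c that unfolding no_exit_def cycle_exit_def by (auto simp: out_arcs_def)
    then obtain t where "c = e # t" using c by (cases c) auto
    then show ?thesis
      using c(2) that(1) unfolding awalk_snoc_iff by (auto simp: awalk_Cons_iff)
  qed
  obtain t where t: "awalk (head G e) (t @ [e]) (head G e)"
    using closed assms by blast
  obtain t' where t': "awalk (head G e) (t' @ [f]) (head G e)"
    using closed[of f] assms by auto
  have "rigid (head G e)"
    using t by (intro cyclic_rigid[OF assms(1)]) (auto simp: cyclic_def)
  then have "cycle_pow (t @ [e]) (Suc (length t')) = cycle_pow (t' @ [f]) (Suc (length t))"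
    by (rule rigidD[OF _ awalk_cycle_pow[OF t] awalk_cycle_pow[OF t']])
      (simp only: length_cycle_pow length_append list.size, simp)
  then have "cycle_pow (t @ [e]) (length t' + 1) = cycle_pow (t' @ [f]) (length t + 1)" by simp
  then show ?thesis
    unfolding cycle_pow_add by simp
qed

text \<open>
  If \<open>N\<close> is the number of vertices and no cycle has an exit, then the initial segments of length
  \<open>N\<close> of the two paths end at rigid vertices, unless a path is shorter and ends at a sink.
\<close>

definition long_monomials :: "nat \<Rightarrow> (('a, 'b) lpa_gen, 'k::field) free_algebra set"
  where "long_monomials N = {path_ghost p w q | p w q. (\<exists>u. awalk u p w) \<and> (\<exists>u. awalk u q w) \<and>
    (out_arcs G w = {} \<or> N \<le> length p \<and> N \<le> length q)}"

lemma long_monomials_subset: "long_monomials N \<subseteq> A0"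
  unfolding long_monomials_def by (auto intro: path_ghost_in_A0)

text \<open>
  Repeated expansion by (CK2) makes both paths of \<open>pq\<^sup>*\<close> longer, until they end at a sink.
\<close>

lemma A0_subset_span_long:
  "(A0 :: (('a, 'b) lpa_gen, 'k::field) free_algebra set) \<subseteq> fa.span (long_monomials N \<union> lpa_ideal G)"
proof -
  have "(monomials :: (('a, 'b) lpa_gen, 'k) free_algebra set) \<subseteq> fa.span (long_monomials N \<union> lpa_ideal G)"
  proof (induction N)
    case 0
    show ?case
      by (rule subset_trans[OF _ fa.span_superset]) (auto simp: monomials_def long_monomials_def)
  next
    case (Suc N)
    let ?S = "fa.span (long_monomials (Suc N) \<union> lpa_ideal G) :: (('a, 'b) lpa_gen, 'k) free_algebra set"
    have "long_monomials N \<subseteq> ?S"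
    proof
      fix m :: "(('a, 'b) lpa_gen, 'k) free_algebra" assume "m \<in> long_monomials N"
      then obtain p w q u u' where m: "m = path_ghost p w q" "awalk u p w" "awalk u' q w"
        and len: "out_arcs G w = {} \<or> N \<le> length p \<and> N \<le> length q"
        unfolding long_monomials_def by blast
      show "m \<in> ?S"
      proof (cases "out_arcs G w = {}")
        case True
        with m show ?thesis by (intro fa.span_base) (auto simp: long_monomials_def)
      next
        case False
        have "path_ghost (p @ [e]) (head G e) (q @ [e]) \<in> ?S" if "e \<in> out_arcs G w" for e
        proof -
          have "awalk u (p @ [e]) (head G e)" "awalk u' (q @ [e]) (head G e)"
            using m that unfolding awalk_snoc_iff by auto
          moreover have "Suc N \<le> length (p @ [e])" "Suc N \<le> length (q @ [e])"
            using len False by auto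
          ultimately show ?thesis
            unfolding long_monomials_def by (intro fa.span_base) blast
        qed
        then show ?thesis
          unfolding m(1) by (intro eqv_in_span[OF path_ghost_expand[OF m(2,3) False]] fa.span_sum)
      qed
    qed
    then have "fa.span (long_monomials N \<union> lpa_ideal G) \<subseteq> ?S"
      by (intro fa.span_minimal) (auto intro: fa.span_base)
    with Suc show ?case by blast
  qed
  then have "fa.span (monomials \<union> lpa_ideal G :: (('a, 'b) lpa_gen, 'k) free_algebra set) \<subseteq>
      fa.span (long_monomials N \<union> lpa_ideal G)"
    by (intro fa.span_minimal) (auto intro: fa.span_base)
  with A0_subset_span show ?thesis by blast
qed

lemma take_awalk:
  assumes "awalk u p w"
  obtains v where "awalk u (take N p) v" "awalk v (drop N p) w"
  using assms awalk_split[of u "take N p" "drop N p" w] by auto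

text \<open>
  The initial segment of length \<open>card (verts G)\<close> leads to a cycle, and from there the length
  determines the path.
\<close>

lemma walk_determined:
  assumes "no_exit" "awalk u p w" "awalk u' q w'" "length p = length q"
    and eq: "take (card (verts G)) p = take (card (verts G)) q"
  shows "p = q"
proof (cases "length p \<le> card (verts G)")
  case True
  then show ?thesis using eq assms(4) by simp
next
  case False
  let ?N = "card (verts G)"
  obtain v where v: "awalk u (take ?N p) v" "awalk v (drop ?N p) w"
    by (rule take_awalk[OF assms(2)])
  obtain v' where v': "awalk u' (take ?N q) v'" "awalk v' (drop ?N q) w'"
    by (rule take_awalk[OF assms(3)])
  have "0 < ?N"
    using awalk_hd_in_verts[OF assms(2)] by (auto simp: card_gt_0_iff)
  then have "take ?N p \<noteq> []" using False by auto
  then have "v = v'"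
    using awalk_ends[OF v(1) v'(1)[folded eq]] by simp
  have "rigid v"
    using False by (intro cyclic_rigid[OF assms(1)] long_walk_cyclic[OF assms(1) v(1)]) simp
  then have "drop ?N p = drop ?N q"
    using rigidD[OF _ v(2) v'(2)[folded \<open>v = v'\<close>]] assms(4) by simp
  with eq show ?thesis by (metis append_take_drop_id)
qed

definition short_walks :: "'b list set"
  where "short_walks = {p. set p \<subseteq> arcs G \<and> length p \<le> card (verts G)}"

lemma finite_short_walks: "finite short_walks"
  unfolding short_walks_def by (intro finite_lists_length_le finite_arcs)

lemma take_in_short_walks: "awalk u p w \<Longrightarrow> take (card (verts G)) p \<in> short_walks"
  unfolding short_walks_def using awalk_set_arcs[of u p w] by (auto dest: in_set_takeD)

text \<open>
  These represent generators of \<open>W\<^sub>n\<close> modulo \<open>W\<^sub>n\<^sub>-\<^sub>1\<close>, see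
  \<open>filtration_subset_span_top\<close>.
\<close>

definition top_monomials :: "int \<Rightarrow> (('a, 'b) lpa_gen, 'k::field) free_algebra set"
  where "top_monomials n = {path_ghost p w q | p w q. (\<exists>u. awalk u p w) \<and> (\<exists>u. awalk u q w) \<and>
    int (length p + length q) = n \<and> (length p \<le> card (verts G) \<or> length q \<le> card (verts G))}"

lemma top_monomials_subset: "top_monomials n \<subseteq> monomials_upto n"
  unfolding top_monomials_def monomials_upto_def by blast

text \<open>
  One of the two paths is short. The other one is determined by its initial segment, since its
  length is fixed by \<open>n\<close> and the length of the short path.
\<close>

lemma card_top_monomials:
  assumes "no_exit"
  shows "card (top_monomials n :: (('a, 'b) lpa_gen, 'k::field) free_algebra set) \<le>
    2 * card (short_walks \<times> verts G \<times> short_walks)"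
proof -
  let ?N = "card (verts G)"
  define A where "A = {(p, w, q). (\<exists>u. awalk u p w) \<and> (\<exists>u. awalk u q w) \<and> int (length p + length q) = n \<and> length p \<le> ?N}"
  define B where "B = {(p, w, q). (\<exists>u. awalk u p w) \<and> (\<exists>u. awalk u q w) \<and> int (length p + length q) = n \<and> length q \<le> ?N}"
  define K where "K = short_walks \<times> verts G \<times> short_walks"
  have fin: "finite K"
    unfolding K_def by (intro finite_cartesian_product finite_short_walks finite_verts)
  have short: "p \<in> short_walks" if "awalk u p w" "length p \<le> ?N" for u p w
    using awalk_set_arcs[OF that(1)] that(2) by (auto simp: short_walks_def)
  have injA: "inj_on (\<lambda>(p, w, q). (p, w, take ?N q)) A"
    unfolding A_def by (intro inj_onI) (auto intro: walk_determined[OF assms])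
  have subA: "(\<lambda>(p, w, q). (p, w, take ?N q)) ` A \<subseteq> K"
    unfolding A_def K_def by (auto intro: short take_in_short_walks dest: awalk_last_in_verts)
  have injB: "inj_on (\<lambda>(p, w, q). (take ?N p, w, q)) B"
    unfolding B_def by (intro inj_onI) (auto intro: walk_determined[OF assms])
  have subB: "(\<lambda>(p, w, q). (take ?N p, w, q)) ` B \<subseteq> K"
    unfolding B_def K_def by (auto intro: short take_in_short_walks dest: awalk_last_in_verts)
  have finAB: "finite A" "finite B"
    using inj_on_finite[OF injA subA fin] inj_on_finite[OF injB subB fin] by auto
  have "top_monomials n \<subseteq> (\<lambda>(p, w, q). path_ghost p w q :: (('a, 'b) lpa_gen, 'k) free_algebra) ` (A \<union> B)"
  proof
    fix m :: "(('a, 'b) lpa_gen, 'k) free_algebra" assume "m \<in> top_monomials n"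
    then obtain p w q where "m = path_ghost p w q" "\<exists>u. awalk u p w" "\<exists>u. awalk u q w"
      "int (length p + length q) = n" "length p \<le> ?N \<or> length q \<le> ?N"
      unfolding top_monomials_def by blast
    then show "m \<in> (\<lambda>(p, w, q). path_ghost p w q) ` (A \<union> B)"
      unfolding A_def B_def by (intro image_eqI[of _ _ "(p, w, q)"]) auto
  qed
  then have "card (top_monomials n :: (('a, 'b) lpa_gen, 'k) free_algebra set) \<le> card (A \<union> B)"
    using finAB by (intro surj_card_le) auto
  also have "\<dots> \<le> card A + card B" by (rule card_Un_le)
  also have "\<dots> \<le> card K + card K"
    by (intro add_mono card_inj_on_le[OF injA subA fin] card_inj_on_le[OF injB subB fin])
  finally show ?thesis by (simp add: K_def)
qed

text \<open>
  If both paths are longer than the number of vertices, their last edges start on cycles and have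
  the same head. By \<open>cyclic_in_arc_unique\<close> they coincide, and (CK2) removes them.
\<close>

lemma filtration_subset_span_top:
  assumes "no_exit"
  shows "(filtration n :: (('a, 'b) lpa_gen, 'k::field) free_algebra set) \<subseteq> fa.span (top_monomials n \<union> filtration (n - 1))"
proof -
  let ?N = "card (verts G)"
  let ?S = "fa.span (top_monomials n \<union> filtration (n - 1)) :: (('a, 'b) lpa_gen, 'k) free_algebra set"
  let ?m = "path_ghost :: 'b list \<Rightarrow> 'a \<Rightarrow> 'b list \<Rightarrow> (('a, 'b) lpa_gen, 'k) free_algebra"
  have "?m p w q \<in> ?S"
    if p: "awalk u p w" and q: "awalk u' q w" and len: "int (length p + length q) \<le> n" for p w q u u'
  proof -
    consider "int (length p + length q) \<le> n - 1"
      | "int (length p + length q) = n" "length p \<le> ?N \<or> length q \<le> ?N"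
      | "int (length p + length q) = n" "?N < length p" "?N < length q"
      using len by linarith
    then show ?thesis
    proof cases
      case 1
      then have "?m p w q \<in> monomials_upto (n - 1)"
        using p q unfolding monomials_upto_def by blast
      then have "?m p w q \<in> filtration (n - 1)"
        unfolding filtration_def by (rule fa.span_base[OF UnI1])
      then show ?thesis by (simp add: fa.span_base)
    next
      case 2
      then have "?m p w q \<in> top_monomials n"
        using p q unfolding top_monomials_def by blast
      then show ?thesis by (simp add: fa.span_base)
    next
      case 3
      obtain p' e where p': "p = p' @ [e]" using 3 by (cases p rule: rev_cases) auto
      obtain q' f where q': "q = q' @ [f]" using 3 by (cases q rule: rev_cases) auto
      have e: "awalk u p' (tail G e)" "e \<in> arcs G" "head G e = w"
        using p unfolding p' awalk_snoc_iff by auto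
      have f: "awalk u' q' (tail G f)" "f \<in> arcs G" "head G f = w"
        using q unfolding q' awalk_snoc_iff by auto
      have cyc: "cyclic (tail G e)" "cyclic (tail G f)"
        using 3 p' q' by (auto intro!: long_walk_cyclic[OF assms e(1)] long_walk_cyclic[OF assms f(1)])
      have "e = f"
        using e f cyc by (intro cyclic_in_arc_unique[OF assms]) auto
      have eqv: "?m p w q \<simeq> ?m p' (tail G e) q'"
        unfolding p' q' \<open>e = f\<close>[symmetric] using e f \<open>e = f\<close>
        by (intro path_ghost_rigid_extend[OF e(1)] cyclic_rigid[OF assms cyc(1)]) (auto simp: awalk_simps)
      have "?m p' (tail G e) q' \<in> monomials_upto (n - 1)"
        using e f \<open>e = f\<close> 3(1) p' q' unfolding monomials_upto_def mem_Collect_eq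
        by (intro exI[of _ p'] exI[of _ "tail G e"] exI[of _ q']) auto
      then have "?m p w q \<in> filtration (n - 1)"
        unfolding filtration_def by (rule eqv_in_span[OF eqv fa.span_base[OF UnI1]])
      then show ?thesis by (simp add: fa.span_base)
    qed
  qed
  then show ?thesis
    unfolding filtration_def[of n] using lpa_ideal_subset_filtration[of "n - 1"]
    by (intro fa.span_minimal) (auto simp: monomials_upto_def intro: fa.span_base)
qed

lemma dim_filtration_quotient_le:
  assumes "no_exit"
  shows "vectorspace.dim class_ring (filtration_quotient TYPE('k::field) G n) \<le>
    2 * card (short_walks \<times> verts G \<times> short_walks)"
proof -
  interpret Q: linear_image scale "filtration n" "filtration_coset n" "filtration_quotient TYPE('k) G n"
    by (rule linear_image_filtration_quotient)
  have "Q.tgt.dim \<le> card (top_monomials n :: (('a, 'b) lpa_gen, 'k) free_algebra set)"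
  proof (rule Q.dim_image_le[of _ "filtration (n - 1)"])
    show "finite (top_monomials n :: (('a, 'b) lpa_gen, 'k) free_algebra set)"
      using finite_subset[OF top_monomials_subset finite_monomials_upto] .
    show "top_monomials n \<subseteq> filtration n"
      using top_monomials_subset by (auto simp: filtration_def intro: fa.span_base)
    show "filtration (n - 1) \<subseteq> filtration n" by (rule filtration_mono) simp
    show "filtration_coset n g = \<zero>\<^bsub>filtration_quotient TYPE('k) G n\<^esub>" if "g \<in> filtration (n - 1)" for g
      using that by (simp add: filtration_quotient_zero filtration_coset_zero_iff)
    show "filtration n \<subseteq> fa.span (top_monomials n \<union> filtration (n - 1))"
      by (rule filtration_subset_span_top[OF assms])
  qed
  also have "\<dots> \<le> 2 * card (short_walks \<times> verts G \<times> short_walks)"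
    by (rule card_top_monomials[OF assms])
  finally show ?thesis .
qed

end

section \<open>The standard identity\<close>

definition standard_poly :: "nat \<Rightarrow> (nat, 'k::field) free_algebra"
  where "standard_poly m =
    (\<Sum>\<sigma> | \<sigma> permutes {..<m}. scale (of_int (sign \<sigma>)) (wd (map \<sigma> [0..<m])))"

lemma lookup_standard_poly:
  "Poly_Mapping.lookup (standard_poly m) w =
    (\<Sum>\<sigma> | \<sigma> permutes {..<m}. of_int (sign \<sigma>) * (1 when Letters (map \<sigma> [0..<m]) = w))"
  by (simp add: standard_poly_def lookup_sum wd_def lookup_single)

lemma permutes_eqI_map:
  assumes "\<sigma> permutes {..<m}" "\<tau> permutes {..<m}" "map \<sigma> [0..<m] = map \<tau> [0..<m]"
  shows "\<sigma> = \<tau>"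
proof
  fix i
  show "\<sigma> i = \<tau> i"
  proof (cases "i < m")
    case True
    then show ?thesis using arg_cong[OF assms(3), of "\<lambda>xs. xs ! i"] by simp
  next
    case False
    then show ?thesis using assms(1,2) by (simp add: permutes_not_in)
  qed
qed

lemma lookup_standard_poly_id:
  "Poly_Mapping.lookup (standard_poly m :: (nat, 'k::field) free_algebra) (Letters [0..<m]) = 1"
proof -
  have "of_int (sign \<sigma>) * (1 when Letters (map \<sigma> [0..<m]) = Letters [0..<m]) =
      (if \<sigma> = id then 1 else (0::'k))" if "\<sigma> permutes {..<m}" for \<sigma>
    using permutes_eqI_map[OF that permutes_id] by (auto simp: when_def sign_id)
  then have "Poly_Mapping.lookup (standard_poly m :: (nat, 'k) free_algebra) (Letters [0..<m]) =
      (\<Sum>\<sigma> | \<sigma> permutes {..<m}. if \<sigma> = id then 1 else (0::'k))"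
    unfolding lookup_standard_poly by (intro sum.cong) auto
  also have "\<dots> = 1"
    using permutes_id[of "{..<m}"] finite_permutations[of "{..<m}"] by (simp add: sum.delta)
  finally show ?thesis .
qed

lemma keys_standard_poly:
  assumes "w \<in> Poly_Mapping.keys (standard_poly m :: (nat, 'k::field) free_algebra)"
  shows "length (letters w) = m"
proof (rule ccontr)
  assume "length (letters w) \<noteq> m"
  then have "Poly_Mapping.lookup (standard_poly m :: (nat, 'k) free_algebra) w = 0"
    unfolding lookup_standard_poly by (intro sum.neutral) (auto simp: when_def)
  with assms show False by (simp add: in_keys_iff)
qed

context fin_digraph
begin

lemma subst_poly_superset:
  assumes "finite A" "Poly_Mapping.keys f \<subseteq> A"
  shows "subst_poly f \<alpha> =
    (\<Sum>w\<in>A. scale (Poly_Mapping.lookup f w) (prod_list (map \<alpha> (letters w)) * unit_elt))"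
  unfolding subst_poly_def using assms by (rule fa_sum_keys_superset)

lemma subst_poly_add: "subst_poly (f + g) \<alpha> = subst_poly f \<alpha> + subst_poly g \<alpha>"
proof -
  let ?A = "Poly_Mapping.keys f \<union> Poly_Mapping.keys g"
  have "Poly_Mapping.keys (f + g) \<subseteq> ?A" by (rule keys_add)
  then show ?thesis
    by (simp add: subst_poly_superset[of ?A] lookup_add fa.scale_left_distrib sum.distrib)
qed

lemma subst_poly_scale: "subst_poly (scale c f) \<alpha> = scale c (subst_poly f \<alpha>)"
  by (subst subst_poly_superset[OF _ keys_scale_subset])
    (simp_all add: subst_poly_def fa.scale_sum_right)

lemma subst_poly_sum: "subst_poly (\<Sum>i\<in>A. f i) \<alpha> = (\<Sum>i\<in>A. subst_poly (f i) \<alpha>)"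
proof (induction A rule: infinite_finite_induct)
  case (insert i A)
  then show ?case by (simp add: subst_poly_add)
qed (simp_all add: subst_poly_def)

lemma subst_poly_wd: "subst_poly (wd u) \<alpha> = prod_list (map \<alpha> u) * unit_elt"
  by (simp add: subst_poly_def wd_def)

definition standard_sum ::
  "nat \<Rightarrow> (nat \<Rightarrow> (('a, 'b) lpa_gen, 'k::field) free_algebra) \<Rightarrow> (('a, 'b) lpa_gen, 'k) free_algebra"
  where "standard_sum m \<alpha> =
    (\<Sum>\<sigma> | \<sigma> permutes {..<m}. scale (of_int (sign \<sigma>)) (prod_list (map \<alpha> (map \<sigma> [0..<m]))))"

lemma subst_standard_poly: "subst_poly (standard_poly m) \<alpha> = standard_sum m \<alpha> * unit_elt"
  by (simp add: standard_poly_def standard_sum_def subst_poly_sum subst_poly_scale subst_poly_wd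
      sum_distrib_right scale_mult_left)

lemma standard_word:
  assumes "\<sigma> permutes {..<m}"
  shows "distinct (map \<sigma> [0..<m])" "set (map \<sigma> [0..<m]) = {..<m}"
  using assms by (auto simp: distinct_map permutes_inj_on permutes_image lessThan_atLeast0)

text \<open>
  Only the two letters \<open>i\<close> and \<open>j\<close> change places, and the hypothesis applies to the product
  \<open>z\<close> of the letters between them.
\<close>

lemma prod_swap_letters:
  fixes \<alpha> :: "nat \<Rightarrow> (('a, 'b) lpa_gen, 'k::field) free_algebra"
  assumes u: "distinct u" "i \<in> set u" "j \<in> set u" "i \<noteq> j"
    and \<alpha>: "\<And>l. l \<in> set u \<Longrightarrow> \<alpha> l \<in> A1"
    and comm: "\<And>z. z \<in> A1 \<Longrightarrow> \<alpha> i * z * \<alpha> j \<simeq> \<alpha> j * z * \<alpha> i"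
  shows "prod_list (map \<alpha> (map (transpose i j) u)) \<simeq> prod_list (map \<alpha> u)"
proof -
  have *: "prod_list (map \<alpha> (map (transpose i j) (xs @ k # ys @ l # zs))) \<simeq> prod_list (map \<alpha> (xs @ k # ys @ l # zs))"
    if kl: "k = i \<and> l = j \<or> k = j \<and> l = i" and u_eq: "u = xs @ k # ys @ l # zs" for k l xs ys zs
  proof -
    have notin: "i \<notin> set xs" "j \<notin> set xs" "i \<notin> set ys" "j \<notin> set ys" "i \<notin> set zs" "j \<notin> set zs"
      using kl u(1) unfolding u_eq by auto
    have same: "map (transpose i j) vs = vs" if "i \<notin> set vs" "j \<notin> set vs" for vs
      using that by (induction vs) (auto simp: transpose_def)
    have A: "prod_list (map \<alpha> vs) \<in> A1" if "set vs \<subseteq> set u" for vs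
      using that \<alpha> by (intro prod_list_in_A1) auto
    have AA: "prod_list (map \<alpha> xs) \<in> A1" "prod_list (map \<alpha> ys) \<in> A1" "prod_list (map \<alpha> zs) \<in> A1"
      by (intro A, auto simp: u_eq)+
    have "\<alpha> l * prod_list (map \<alpha> ys) * \<alpha> k \<simeq> \<alpha> k * prod_list (map \<alpha> ys) * \<alpha> l"
      using comm[OF AA(2)] kl by (auto intro: eqv_sym)
    then have "prod_list (map \<alpha> xs) * (\<alpha> l * prod_list (map \<alpha> ys) * \<alpha> k) * prod_list (map \<alpha> zs) \<simeq>
        prod_list (map \<alpha> xs) * (\<alpha> k * prod_list (map \<alpha> ys) * \<alpha> l) * prod_list (map \<alpha> zs)"
      by (intro eqv_mult_left eqv_mult_right AA)
    moreover have "transpose i j k = l" "transpose i j l = k"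
      using kl by auto
    ultimately show ?thesis
      using notin by (simp add: same mult.assoc del: map_map)
  qed
  obtain xs rest where u1: "u = xs @ i # rest" using split_list[OF u(2)] by blast
  have "j \<in> set xs \<or> j \<in> set rest" using u(3,4) unfolding u1 by auto
  then show ?thesis
  proof
    assume "j \<in> set xs"
    then obtain vs ws where "xs = vs @ j # ws" using split_list by metis
    then have "u = vs @ j # ws @ i # rest" using u1 by simp
    from *[OF _ this] this show ?thesis by simp
  next
    assume "j \<in> set rest"
    then obtain vs ws where "rest = vs @ j # ws" using split_list by metis
    then have "u = xs @ i # vs @ j # ws" using u1 by simp
    from *[OF _ this] this show ?thesis by simp
  qed
qed

text \<open>
  The terms for \<open>\<sigma>\<close> and \<open>\<tau> \<circ> \<sigma>\<close>, where \<open>\<tau>\<close> transposes \<open>i\<close> and \<open>j\<close>, cancel.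
  Pairing even with odd permutations in this way works in characteristic two as well, where
  equality of the sum with its negative would give nothing.
\<close>

lemma standard_sum_alternating:
  fixes \<alpha> :: "nat \<Rightarrow> (('a, 'b) lpa_gen, 'k::field) free_algebra"
  assumes ij: "i < m" "j < m" "i \<noteq> j"
    and \<alpha>: "\<And>l. l < m \<Longrightarrow> \<alpha> l \<in> A1"
    and comm: "\<And>z. z \<in> A1 \<Longrightarrow> \<alpha> i * z * \<alpha> j \<simeq> \<alpha> j * z * \<alpha> i"
  shows "standard_sum m \<alpha> \<in> lpa_ideal G"
proof -
  define P where "P \<sigma> = prod_list (map \<alpha> (map \<sigma> [0..<m]))" for \<sigma>
  define \<tau> where "\<tau> = transpose i j"
  define S where "S = {\<sigma>. \<sigma> permutes {..<m}}"
  define Ev where "Ev = {\<sigma> \<in> S. evenperm \<sigma>}"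
  have \<tau>: "\<tau> permutes {..<m}" "\<not> evenperm \<tau>" "\<tau> \<circ> \<tau> = id"
    unfolding \<tau>_def using ij by (auto intro!: permutes_swap_id simp: evenperm_swap)
  have perm: "permutation \<sigma>" if "\<sigma> \<in> S" for \<sigma>
    using that by (auto simp: S_def intro: permutes_imp_permutation[of "{..<m}"])
  have \<tau>S: "\<tau> \<in> S" using \<tau> by (simp add: S_def)
  have comp: "\<tau> \<circ> \<sigma> \<in> S" "evenperm (\<tau> \<circ> \<sigma>) \<longleftrightarrow> \<not> evenperm \<sigma>" if "\<sigma> \<in> S" for \<sigma>
    using that \<tau> evenperm_comp[OF perm[OF \<tau>S] perm[OF that]]
    by (auto simp: S_def intro: permutes_compose)
  have fin: "finite S" unfolding S_def by (intro finite_permutations) simp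
  have odd: "S - Ev = (\<lambda>\<sigma>. \<tau> \<circ> \<sigma>) ` Ev"
  proof (intro equalityI subsetI)
    fix \<sigma> assume "\<sigma> \<in> S - Ev"
    then have "\<tau> \<circ> \<sigma> \<in> Ev" using comp by (auto simp: Ev_def)
    moreover have "\<sigma> = \<tau> \<circ> (\<tau> \<circ> \<sigma>)" by (simp add: comp_assoc[symmetric] \<tau>(3))
    ultimately show "\<sigma> \<in> (\<lambda>\<sigma>. \<tau> \<circ> \<sigma>) ` Ev" by blast
  qed (auto simp: Ev_def comp)
  have inj: "inj_on (\<lambda>\<sigma>. \<tau> \<circ> \<sigma>) Ev"
    by (rule inj_on_inverseI[of _ "\<lambda>\<sigma>. \<tau> \<circ> \<sigma>"]) (simp add: comp_assoc[symmetric] \<tau>(3))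
  have "standard_sum m \<alpha> = (\<Sum>\<sigma>\<in>S. scale (of_int (sign \<sigma>)) (P \<sigma>))"
    by (simp add: standard_sum_def P_def S_def)
  also have "\<dots> = (\<Sum>\<sigma>\<in>S - Ev. scale (of_int (sign \<sigma>)) (P \<sigma>)) + (\<Sum>\<sigma>\<in>Ev. scale (of_int (sign \<sigma>)) (P \<sigma>))"
    using fin by (intro sum.subset_diff) (auto simp: Ev_def)
  also have "(\<Sum>\<sigma>\<in>S - Ev. scale (of_int (sign \<sigma>)) (P \<sigma>)) = (\<Sum>\<sigma>\<in>Ev. - P (\<tau> \<circ> \<sigma>))"
    unfolding odd using inj by (subst sum.reindex) (auto simp: Ev_def sign_def comp intro!: sum.cong)
  also have "(\<Sum>\<sigma>\<in>Ev. scale (of_int (sign \<sigma>)) (P \<sigma>)) = (\<Sum>\<sigma>\<in>Ev. P \<sigma>)"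
    by (intro sum.cong) (auto simp: Ev_def sign_def)
  also have "(\<Sum>\<sigma>\<in>Ev. - P (\<tau> \<circ> \<sigma>)) + (\<Sum>\<sigma>\<in>Ev. P \<sigma>) = (\<Sum>\<sigma>\<in>Ev. P \<sigma> - P (\<tau> \<circ> \<sigma>))"
    by (simp add: sum_negf sum_subtractf)
  also have "\<dots> \<in> lpa_ideal G"
  proof (rule fa.subspace_sum[OF subspace_lpa_ideal])
    fix \<sigma> assume "\<sigma> \<in> Ev"
    then have \<sigma>: "\<sigma> permutes {..<m}" by (simp add: Ev_def S_def)
    have "prod_list (map \<alpha> (map (transpose i j) (map \<sigma> [0..<m]))) \<simeq> prod_list (map \<alpha> (map \<sigma> [0..<m]))"
      using standard_word[OF \<sigma>] ij \<alpha> comm by (intro prod_swap_letters) (auto simp del: map_map)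
    then have "P (\<tau> \<circ> \<sigma>) \<simeq> P \<sigma>" by (simp add: P_def \<tau>_def comp_def)
    then show "P \<sigma> - P (\<tau> \<circ> \<sigma>) \<in> lpa_ideal G"
      using eqv_sym eqv_def by blast
  qed
  finally show ?thesis .
qed

text \<open>
  The letter \<open>k\<close> occurs exactly once in each word, and \<open>U\<close> and \<open>V\<close> are the values of the parts
  before and after it.
\<close>

lemma standard_sum_multilinear:
  fixes \<alpha> :: "nat \<Rightarrow> (('a, 'b) lpa_gen, 'k::field) free_algebra"
  assumes k: "k < m" and \<alpha>: "\<forall>l<m. \<alpha> l \<in> A1"
  shows "\<exists>S s U V. (\<forall>\<sigma>\<in>S. U \<sigma> \<in> A1 \<and> V \<sigma> \<in> A1) \<and>
    (\<forall>x. standard_sum m (\<alpha>(k := x)) = (\<Sum>\<sigma>\<in>(S :: (nat \<Rightarrow> nat) set). scale (s \<sigma>) (U \<sigma> * x * V \<sigma>)))"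
proof -
  let ?S = "{\<sigma>. \<sigma> permutes {..<m}}"
  have "\<forall>\<sigma>\<in>?S. \<exists>UV. fst UV \<in> A1 \<and> snd UV \<in> A1 \<and>
      (\<forall>x. prod_list (map (\<alpha>(k := x)) (map \<sigma> [0..<m])) = fst UV * x * snd UV)"
  proof
    fix \<sigma> assume "\<sigma> \<in> ?S"
    then have w: "distinct (map \<sigma> [0..<m])" "set (map \<sigma> [0..<m]) = {..<m}"
      using standard_word by auto
    then obtain xs ys where split: "map \<sigma> [0..<m] = xs @ k # ys"
      using k split_list[of k "map \<sigma> [0..<m]"] by auto
    have notin: "k \<notin> set xs" "k \<notin> set ys" using w(1) unfolding split by auto
    have sets: "set xs \<subseteq> {..<m}" "set ys \<subseteq> {..<m}" using w(2) unfolding split by auto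
    have "map (\<alpha>(k := x)) vs = map \<alpha> vs" if "k \<notin> set vs" for x vs
      using that by auto
    then have "prod_list (map (\<alpha>(k := x)) (map \<sigma> [0..<m])) = prod_list (map \<alpha> xs) * x * prod_list (map \<alpha> ys)" for x
      unfolding split using notin by (simp add: mult.assoc)
    moreover have "prod_list (map \<alpha> xs) \<in> A1" "prod_list (map \<alpha> ys) \<in> A1"
      using sets \<alpha> by (auto intro!: prod_list_in_A1 simp: subset_iff)
    ultimately show "\<exists>UV. fst UV \<in> A1 \<and> snd UV \<in> A1 \<and>
      (\<forall>x. prod_list (map (\<alpha>(k := x)) (map \<sigma> [0..<m])) = fst UV * x * snd UV)"
      by (intro exI[of _ "(prod_list (map \<alpha> xs), prod_list (map \<alpha> ys))"]) auto
  qed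
  then obtain UV where UV: "\<And>\<sigma>. \<sigma> \<in> ?S \<Longrightarrow> fst (UV \<sigma>) \<in> A1 \<and> snd (UV \<sigma>) \<in> A1"
    "\<And>\<sigma> x. \<sigma> \<in> ?S \<Longrightarrow> prod_list (map (\<alpha>(k := x)) (map \<sigma> [0..<m])) = fst (UV \<sigma>) * x * snd (UV \<sigma>)"
    unfolding bchoice_iff by blast
  show ?thesis
    unfolding standard_sum_def
    by (rule exI[of _ ?S], rule exI[of _ "\<lambda>\<sigma>. of_int (sign \<sigma>)"], rule exI[of _ "\<lambda>\<sigma>. fst (UV \<sigma>)"],
        rule exI[of _ "\<lambda>\<sigma>. snd (UV \<sigma>)"])
      (use UV in \<open>simp del: map_map\<close>)
qed

text \<open>
  By linearity in each variable, the arguments can be restricted to \<open>T\<close> one after the other.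
\<close>

lemma standard_sum_in_ideal_from_spanning_set:
  fixes T :: "(('a, 'b) lpa_gen, 'k::field) free_algebra set"
    and \<alpha> :: "nat \<Rightarrow> (('a, 'b) lpa_gen, 'k) free_algebra"
  assumes T: "T \<subseteq> A0" "A0 \<subseteq> fa.span (T \<union> lpa_ideal G)"
    and base: "\<And>\<alpha>. (\<And>i. i < m \<Longrightarrow> \<alpha> i \<in> T) \<Longrightarrow> standard_sum m \<alpha> \<in> lpa_ideal G"
    and \<alpha>: "\<And>i. i < m \<Longrightarrow> \<alpha> i \<in> A0"
  shows "standard_sum m \<alpha> \<in> lpa_ideal G"
proof -
  have "standard_sum m \<alpha> \<in> lpa_ideal G"
    if "k \<le> m" "\<And>i. i < m \<Longrightarrow> \<alpha> i \<in> A0" "\<And>i. k \<le> i \<Longrightarrow> i < m \<Longrightarrow> \<alpha> i \<in> T" for k \<alpha>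
    using that
  proof (induction k arbitrary: \<alpha>)
    case 0
    then show ?case by (intro base) auto
  next
    case (Suc k)
    have k: "k < m" using Suc.prems(1) by simp
    have \<alpha>A1: "\<forall>l<m. \<alpha> l \<in> A1"
      using Suc.prems(2) A0_in_A1 by blast
    obtain S :: "(nat \<Rightarrow> nat) set" and s U V where
      multilinear: "(\<forall>\<sigma>\<in>S. U \<sigma> \<in> A1 \<and> V \<sigma> \<in> A1) \<and>
        (\<forall>x. standard_sum m (\<alpha>(k := x)) = (\<Sum>\<sigma>\<in>S. scale (s \<sigma>) (U \<sigma> * x * V \<sigma>)))"
      using standard_sum_multilinear[OF k \<alpha>A1] by (elim exE) (rule that)
    have UV: "U \<sigma> \<in> A1 \<and> V \<sigma> \<in> A1" if "\<sigma> \<in> S" for \<sigma>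
      using conjunct1[OF multilinear] that by (rule bspec)
    have lin: "standard_sum m (\<alpha>(k := x)) = (\<Sum>\<sigma>\<in>S. scale (s \<sigma>) (U \<sigma> * x * V \<sigma>))" for x
      using conjunct2[OF multilinear] by (rule spec)
    define X where "X = {x. standard_sum m (\<alpha>(k := x)) \<in> lpa_ideal G}"
    have "fa.subspace X"
      unfolding fa.subspace_def X_def
    proof (intro conjI ballI allI)
      show "0 \<in> {x. standard_sum m (\<alpha>(k := x)) \<in> lpa_ideal G}"
        by (simp add: lin lpa_ideal_closed)
      fix x assume x: "x \<in> {x. standard_sum m (\<alpha>(k := x)) \<in> lpa_ideal G}"
      have "standard_sum m (\<alpha>(k := scale c x)) = scale c (standard_sum m (\<alpha>(k := x)))" for c
        unfolding lin by (simp add: fa.scale_sum_right mult_scale_right scale_mult_left mult.commute)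
      then show "scale c x \<in> {x. standard_sum m (\<alpha>(k := x)) \<in> lpa_ideal G}" for c
        using x by (simp add: lpa_ideal_closed)
      fix y assume y: "y \<in> {x. standard_sum m (\<alpha>(k := x)) \<in> lpa_ideal G}"
      have "standard_sum m (\<alpha>(k := x + y)) = standard_sum m (\<alpha>(k := x)) + standard_sum m (\<alpha>(k := y))"
        unfolding lin by (simp add: distrib_left distrib_right fa.scale_right_distrib sum.distrib)
      then show "x + y \<in> {x. standard_sum m (\<alpha>(k := x)) \<in> lpa_ideal G}"
        using x y by (simp add: lpa_ideal_closed)
    qed
    moreover have "x \<in> X" if "x \<in> lpa_ideal G" for x
      unfolding X_def lin mem_Collect_eq using UV that
      by (intro fa.subspace_sum[OF subspace_lpa_ideal] lpa_ideal_closed(5) lpa_ideal_mult_right lpa_ideal_mult_left) auto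
    moreover have "x \<in> X" if "x \<in> T" for x
      unfolding X_def mem_Collect_eq
    proof (rule Suc.IH)
      fix i assume "i < m"
      then show "(\<alpha>(k := x)) i \<in> A0" using Suc.prems(2)[of i] that T(1) by auto
    next
      fix i assume "k \<le> i" "i < m"
      then show "(\<alpha>(k := x)) i \<in> T" using Suc.prems(3)[of i] that by auto
    qed (use k in simp)
    ultimately have "fa.span (T \<union> lpa_ideal G) \<subseteq> X"
      by (intro fa.span_minimal) auto
    then have "\<alpha> k \<in> X" using Suc.prems(2)[OF k] T(2) by blast
    then show ?case by (simp add: X_def)
  qed
  from this[of m \<alpha>] \<alpha> show ?thesis by simp
qed

text \<open>
  The shape \<open>(p, w, q, w')\<close> stands for the family of all \<open>paq\<^sup>*\<close> where \<open>a\<close> leads from the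
  rigid vertex \<open>w\<close> to the rigid vertex \<open>w'\<close>.
\<close>

definition has_shape ::
  "(('a, 'b) lpa_gen, 'k::field) free_algebra \<Rightarrow> 'b list \<times> 'a \<times> 'b list \<times> 'a \<Rightarrow> bool"
  where "has_shape t = (\<lambda>(p, w, q, w').
    rigid w \<and> rigid w' \<and> set p \<subseteq> arcs G \<and> set q \<subseteq> arcs G \<and>
    (\<exists>d. \<exists>a\<in>monomials_between w w' d. t = wd (map Edge p) * a * wd (map Ghost (rev q))))"

text \<open>
  With \<open>t = paq\<^sup>*\<close> and \<open>t' = pa'q\<^sup>*\<close>, the element \<open>q\<^sup>*zp\<close> stands between \<open>a\<close> and \<open>a'\<close>, so
  \<open>monomials_between_swap\<close> exchanges \<open>a\<close> and \<open>a'\<close>.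
\<close>

lemma same_shape_commute:
  fixes t t' z :: "(('a, 'b) lpa_gen, 'k::field) free_algebra"
  assumes "has_shape t k" "has_shape t' k" "z \<in> A1"
  shows "t * z * t' \<simeq> t' * z * t"
proof -
  obtain p w q w' where k: "k = (p, w, q, w')" by (cases k) auto
  define P :: "(('a, 'b) lpa_gen, 'k) free_algebra" where "P = wd (map Edge p)"
  define Q :: "(('a, 'b) lpa_gen, 'k) free_algebra" where "Q = wd (map Ghost (rev q))"
  have PQ: "P \<in> A1" "Q \<in> A1"
    using assms(1) unfolding k has_shape_def P_def Q_def
    by (auto intro!: wd_in_free_algebra_on simp: subset_iff)
  obtain d a where a: "a \<in> monomials_between w w' d" "t = P * a * Q"
    using assms(1) unfolding k has_shape_def P_def Q_def by auto
  obtain d' a' where a': "a' \<in> monomials_between w w' d'" "t' = P * a' * Q"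
    using assms(2) unfolding k has_shape_def P_def Q_def by auto
  have w: "rigid w" "rigid w'" using assms(1) unfolding k has_shape_def by auto
  have "P * (a * (Q * z * P) * a') * Q \<simeq> P * (a' * (Q * z * P) * a) * Q"
    by (intro eqv_mult_left eqv_mult_right monomials_between_swap[OF w a(1) a'(1)] free_algebra_on_mult PQ assms(3))
  then show ?thesis by (simp add: a a' mult.assoc)
qed

definition shapes :: "('b list \<times> 'a \<times> 'b list \<times> 'a) set"
  where "shapes = short_walks \<times> verts G \<times> short_walks \<times> verts G"

lemma long_monomial_shape:
  assumes "no_exit" "t \<in> long_monomials (card (verts G))"
  shows "\<exists>k\<in>shapes. has_shape t k"
proof -
  let ?N = "card (verts G)"
  obtain p x q u u' where t: "t = path_ghost p x q" "awalk u p x" "awalk u' q x"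
    and long: "out_arcs G x = {} \<or> ?N \<le> length p \<and> ?N \<le> length q"
    using assms(2) unfolding long_monomials_def by blast
  have rigid_end: "rigid v" if "awalk u (take ?N p) v" "awalk v (drop ?N p) x"
      "out_arcs G x = {} \<or> ?N \<le> length p" for u p v
  proof (cases "?N \<le> length p")
    case True
    then show ?thesis
      by (intro cyclic_rigid[OF assms(1)] long_walk_cyclic[OF assms(1) that(1)]) simp
  next
    case False
    then have "v = x" using that(2) by (simp add: awalk_Nil_iff)
    with that(3) False show ?thesis by (simp add: sink_rigid)
  qed
  obtain w where w: "awalk u (take ?N p) w" "awalk w (drop ?N p) x"
    by (rule take_awalk[OF t(2)])
  obtain w' where w': "awalk u' (take ?N q) w'" "awalk w' (drop ?N q) x"
    by (rule take_awalk[OF t(3)])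
  have "t = wd (map Edge (take ?N p)) * path_ghost (drop ?N p) x (drop ?N q) * wd (map Ghost (rev (take ?N q)))"
    unfolding path_ghost_append_left[symmetric] path_ghost_append_right[symmetric] t(1) by simp
  moreover have "path_ghost (drop ?N p) x (drop ?N q) \<in>
      monomials_between w w' (int (length (drop ?N p)) - int (length (drop ?N q)))"
    using w w' unfolding monomials_between_def by blast
  moreover have "rigid w" "rigid w'"
    using rigid_end[OF w] rigid_end[OF w'] long by auto
  moreover have "set (take ?N p) \<subseteq> arcs G" "set (take ?N q) \<subseteq> arcs G"
    using awalk_set_arcs w(1) w'(1) by blast+
  ultimately have "has_shape t (take ?N p, w, take ?N q, w')"
    unfolding has_shape_def by blast
  moreover have "(take ?N p, w, take ?N q, w') \<in> shapes"
    unfolding shapes_def using t w w' by (auto intro: take_in_short_walks dest: awalk_hd_in_verts)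
  ultimately show ?thesis by blast
qed

text \<open>
  Among more elements of the spanning set than there are shapes, two have the same shape, and the
  standard polynomial is alternating with respect to them.
\<close>

lemma PI_if_no_exit:
  assumes "no_exit"
  shows "PI_algebra (leavitt_path_algebra TYPE('k::field) G)"
proof -
  define m where "m = Suc (card shapes)"
  define T :: "(('a, 'b) lpa_gen, 'k) free_algebra set" where "T = long_monomials (card (verts G))"
  have fin: "finite shapes"
    unfolding shapes_def by (intro finite_cartesian_product finite_short_walks finite_verts)
  have "\<forall>t\<in>T. \<exists>k. k \<in> shapes \<and> has_shape t k"
    using long_monomial_shape[OF assms] unfolding T_def by blast
  then obtain \<kappa> where \<kappa>: "\<And>t. t \<in> T \<Longrightarrow> \<kappa> t \<in> shapes" "\<And>t. t \<in> T \<Longrightarrow> has_shape t (\<kappa> t)"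
    unfolding bchoice_iff by blast
  have TA: "T \<subseteq> A0" unfolding T_def by (rule long_monomials_subset)
  have base: "standard_sum m \<alpha> \<in> lpa_ideal G" if \<alpha>: "\<And>i. i < m \<Longrightarrow> \<alpha> i \<in> T" for \<alpha>
  proof -
    have "(\<lambda>i. \<kappa> (\<alpha> i)) ` {..<m} \<subseteq> shapes" using \<kappa>(1) \<alpha> by auto
    then have "card ((\<lambda>i. \<kappa> (\<alpha> i)) ` {..<m}) < card {..<m}"
      using card_mono[OF fin] by (simp add: m_def less_Suc_eq_le)
    then obtain i j where ij: "i < m" "j < m" "i \<noteq> j" "\<kappa> (\<alpha> i) = \<kappa> (\<alpha> j)"
      using pigeonhole[of "\<lambda>i. \<kappa> (\<alpha> i)" "{..<m}"] unfolding inj_on_def by auto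
    show ?thesis
    proof (rule standard_sum_alternating[OF ij(1-3)])
      show "\<alpha> l \<in> A1" if "l < m" for l using \<alpha>[OF that] TA A0_in_A1 by blast
      show "\<alpha> i * z * \<alpha> j \<simeq> \<alpha> j * z * \<alpha> i" if "z \<in> A1" for z
        using same_shape_commute[OF \<kappa>(2)[OF \<alpha>[OF ij(1)]] _ that] \<kappa>(2)[OF \<alpha>[OF ij(2)]] ij(4) by simp
    qed
  qed
  have "subst_poly (standard_poly m) \<alpha> \<in> lpa_ideal G" if "\<forall>i. \<alpha> i \<in> A0"
    for \<alpha> :: "nat \<Rightarrow> (('a, 'b) lpa_gen, 'k) free_algebra"
    unfolding subst_standard_poly using that A0_subset_span_long[of "card (verts G)"]
    by (intro lpa_ideal_mult_right A0_in_A1 unit_elt_in_A0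
        standard_sum_in_ideal_from_spanning_set[OF TA _ base]) (auto simp: T_def)
  moreover have "Letters [0..<m] \<in> Poly_Mapping.keys (standard_poly m :: (nat, 'k) free_algebra)"
    by (simp add: in_keys_iff lookup_standard_poly_id)
  ultimately show ?thesis
    unfolding PI_algebra_lpa_iff
    by (intro exI[of _ "standard_poly m"] conjI bexI[of _ "Letters [0..<m]"])
      (auto simp: lookup_standard_poly_id keys_standard_poly)
qed

lemma PI_iff_no_exit: "PI_algebra (leavitt_path_algebra TYPE('k::field) G) \<longleftrightarrow> no_exit"
  using PI_if_no_exit not_PI_if_cycle_exit unfolding no_exit_def by blast

lemma bounded_iff_no_exit:
  "bdd_above (range (\<lambda>n::nat. vectorspace.dim class_ring (filtration_quotient TYPE('k::field) G (int n))))
    \<longleftrightarrow> no_exit"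
proof
  assume "no_exit"
  then show "bdd_above (range (\<lambda>n::nat. vectorspace.dim class_ring (filtration_quotient TYPE('k) G (int n))))"
    by (intro bdd_aboveI2[where M = "2 * card (short_walks \<times> verts G \<times> short_walks)"] dim_filtration_quotient_le)
next
  assume "bdd_above (range (\<lambda>n::nat. vectorspace.dim class_ring (filtration_quotient TYPE('k) G (int n))))"
  then obtain M where M: "\<And>n. vectorspace.dim class_ring (filtration_quotient TYPE('k) G (int n)) \<le> M"
    unfolding bdd_above_def by auto
  show no_exit
    unfolding no_exit_def
  proof clarify
    fix v c f assume "cycle_exit v c f"
    from dim_filtration_quotient_ge[OF this, of M, where ?'k = 'k] M[of "M * length c + 2"]
    show False by simp
  qed
qed

end

theorem theorem3p26:
  fixes E :: "('v, 'e) pre_digraph"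
  assumes "fin_digraph E"
  shows "PI_algebra (leavitt_path_algebra TYPE('k::field) E) \<longleftrightarrow>
    bdd_above (range (\<lambda>n::nat.
      vectorspace.dim class_ring (filtration_quotient TYPE('k) E (int n))))"
proof -
  interpret fin_digraph E by (rule assms)
  show ?thesis unfolding PI_iff_no_exit bounded_iff_no_exit ..
qed

end
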